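(* Let $q$ be a prime power and let $r,d\ge3$. Set $R_+=\mathbb{F}_q[x_1,\dots,x_d]$ and $R=\mathbb{F}_q[x_1^{\pm1},\dots,x_d^{\pm1}]$, and let $\operatorname{SL}_d(\mathbb{Z})$ act on $R$ by monomial substitutions. Let $\Gamma$ and $G$ be the finitely generated groups $$\Gamma:=\operatorname{EL}_r(R_+),\qquad G:=\operatorname{EL}_r(R)\rtimes\operatorname{SL}_d(\mathbb{Z}),$$ with $\Gamma$ regarded as a subgroup of $G$. Then the generalized wreath product $(\mathbb{Z}/2\mathbb{Z})\wr_{G/\Gamma}G$ and the amalgamated free product $G*_\Gamma G$ have Property A.
   Context: $\operatorname{EL}_r(A)$ is the subgroup of $\operatorname{GL}_r(A)$ generated by the elementary matrices over the commutative ring $A$. The action of $\operatorname{SL}_d(\mathbb{Z})$ on $R$ permutes the monomials via the linear action on exponent vectors in $\mathbb{Z}^d$, and induces the action on $\operatorname{EL}_r(R)$ used in the semidirect product. The inclusion $R_+\subseteq R$ gives $\Gamma\le\operatorname{EL}_r(R)\le G$. The generalized wreath product is $(\mathbb{Z}/2\mathbb{Z})\wr_{G/\Gamma}G=\big(\bigoplus_{G/\Gamma}\mathbb{Z}/2\mathbb{Z}\big)\rtimes G$, where $G$ permutes the coordinates via its action on $G/\Gamma$. A discrete metric space $X$ with bounded geometry has Property A if for every $R>0$ and $\epsilon>0$ there exist a map $\tau:X\to S(\ell^1(X))$ (unit sphere of $\ell^1(X)$) and a constant $c>0$ such that $d(x,y)\le R$ implies $\|\tau(x)-\tau(y)\|\le\epsilon$,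 and the support of $\tau(x)$ is contained in the closed ball of radius $c$ centered at $x$ for every $x\in X$. A finitely generated group has Property A if it does so as a metric space with a word length metric. *)

theory Defs
  imports
    "HOL-Analysis.Analysis"
    "HOL-Library.Poly_Mapping"
    "HOL-Algebra.Left_Coset"
    "HOL-Algebra.Product_Groups"
    "HOL-Algebra.Elementary_Groups"
    "HOL-Number_Theory.Prime_Powers"
begin

section \<open>Property A\<close>

definition l1_norm :: "'a set \<Rightarrow> ('a \<Rightarrow> real) \<Rightarrow> real" where
  "l1_norm X f = (\<Sum>\<^sub>\<infinity>z\<in>X. \<bar>f z\<bar>)"

definition l1_unit_sphere :: "'a set \<Rightarrow> ('a \<Rightarrow> real) set" where
  "l1_unit_sphere X = {f. (\<lambda>z. \<bar>f z\<bar>) summable_on X \<and> l1_norm X f = 1}"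

text \<open>
  This is the notion for discrete metric spaces of bounded geometry; below it is only applied to
  finitely generated groups with a word metric, which are of this kind. Elements of
  \<open>\<ell>\<^sup>1(X)\<close> are real functions of which only the values on \<open>X\<close> matter.
\<close>

definition property_A :: "'a set \<Rightarrow> ('a \<Rightarrow> 'a \<Rightarrow> real) \<Rightarrow> bool" where
  "property_A X d \<longleftrightarrow>
     (\<forall>R>0. \<forall>\<epsilon>>0. \<exists>(\<tau> :: 'a \<Rightarrow> 'a \<Rightarrow> real) c. c > 0 \<and>
        (\<forall>x\<in>X. \<tau> x \<in> l1_unit_sphere X) \<and>
        (\<forall>x\<in>X. \<forall>y\<in>X. d x y \<le> R \<longrightarrow> l1_norm X (\<lambda>z. \<tau> x z - \<tau> y z) \<le> \<epsilon>) \<and>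
        (\<forall>x\<in>X. {z\<in>X. \<tau> x z \<noteq> 0} \<subseteq> {z\<in>X. d x z \<le> c}))"

definition finite_generating_set :: "('a, 'b) monoid_scheme \<Rightarrow> 'a set \<Rightarrow> bool" where
  "finite_generating_set G S \<longleftrightarrow> finite S \<and> S \<subseteq> carrier G \<and> generate G S = carrier G"

definition finitely_generated :: "('a, 'b) monoid_scheme \<Rightarrow> bool" where
  "finitely_generated G \<longleftrightarrow> (\<exists>S. finite_generating_set G S)"

definition word_length :: "('a, 'b) monoid_scheme \<Rightarrow> 'a set \<Rightarrow> 'a \<Rightarrow> nat" where
  "word_length G S g =
     (LEAST n. \<exists>ws. length ws = n \<and> set ws \<subseteq> S \<union> m_inv G ` S \<and> foldr (mult G) ws \<one>\<^bsub>G\<^esub> = g)"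

definition word_metric :: "('a, 'b) monoid_scheme \<Rightarrow> 'a set \<Rightarrow> 'a \<Rightarrow> 'a \<Rightarrow> real" where
  "word_metric G S g h = real (word_length G S (inv\<^bsub>G\<^esub> g \<otimes>\<^bsub>G\<^esub> h))"

text \<open>
  Word metrics of different finite generating sets are bi-Lipschitz equivalent, hence the choice of
  \<open>S\<close> is immaterial.
\<close>

definition group_property_A :: "('a, 'b) monoid_scheme \<Rightarrow> bool" where
  "group_property_A G \<longleftrightarrow>
     (\<exists>S. finite_generating_set G S \<and> property_A (carrier G) (word_metric G S))"


section \<open>Constructions on groups\<close>

text \<open>\<open>\<phi>\<close> is meant to be an action of \<open>K\<close> on \<open>H\<close> by group automorphisms.\<close>

definition semidirect_product ::
    "('h, 'x) monoid_scheme \<Rightarrow> ('k, 'y) monoid_scheme \<Rightarrow> ('k \<Rightarrow> 'h \<Rightarrow> 'h) \<Rightarrow> ('h \<times> 'k) monoid" where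
  "semidirect_product H K \<phi> =
     \<lparr>carrier = carrier H \<times> carrier K,
      mult = (\<lambda>(h, k) (h', k'). (h \<otimes>\<^bsub>H\<^esub> \<phi> k h', k \<otimes>\<^bsub>K\<^esub> k')),
      one = (\<one>\<^bsub>H\<^esub>, \<one>\<^bsub>K\<^esub>)\<rparr>"

text \<open>
  The action on the direct sum over \<open>G/H\<close> is \<open>(g \<cdot> f)(c) = f(g\<^sup>-\<^sup>1 c)\<close>; the restriction to the set
  of left cosets is there because elements of \<^const>\<open>sum_group\<close> are extensional functions.
\<close>

definition generalized_wreath_product ::
    "('a, 'x) monoid_scheme \<Rightarrow> ('g, 'y) monoid_scheme \<Rightarrow> 'g set \<Rightarrow> (('g set \<Rightarrow> 'a) \<times> 'g) monoid" where
  "generalized_wreath_product A G H =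
     semidirect_product (sum_group (lcosets\<^bsub>G\<^esub> H) (\<lambda>_. A)) G
       (\<lambda>g f. \<lambda>c\<in>lcosets\<^bsub>G\<^esub> H. f (inv\<^bsub>G\<^esub> g <#\<^bsub>G\<^esub> c))"

text \<open>
  The amalgamated free product of \<open>G\<^sub>1\<close> and \<open>G\<^sub>2\<close> along embeddings \<open>f\<^sub>1\<close>, \<open>f\<^sub>2\<close> of \<open>C\<close>: words in the
  disjoint union of \<open>G\<^sub>1\<close> and \<open>G\<^sub>2\<close> modulo the least congruence that contains the multiplication
  tables of both groups and identifies \<open>f\<^sub>1 c\<close> with \<open>f\<^sub>2 c\<close> for all \<open>c\<close> in \<open>C\<close>.
\<close>

definition amalgam_words ::
    "('a, 'x) monoid_scheme \<Rightarrow> ('b, 'y) monoid_scheme \<Rightarrow> ('a + 'b) list set" where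
  "amalgam_words G1 G2 = lists (carrier G1 <+> carrier G2)"

inductive amalgam_cong ::
    "('a, 'x) monoid_scheme \<Rightarrow> ('b, 'y) monoid_scheme \<Rightarrow> ('c, 'z) monoid_scheme \<Rightarrow>
     ('c \<Rightarrow> 'a) \<Rightarrow> ('c \<Rightarrow> 'b) \<Rightarrow> ('a + 'b) list \<Rightarrow> ('a + 'b) list \<Rightarrow> bool"
  for G1 G2 C f1 f2 where
  refl: "w \<in> amalgam_words G1 G2 \<Longrightarrow> amalgam_cong G1 G2 C f1 f2 w w"
| sym: "amalgam_cong G1 G2 C f1 f2 v w \<Longrightarrow> amalgam_cong G1 G2 C f1 f2 w v"
| trans: "amalgam_cong G1 G2 C f1 f2 u v \<Longrightarrow> amalgam_cong G1 G2 C f1 f2 v w \<Longrightarrow>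
    amalgam_cong G1 G2 C f1 f2 u w"
| append: "amalgam_cong G1 G2 C f1 f2 v v' \<Longrightarrow> amalgam_cong G1 G2 C f1 f2 w w' \<Longrightarrow>
    amalgam_cong G1 G2 C f1 f2 (v @ w) (v' @ w')"
| one_left: "amalgam_cong G1 G2 C f1 f2 [Inl \<one>\<^bsub>G1\<^esub>] []"
| one_right: "amalgam_cong G1 G2 C f1 f2 [Inr \<one>\<^bsub>G2\<^esub>] []"
| mult_left: "x \<in> carrier G1 \<Longrightarrow> y \<in> carrier G1 \<Longrightarrow>
    amalgam_cong G1 G2 C f1 f2 [Inl x, Inl y] [Inl (x \<otimes>\<^bsub>G1\<^esub> y)]"
| mult_right: "x \<in> carrier G2 \<Longrightarrow> y \<in> carrier G2 \<Longrightarrow>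
    amalgam_cong G1 G2 C f1 f2 [Inr x, Inr y] [Inr (x \<otimes>\<^bsub>G2\<^esub> y)]"
| amalgamate: "c \<in> carrier C \<Longrightarrow> amalgam_cong G1 G2 C f1 f2 [Inl (f1 c)] [Inr (f2 c)]"

definition amalgamated_free_product ::
    "('a, 'x) monoid_scheme \<Rightarrow> ('b, 'y) monoid_scheme \<Rightarrow> ('c, 'z) monoid_scheme \<Rightarrow>
     ('c \<Rightarrow> 'a) \<Rightarrow> ('c \<Rightarrow> 'b) \<Rightarrow> ('a + 'b) list set monoid" where
  "amalgamated_free_product G1 G2 C f1 f2 =
     (let E = {(v, w). amalgam_cong G1 G2 C f1 f2 v w} in
      \<lparr>carrier = amalgam_words G1 G2 // E,
       mult = (\<lambda>V W. \<Union>v\<in>V. \<Union>w\<in>W. E `` {v @ w}),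
       one = E `` {[]}\<rparr>)"


section \<open>Linear groups over Laurent polynomial rings\<close>

text \<open>
  For a subring \<open>A\<close> of the ambient ring, \<open>GL_over A\<close> and \<open>EL_over A\<close> are
  \<open>GL\<^sub>r(A)\<close> and \<open>EL\<^sub>r(A)\<close>, with \<open>r\<close> the cardinality of the index type.
\<close>

definition GL_over :: "'a::comm_ring_1 set \<Rightarrow> ('a ^ 'r::finite ^ 'r) monoid" where
  "GL_over A =
     (let M = {P :: 'a ^ 'r ^ 'r. \<forall>i j. P $ i $ j \<in> A} in
      \<lparr>carrier = {P \<in> M. \<exists>Q\<in>M. P ** Q = mat 1 \<and> Q ** P = mat 1},
       mult = (**),
       one = mat 1\<rparr>)"

definition elementary_matrix :: "'r \<Rightarrow> 'r \<Rightarrow> 'a \<Rightarrow> 'a::comm_ring_1 ^ 'r::finite ^ 'r" where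
  "elementary_matrix i j a = mat 1 + (\<chi> k l. if k = i \<and> l = j then a else 0)"

definition EL_over :: "'a::comm_ring_1 set \<Rightarrow> ('a ^ 'r::finite ^ 'r) monoid" where
  "EL_over A = subgroup_generated (GL_over A) {elementary_matrix i j a |i j a. i \<noteq> j \<and> a \<in> A}"

definition SL_int :: "(int ^ 'd::finite ^ 'd) monoid" where
  "SL_int = \<lparr>carrier = {M. det M = 1}, mult = (**), one = mat 1\<rparr>"

text \<open>
  The Laurent polynomial ring in \<open>d\<close> variables is the group algebra of \<open>\<int>\<^sup>d\<close>: finitely supported
  functions on exponent vectors, whose multiplication in \<^theory>\<open>HOL-Library.Poly_Mapping\<close> is
  convolution. The monomial \<open>x\<^sup>v\<close> is \<open>Poly_Mapping.single v 1\<close>.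
\<close>

type_synonym ('k, 'd) laurent = "(int ^ 'd) \<Rightarrow>\<^sub>0 'k"

definition polynomials :: "('k::comm_ring_1, 'd::finite) laurent set" where
  "polynomials = {p. \<forall>v\<in>Poly_Mapping.keys p. \<forall>i. 0 \<le> v $ i}"

text \<open>The monomial substitution \<open>x\<^sup>v \<mapsto> x\<^bsup>Mv\<^esup>\<close>, extended linearly.\<close>

definition monomial_act ::
    "int ^ 'd::finite ^ 'd \<Rightarrow> ('k::comm_ring_1, 'd) laurent \<Rightarrow> ('k, 'd) laurent" where
  "monomial_act M p =
     (\<Sum>v\<in>Poly_Mapping.keys p. Poly_Mapping.single (M *v v) (Poly_Mapping.lookup p v))"

definition EL_semidirect_SL ::
    "((('k::comm_ring_1, 'd::finite) laurent ^ 'r::finite ^ 'r) \<times> (int ^ 'd ^ 'd)) monoid" where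
  "EL_semidirect_SL =
     semidirect_product (EL_over UNIV) SL_int (\<lambda>M P. \<chi> i j. monomial_act M (P $ i $ j))"

end

theory Submission
  imports Defs "HOL-Probability.Probability_Mass_Function"
    "HOL-Computational_Algebra.Formal_Laurent_Series" "HOL-Computational_Algebra.Polynomial_Factorial"
begin

text \<open>
  For a finitely generated group, Property A says that the points \<open>x\<close> of the group carry probability
  measures \<open>\<tau> x\<close> that hardly change when \<open>x\<close> is multiplied from the right by an element of a given
  finite set, and whose supports lie in \<open>x E\<close> for one finite set \<open>E\<close>. This condition, called
  \<open>exact_group\<close> below, no longer mentions a word metric, and it is flexible: the measures may live on
  any set whatsoever, provided that \<open>\<tau> x\<close> and \<open>\<tau> y\<close> have disjoint supports unless \<open>x\<^sup>-\<^sup>1 y\<close> lies in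
  a fixed finite set (\<open>exact_groupI\<close>).

  \<^emph>\<open>Reduction to \<open>G\<close>.\<close> Exactness passes to subgroups (\<open>exact_group_inj_hom\<close>) and to semidirect
  products (\<open>semidirect.exact_SD\<close>). The base group of the wreath product is locally finite, hence
  exact, so the wreath product is exact as soon as \<open>G\<close> is. For the amalgam \<open>G *\<^sub>H G\<close>, let \<open>W\<close> be the
  group generated by one involution \<open>t\<^sub>c\<close> for every coset \<open>c\<close> in \<open>G/H\<close>, without further relations,
  and let \<open>G\<close> permute the generators. In \<open>W \<rtimes> G\<close> the involution \<open>t\<close> of the trivial coset commutes with
  exactly those elements of \<open>G\<close> that lie in \<open>H\<close>, and the subgroup generated by \<open>t G t\<close> and \<open>G\<close> is the
  amalgam (\<open>double.embed_inj\<close>). The group \<open>W\<close> is exact because its Cayley graph is a tree: average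
  over a long piece of the path from \<open>x\<close> to the root (\<open>exact_coxeter\<close>).

  \<^emph>\<open>Linear groups.\<close> Let \<open>K\<close> be a field with an absolute value and let a group be mapped to
  \<open>GL\<^sub>r(K)\<close>. Up to bounded factors every matrix is upper triangular with powers of a fixed element
  \<open>\<pi>\<close> on the diagonal (\<open>iwasawa\<close>). Move such a matrix \<open>b\<close> to \<open>b t\<close>, where \<open>t\<close> runs over the diagonal
  matrices \<open>\<pi>\<^bsup>k\<^esup>\<close> with \<open>k\<close> in a large box of \<open>\<int>\<^sup>r\<close> deep inside the Weyl chamber. Conjugation by
  these \<open>t\<close> contracts bounded unipotent matrices to almost \<open>1\<close>, and the average over the box
  hardly notices a bounded shift of \<open>k\<close>. Hence a bounded change of \<open>b\<close> hardly changes the resulting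
  measure (\<open>gl_sampling_almost_invariant\<close>). The outcome is exactness relative to the
  subsets of the group on which the given linear representation is bounded.

  \<^emph>\<open>From bounded to finite.\<close> A bounded set of integer matrices is finite, so the real absolute value
  alone shows that \<open>SL\<^sub>d(\<int>)\<close> is exact. The ring \<open>R\<close> has \<open>2d\<close> gradings, by the degrees in
  \<open>x\<^sub>i\<close> and by their negatives; each of them yields an embedding of \<open>R\<close> into a field of
  Laurent series, which carries the absolute value of the order in the series variable. A Laurent
  polynomial that is bounded for all \<open>2d\<close> absolute values has its exponents in a fixed box, and as the
  coefficient field is finite there are only finitely many of these. The product of the \<open>2d\<close> families of
  measures therefore shows that \<open>EL\<^sub>r(R)\<close> is exact (\<open>exact_EL_laurent\<close>), and so is \<open>G\<close>.
\<close>

text \<open>The infix \<open>$\<close> is reserved for the components of vectors and matrices.\<close>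

no_notation fps_nth (infixl \<open>$\<close> 75)

section \<open>Exactness of groups\<close>

text \<open>
  Up to the factor that depends on the normalisation this is the total variation distance. Testing
  against bounded functions makes the behaviour under \<open>bind_pmf\<close> immediate.
\<close>

definition pmf_close :: "real \<Rightarrow> 'y pmf \<Rightarrow> 'y pmf \<Rightarrow> bool" where
  "pmf_close \<epsilon> p q \<longleftrightarrow>
     (\<forall>f :: 'y \<Rightarrow> real. (\<forall>y. \<bar>f y\<bar> \<le> 1) \<longrightarrow>
        \<bar>measure_pmf.expectation p f - measure_pmf.expectation q f\<bar> \<le> \<epsilon>)"

lemma pmf_closeD:
  fixes f :: "'y \<Rightarrow> real"
  shows "pmf_close \<epsilon> p q \<Longrightarrow> (\<And>y. \<bar>f y\<bar> \<le> 1) \<Longrightarrow>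
    \<bar>measure_pmf.expectation p f - measure_pmf.expectation q f\<bar> \<le> \<epsilon>"
  by (simp add: pmf_close_def)

lemma pmf_close_refl: "0 \<le> \<epsilon> \<Longrightarrow> pmf_close \<epsilon> p p"
  by (simp add: pmf_close_def)

lemma pmf_close_sym: "pmf_close \<epsilon> p q \<Longrightarrow> pmf_close \<epsilon> q p"
  by (simp add: pmf_close_def abs_minus_commute)

lemma pmf_close_mono: "pmf_close \<epsilon> p q \<Longrightarrow> \<epsilon> \<le> \<delta> \<Longrightarrow> pmf_close \<delta> p q"
  by (meson order_trans pmf_close_def)

lemma pmf_close_trans:
  assumes "pmf_close \<epsilon> p q" "pmf_close \<delta> q r"
  shows "pmf_close (\<epsilon> + \<delta>) p r"
  unfolding pmf_close_def
proof (intro allI impI)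
  fix f :: "'a \<Rightarrow> real" assume f: "\<forall>y. \<bar>f y\<bar> \<le> 1"
  show "\<bar>measure_pmf.expectation p f - measure_pmf.expectation r f\<bar> \<le> \<epsilon> + \<delta>"
    using pmf_closeD[OF assms(1), of f] pmf_closeD[OF assms(2), of f] f by simp
qed

lemma integral_bounded_bind_pmf:
  fixes f :: "'y \<Rightarrow> real"
  assumes "\<And>y. \<bar>f y\<bar> \<le> B"
  shows "measure_pmf.expectation (bind_pmf p F) f =
    measure_pmf.expectation p (\<lambda>x. measure_pmf.expectation (F x) f)"
  unfolding measure_pmf_bind
  by (rule integral_bind[where K = "count_space UNIV" and B' = 1 and B = B])
     (use assms measurable_measure_pmf[of F] in
        \<open>auto simp: measure_pmf.emeasure_space_1[simplified] simp del: measure_pmf_bind\<close>)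

lemma abs_expectation_le:
  fixes f :: "'y \<Rightarrow> real"
  assumes "\<And>y. y \<in> set_pmf p \<Longrightarrow> \<bar>f y\<bar> \<le> B" "0 \<le> B"
  shows "\<bar>measure_pmf.expectation p f\<bar> \<le> B"
proof -
  have "norm (measure_pmf.expectation p f) \<le> measure_pmf.expectation p (\<lambda>x. norm (f x))"
    by (rule integral_norm_bound)
  also have "\<dots> \<le> B"
    using assms
    by (intro measure_pmf.integral_le_const measure_pmf.integrable_const_bound[where B = B])
       (auto simp: AE_measure_pmf_iff)
  finally show ?thesis by simp
qed

lemma integrable_bounded_pmf:
  fixes f :: "'y \<Rightarrow> real"
  assumes "\<And>y. \<bar>f y\<bar> \<le> B"
  shows "integrable (measure_pmf p) f"
  using assms by (intro measure_pmf.integrable_const_bound[where B = B]) auto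

lemma pmf_close_bind_left:
  assumes "pmf_close \<epsilon> p q"
  shows "pmf_close \<epsilon> (bind_pmf p F) (bind_pmf q F)"
  unfolding pmf_close_def
proof (intro allI impI)
  fix f :: "'b \<Rightarrow> real" assume f: "\<forall>y. \<bar>f y\<bar> \<le> 1"
  show "\<bar>measure_pmf.expectation (bind_pmf p F) f - measure_pmf.expectation (bind_pmf q F) f\<bar> \<le> \<epsilon>"
    using f by (subst (1 2) integral_bounded_bind_pmf[where B = 1])
      (auto intro!: pmf_closeD[OF assms] abs_expectation_le)
qed

lemma pmf_close_bind_right:
  assumes "\<And>x. x \<in> set_pmf p \<Longrightarrow> pmf_close \<epsilon> (F x) (F' x)" "0 \<le> \<epsilon>"
  shows "pmf_close \<epsilon> (bind_pmf p F) (bind_pmf p F')"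
  unfolding pmf_close_def
proof (intro allI impI)
  fix f :: "'b \<Rightarrow> real" assume f: "\<forall>y. \<bar>f y\<bar> \<le> 1"
  have "\<bar>measure_pmf.expectation (F x) f\<bar> \<le> 1" "\<bar>measure_pmf.expectation (F' x) f\<bar> \<le> 1" for x
    using f by (auto intro!: abs_expectation_le)
  then have "measure_pmf.expectation (bind_pmf p F) f - measure_pmf.expectation (bind_pmf p F') f =
    measure_pmf.expectation p (\<lambda>x. measure_pmf.expectation (F x) f - measure_pmf.expectation (F' x) f)"
    using f by (subst (1 2) integral_bounded_bind_pmf[where B = 1])
      (auto intro!: Bochner_Integration.integral_diff[symmetric] integrable_bounded_pmf[where B = 1])
  moreover have "\<bar>\<dots>\<bar> \<le> \<epsilon>"
    using assms f by (intro abs_expectation_le) (auto intro: pmf_closeD)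
  ultimately show "\<bar>measure_pmf.expectation (bind_pmf p F) f - measure_pmf.expectation (bind_pmf p F') f\<bar> \<le> \<epsilon>"
    by simp
qed

lemma pmf_close_map:
  assumes "pmf_close \<epsilon> p q"
  shows "pmf_close \<epsilon> (map_pmf g p) (map_pmf g q)"
  using pmf_close_bind_left[OF assms] by (simp add: map_pmf_def)

text \<open>
  The uniform measures on two sets of the same size are close if the sets almost coincide; this is
  the Folner argument.
\<close>

lemma pmf_close_uniform:
  assumes "finite A" "finite B" "card A = n" "card B = n" "0 < n" "card (A - B) \<le> m"
  shows "pmf_close (2 * real m / real n) (pmf_of_set A) (pmf_of_set B)"
  unfolding pmf_close_def
proof (intro allI impI)
  fix f :: "'a \<Rightarrow> real" assume f: "\<forall>y. \<bar>f y\<bar> \<le> 1"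
  have ne: "A \<noteq> {}" "B \<noteq> {}" using assms by auto
  have cBA: "card (B - A) \<le> m"
    using card_le_sym_Diff[of B A] assms by simp
  have bd: "\<bar>sum f X\<bar> \<le> real m" if "card X \<le> m" for X
  proof -
    have "\<bar>sum f X\<bar> \<le> (\<Sum>x\<in>X. \<bar>f x\<bar>)" by (rule sum_abs)
    also have "\<dots> \<le> (\<Sum>x\<in>X. 1)" using f by (intro sum_mono) auto
    finally show ?thesis using that by simp
  qed
  have "sum f A - sum f B = sum f (A - B) - sum f (B - A)"
    using sum.Int_Diff[OF assms(1), of f B] sum.Int_Diff[OF assms(2), of f A]
    by (simp add: Int_commute)
  then have "\<bar>sum f A - sum f B\<bar> \<le> 2 * real m"
    using bd[OF assms(6)] bd[OF cBA] by linarith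
  then have "\<bar>(sum f A - sum f B) / real n\<bar> \<le> 2 * real m / real n"
    unfolding abs_divide using assms(5) by (simp add: divide_right_mono)
  then show "\<bar>measure_pmf.expectation (pmf_of_set A) f - measure_pmf.expectation (pmf_of_set B) f\<bar>
      \<le> 2 * real m / real n"
    using assms ne by (simp add: integral_pmf_of_set diff_divide_distrib)
qed

lemma abs_diff_sgn: "\<bar>a - b\<bar> = sgn (a - b) * a - sgn (a - b) * (b :: real)"
  by (cases a b rule: linorder_cases) auto

text \<open>
  The distance in \<open>\<ell>\<^sup>1\<close> is attained on the test function that is the sign of the difference.
\<close>

lemma pmf_close_l1:
  assumes "pmf_close \<epsilon> p q" "finite A" "set_pmf p \<subseteq> A" "set_pmf q \<subseteq> A"
  shows "(\<Sum>z\<in>A. \<bar>pmf p z - pmf q z\<bar>) \<le> \<epsilon>"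
proof -
  define f where "f z = sgn (pmf p z - pmf q z)" for z
  have 1: "\<bar>f z\<bar> \<le> 1" for z by (simp add: f_def sgn_if)
  have "measure_pmf.expectation p f = (\<Sum>z\<in>A. f z * pmf p z)"
    using assms by (intro integral_measure_pmf_real) auto
  moreover have "measure_pmf.expectation q f = (\<Sum>z\<in>A. f z * pmf q z)"
    using assms by (intro integral_measure_pmf_real) auto
  moreover have "(\<Sum>z\<in>A. \<bar>pmf p z - pmf q z\<bar>) = (\<Sum>z\<in>A. f z * pmf p z) - (\<Sum>z\<in>A. f z * pmf q z)"
    unfolding sum_subtractf[symmetric]
    unfolding f_def by (rule sum.cong[OF HOL.refl]) (rule abs_diff_sgn)
  ultimately show ?thesis using pmf_closeD[OF assms(1), of f, OF 1] by simp
qed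

text \<open>
  Right multiplication by \<open>s\<close> moves every point of the group by at most the word length of \<open>s\<close>, so
  this condition replaces the one on points at bounded distance.
\<close>

definition almost_invariant :: "('a, 'b) monoid_scheme \<Rightarrow> real \<Rightarrow> 'a set \<Rightarrow> ('a \<Rightarrow> 'y pmf) \<Rightarrow> bool" where
  "almost_invariant G \<epsilon> F \<tau> \<longleftrightarrow>
     (\<forall>x\<in>carrier G. \<forall>s\<in>F. pmf_close \<epsilon> (\<tau> x) (\<tau> (x \<otimes>\<^bsub>G\<^esub> s)))"

text \<open>
  The set \<open>E\<close> plays the role of a ball: measures at points that are not \<open>E\<close>-close to each
  other do not interact. The measures may live on an arbitrary set; this is what makes the notion
  convenient to verify.
\<close>

definition localized :: "('a, 'b) monoid_scheme \<Rightarrow> 'a set \<Rightarrow> ('a \<Rightarrow> 'y pmf) \<Rightarrow> bool" where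
  "localized G E \<tau> \<longleftrightarrow>
     (\<forall>x\<in>carrier G. \<forall>y\<in>carrier G. set_pmf (\<tau> x) \<inter> set_pmf (\<tau> y) \<noteq> {} \<longrightarrow> inv\<^bsub>G\<^esub> x \<otimes>\<^bsub>G\<^esub> y \<in> E)"

definition exact_group :: "('a, 'b) monoid_scheme \<Rightarrow> bool" where
  "exact_group G \<longleftrightarrow>
     (\<forall>F \<epsilon>. finite F \<longrightarrow> F \<subseteq> carrier G \<longrightarrow> \<epsilon> > 0 \<longrightarrow>
        (\<exists>(\<tau> :: 'a \<Rightarrow> 'a pmf) E. almost_invariant G \<epsilon> F \<tau> \<and> finite E \<and> E \<subseteq> carrier G \<and>
           (\<forall>x\<in>carrier G. set_pmf (\<tau> x) \<subseteq> (\<lambda>e. x \<otimes>\<^bsub>G\<^esub> e) ` E)))"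

lemma exact_groupE:
  assumes "exact_group G" "finite F" "F \<subseteq> carrier G" "\<epsilon> > 0"
  obtains \<tau> :: "'a \<Rightarrow> 'a pmf" and E where "almost_invariant G \<epsilon> F \<tau>" "finite E" "E \<subseteq> carrier G"
    "\<And>x y. x \<in> carrier G \<Longrightarrow> y \<in> set_pmf (\<tau> x) \<Longrightarrow> \<exists>e\<in>E. y = x \<otimes>\<^bsub>G\<^esub> e"
proof -
  obtain \<tau> :: "'a \<Rightarrow> 'a pmf" and E where E: "almost_invariant G \<epsilon> F \<tau>" "finite E" "E \<subseteq> carrier G"
      "\<forall>x\<in>carrier G. set_pmf (\<tau> x) \<subseteq> (\<lambda>e. x \<otimes>\<^bsub>G\<^esub> e) ` E"
    using assms(1)[unfolded exact_group_def, rule_format, OF assms(2,3,4)] by blast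
  from E(4) have "\<exists>e\<in>E. y = x \<otimes>\<^bsub>G\<^esub> e" if "x \<in> carrier G" "y \<in> set_pmf (\<tau> x)" for x y
    using that by blast
  with E(1-3) show ?thesis by (rule that)
qed


text \<open>
  Localized measures on an arbitrary set can be pushed forward to the group: send \<open>z\<close> to some point
  whose measure charges \<open>z\<close>. If \<open>\<tau> x\<close> charges \<open>z\<close> as well, localization puts the chosen
  point into \<open>x E\<close>.
\<close>

lemma (in group) exact_groupI:
  assumes "\<And>F \<epsilon>. finite F \<Longrightarrow> F \<subseteq> carrier G \<Longrightarrow> \<epsilon> > 0 \<Longrightarrow>
    \<exists>(\<tau> :: 'a \<Rightarrow> 'y pmf) E. finite E \<and> almost_invariant G \<epsilon> F \<tau> \<and> localized G E \<tau>"
  shows "exact_group G"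
  unfolding exact_group_def
proof (intro allI impI)
  fix F :: "'a set" and \<epsilon> :: real
  assume F: "finite F" "F \<subseteq> carrier G" "\<epsilon> > 0"
  obtain \<tau> :: "'a \<Rightarrow> 'y pmf" and E where E: "finite E" "almost_invariant G \<epsilon> F \<tau>" "localized G E \<tau>"
    using assms[OF F] by blast
  \<comment> \<open>A point of the group whose measure charges \<open>z\<close>.\<close>
  define p where "p z = (SOME x. x \<in> carrier G \<and> z \<in> set_pmf (\<tau> x))" for z
  have p: "p z \<in> carrier G \<and> z \<in> set_pmf (\<tau> (p z))" if "x \<in> carrier G" "z \<in> set_pmf (\<tau> x)" for x z
    unfolding p_def using someI[of "\<lambda>x. x \<in> carrier G \<and> z \<in> set_pmf (\<tau> x)" x] that by blast
  have "almost_invariant G \<epsilon> F (\<lambda>x. map_pmf p (\<tau> x))"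
    using E(2) unfolding almost_invariant_def by (auto intro: pmf_close_map)
  moreover have "set_pmf (map_pmf p (\<tau> x)) \<subseteq> (\<lambda>e. x \<otimes> e) ` (E \<inter> carrier G)" if x: "x \<in> carrier G" for x
  proof
    fix y assume "y \<in> set_pmf (map_pmf p (\<tau> x))"
    then obtain z where z: "z \<in> set_pmf (\<tau> x)" "y = p z" by auto
    have y: "y \<in> carrier G" "z \<in> set_pmf (\<tau> y)" using p[OF x z(1)] z(2) by auto
    then have "inv x \<otimes> y \<in> E" using E(3) x z(1) unfolding localized_def by blast
    moreover have "y = x \<otimes> (inv x \<otimes> y)" using x y by (simp add: m_assoc[symmetric])
    ultimately show "y \<in> (\<lambda>e. x \<otimes> e) ` (E \<inter> carrier G)" using x y by blast
  qed
  ultimately show "\<exists>(\<tau> :: 'a \<Rightarrow> 'a pmf) E. almost_invariant G \<epsilon> F \<tau> \<and> finite E \<and> E \<subseteq> carrier G \<and>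
           (\<forall>x\<in>carrier G. set_pmf (\<tau> x) \<subseteq> (\<lambda>e. x \<otimes> e) ` E)"
    using E(1) by (intro exI[of _ "\<lambda>x. map_pmf p (\<tau> x)"] exI[of _ "E \<inter> carrier G"]) auto
qed

lemma (in group) exact_group_localized:
  assumes "exact_group G" "finite F" "F \<subseteq> carrier G" "\<epsilon> > 0"
  obtains \<tau> :: "'a \<Rightarrow> 'a pmf" and E where "finite E" "E \<subseteq> carrier G" "almost_invariant G \<epsilon> F \<tau>" "localized G E \<tau>"
proof -
  obtain \<tau> :: "'a \<Rightarrow> 'a pmf" and E where E: "almost_invariant G \<epsilon> F \<tau>" "finite E" "E \<subseteq> carrier G"
    "\<And>x y. x \<in> carrier G \<Longrightarrow> y \<in> set_pmf (\<tau> x) \<Longrightarrow> \<exists>e\<in>E. y = x \<otimes> e"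
    by (rule exact_groupE[OF assms]) blast
  let ?E = "(\<lambda>(a, b). a \<otimes> inv b) ` (E \<times> E)"
  have "localized G ?E \<tau>"
    unfolding localized_def
  proof (intro ballI impI)
    fix x y assume xy: "x \<in> carrier G" "y \<in> carrier G" "set_pmf (\<tau> x) \<inter> set_pmf (\<tau> y) \<noteq> {}"
    then obtain z where "z \<in> set_pmf (\<tau> x)" "z \<in> set_pmf (\<tau> y)" by blast
    then obtain a b where ab: "a \<in> E" "b \<in> E" "z = x \<otimes> a" "z = y \<otimes> b" using E(4) xy by metis
    then have c: "a \<in> carrier G" "b \<in> carrier G" using E(3) by auto
    have "y = x \<otimes> a \<otimes> inv b" using ab c xy by (metis inv_solve_right m_closed)
    then have "inv x \<otimes> y = a \<otimes> inv b" using c xy by (simp add: m_assoc inv_solve_left')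
    then show "inv x \<otimes> y \<in> ?E" using ab by force
  qed
  moreover have "finite ?E" "?E \<subseteq> carrier G" using E(2,3) by auto
  ultimately show ?thesis using that E(1) by blast
qed

lemma exact_group_inj_hom:
  fixes A :: "('a, 'x) monoid_scheme" and B :: "('c, 'y) monoid_scheme"
  assumes "group A" "group B" "exact_group B" "f \<in> hom A B" "inj_on f (carrier A)"
  shows "exact_group A"
proof -
  interpret A: group A by fact
  interpret B: group B by fact
  interpret f: group_hom A B f using assms by unfold_locales
  show ?thesis
  proof (rule A.exact_groupI)
    fix F :: "'a set" and \<epsilon> :: real
    assume F: "finite F" "F \<subseteq> carrier A" "\<epsilon> > 0"
    then have fF: "finite (f ` F)" "f ` F \<subseteq> carrier B" by auto
    obtain \<tau> :: "'c \<Rightarrow> 'c pmf" and E where E: "finite E" "E \<subseteq> carrier B"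
        "almost_invariant B \<epsilon> (f ` F) \<tau>" "localized B E \<tau>"
      using B.exact_group_localized[OF assms(3) fF F(3)] .
    let ?E = "f -` E \<inter> carrier A"
    have "finite ?E" using E(1) assms(5) by (simp add: finite_vimage_IntI)
    moreover have "almost_invariant A \<epsilon> F (\<tau> \<circ> f)"
      using E(3) F(2) by (auto simp: almost_invariant_def subset_iff)
    moreover have "localized A ?E (\<tau> \<circ> f)"
      using E(4) by (auto simp: localized_def)
    ultimately show "\<exists>(\<tau> :: 'a \<Rightarrow> 'c pmf) E. finite E \<and> almost_invariant A \<epsilon> F \<tau> \<and> localized A E \<tau>"
      by blast
  qed
qed

lemma finitely_generatedE:
  assumes "finitely_generated G"
  obtains S where "finite S" "S \<subseteq> carrier G" "generate G S = carrier G"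
  using assms unfolding finitely_generated_def finite_generating_set_def by blast

lemma (in group) finitely_generatedI:
  assumes "finite S" "S \<subseteq> carrier G" "carrier G \<subseteq> generate G S"
  shows "finitely_generated G"
  unfolding finitely_generated_def finite_generating_set_def
  using assms generate_incl[OF assms(2)] by (intro exI[of _ S]) simp

lemma (in group) generate_word:
  assumes "S \<subseteq> carrier G" "g \<in> generate G S"
  shows "\<exists>ws. set ws \<subseteq> S \<union> m_inv G ` S \<and> foldr (mult G) ws \<one> = g"
  using assms(2)
proof induction
  case one
  show ?case by (intro exI[of _ "[]"]) auto
next
  case (incl h)
  then show ?case using assms(1) by (intro exI[of _ "[h]"]) auto
next
  case (inv h)
  then show ?case using assms(1) by (intro exI[of _ "[inv h]"]) auto
next
  case (eng g h)
  then obtain v w where vw: "set v \<subseteq> S \<union> m_inv G ` S" "foldr (mult G) v \<one> = g"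
      "set w \<subseteq> S \<union> m_inv G ` S" "foldr (mult G) w \<one> = h" by auto
  have "h \<in> carrier G" using eng.hyps(2) assms(1) generate_in_carrier by blast
  then have "set v \<subseteq> carrier G \<Longrightarrow> foldr (mult G) v \<one> \<in> carrier G \<and>
      foldr (mult G) v h = foldr (mult G) v \<one> \<otimes> h" for v
    by (induction v) (auto simp: m_assoc)
  moreover have "set v \<subseteq> carrier G" using vw(1) assms(1) by auto
  ultimately show ?case using vw by (intro exI[of _ "v @ w"]) auto
qed

lemma (in group) word_length_word:
  assumes "finite_generating_set G S" "g \<in> carrier G"
  obtains ws where "length ws = word_length G S g" "set ws \<subseteq> S \<union> m_inv G ` S" "foldr (mult G) ws \<one> = g"
proof -
  have "\<exists>n ws. length ws = n \<and> set ws \<subseteq> S \<union> m_inv G ` S \<and> foldr (mult G) ws \<one> = g"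
    using generate_word[of S g] assms unfolding finite_generating_set_def by auto
  from LeastI_ex[OF this] show ?thesis using that unfolding word_length_def by blast
qed

lemma (in group) finite_word_ball:
  assumes "finite_generating_set G S"
  shows "finite {g \<in> carrier G. word_length G S g \<le> n}"
proof (rule finite_subset)
  let ?W = "{ws. set ws \<subseteq> S \<union> m_inv G ` S \<and> length ws \<le> n}"
  show "{g \<in> carrier G. word_length G S g \<le> n} \<subseteq> (\<lambda>ws. foldr (mult G) ws \<one>) ` ?W"
  proof safe
    fix g assume g: "g \<in> carrier G" "word_length G S g \<le> n"
    obtain ws where "length ws = word_length G S g" "set ws \<subseteq> S \<union> m_inv G ` S" "foldr (mult G) ws \<one> = g"
      using word_length_word[OF assms g(1)] .
    with g show "g \<in> (\<lambda>ws. foldr (mult G) ws \<one>) ` ?W" by (intro image_eqI[of _ _ ws]) auto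
  qed
  show "finite ((\<lambda>ws. foldr (mult G) ws \<one>) ` ?W)"
    using assms by (intro finite_imageI finite_lists_length_le) (auto simp: finite_generating_set_def)
qed

text \<open>
  For a finitely generated group a set is finite if and only if it has bounded word length, so balls
  and finite sets can be exchanged for each other.
\<close>

lemma (in group) exact_imp_group_property_A:
  assumes "exact_group G" "finitely_generated G"
  shows "group_property_A G"
proof -
  obtain S where S: "finite_generating_set G S"
    using assms(2) unfolding finitely_generated_def by blast
  have "property_A (carrier G) (word_metric G S)"
    unfolding property_A_def
  proof (intro allI impI)
    fix R \<epsilon> :: real assume "R > 0" "\<epsilon> > 0"
    let ?F = "{g \<in> carrier G. word_length G S g \<le> nat \<lfloor>R\<rfloor>}"
    have "finite ?F" "?F \<subseteq> carrier G" using finite_word_ball[OF S] by auto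
    then obtain \<tau> :: "'a \<Rightarrow> 'a pmf" and E where E: "almost_invariant G \<epsilon> ?F \<tau>" "finite E" "E \<subseteq> carrier G"
      "\<And>x y. x \<in> carrier G \<Longrightarrow> y \<in> set_pmf (\<tau> x) \<Longrightarrow> \<exists>e\<in>E. y = x \<otimes> e"
      by (rule exact_groupE[OF assms(1) _ _ \<open>\<epsilon> > 0\<close>]) blast
    define c where "c = 1 + (\<Sum>e\<in>E. real (word_length G S e))"
    have c: "real (word_length G S e) \<le> c" if "e \<in> E" for e
      using member_le_sum[of e E "\<lambda>e. real (word_length G S e)"] that E(2) by (simp add: c_def)
    have supp: "set_pmf (\<tau> x) \<subseteq> (\<lambda>e. x \<otimes> e) ` E" if "x \<in> carrier G" for x
      using E(4) that by blast
    have sum_eq: "(\<lambda>z. \<bar>pmf (\<tau> x) z - r * pmf (\<tau> y) z\<bar>) summable_on carrier G \<and>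
        l1_norm (carrier G) (\<lambda>z. pmf (\<tau> x) z - r * pmf (\<tau> y) z) =
        (\<Sum>z\<in>(\<lambda>e. x \<otimes> e) ` E \<union> (\<lambda>e. y \<otimes> e) ` E. \<bar>pmf (\<tau> x) z - r * pmf (\<tau> y) z\<bar>)"
      if xy: "x \<in> carrier G" "y \<in> carrier G" for x y r
    proof -
      let ?A = "(\<lambda>e. x \<otimes> e) ` E \<union> (\<lambda>e. y \<otimes> e) ` E"
      let ?f = "\<lambda>z. \<bar>pmf (\<tau> x) z - r * pmf (\<tau> y) z\<bar>"
      have A: "finite ?A" "?A \<subseteq> carrier G" using E(2,3) xy by auto
      have 0: "?f z = 0" if "z \<notin> ?A" for z
      proof -
        have "z \<notin> set_pmf (\<tau> x)" "z \<notin> set_pmf (\<tau> y)" using that supp[OF xy(1)] supp[OF xy(2)] by blast+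
        then show ?thesis by (simp add: set_pmf_iff)
      qed
      have "?f summable_on ?A" using A(1) by (rule summable_on_finite)
      moreover have "?f summable_on carrier G \<longleftrightarrow> ?f summable_on ?A"
        by (rule summable_on_cong_neutral) (use A(2) 0 in blast)+
      moreover have "infsum ?f (carrier G) = infsum ?f ?A"
        by (rule infsum_cong_neutral) (use A(2) 0 in blast)+
      ultimately show ?thesis unfolding l1_norm_def using A(1) by simp
    qed
    have 1: "pmf (\<tau> x) \<in> l1_unit_sphere (carrier G)" if x: "x \<in> carrier G" for x
    proof -
      have "(\<Sum>z\<in>(\<lambda>e. x \<otimes> e) ` E. pmf (\<tau> x) z) = 1"
        using supp[OF x] E(2) by (intro sum_pmf_eq_1) auto
      then show ?thesis using sum_eq[OF x x, of 0] by (simp add: l1_unit_sphere_def)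
    qed
    have 2: "l1_norm (carrier G) (\<lambda>z. pmf (\<tau> x) z - pmf (\<tau> y) z) \<le> \<epsilon>"
      if xy: "x \<in> carrier G" "y \<in> carrier G" "word_metric G S x y \<le> R" for x y
    proof -
      have "word_length G S (inv x \<otimes> y) \<le> nat \<lfloor>R\<rfloor>"
        using xy(3) unfolding word_metric_def by (simp add: le_nat_floor)
      then have "inv x \<otimes> y \<in> ?F" using xy by simp
      then have "pmf_close \<epsilon> (\<tau> x) (\<tau> (x \<otimes> (inv x \<otimes> y)))"
        using E(1) xy unfolding almost_invariant_def by blast
      then have "pmf_close \<epsilon> (\<tau> x) (\<tau> y)" using xy by (simp add: m_assoc[symmetric])
      then show ?thesis
        using sum_eq[OF xy(1,2), of 1] supp[OF xy(1)] supp[OF xy(2)] E(2)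
          pmf_close_l1[of \<epsilon> "\<tau> x" "\<tau> y" "(\<lambda>e. x \<otimes> e) ` E \<union> (\<lambda>e. y \<otimes> e) ` E"]
        by (simp add: le_supI1 le_supI2)
    qed
    have 3: "{z \<in> carrier G. pmf (\<tau> x) z \<noteq> 0} \<subseteq> {z \<in> carrier G. word_metric G S x z \<le> c}"
      if x: "x \<in> carrier G" for x
    proof safe
      fix z assume z: "z \<in> carrier G" "pmf (\<tau> x) z \<noteq> 0"
      then obtain e where e: "e \<in> E" "z = x \<otimes> e" using E(4)[OF x] by (auto simp: set_pmf_iff)
      then have "inv x \<otimes> z = e" using x E(3) by (simp add: m_assoc[symmetric] subset_iff)
      then show "word_metric G S x z \<le> c" using c[OF e(1)] by (simp add: word_metric_def)
    qed
    have "c > 0" unfolding c_def by (intro add_pos_nonneg sum_nonneg) auto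
    with 1 2 3 show "\<exists>\<tau> c. c > 0 \<and> (\<forall>x\<in>carrier G. \<tau> x \<in> l1_unit_sphere (carrier G)) \<and>
        (\<forall>x\<in>carrier G. \<forall>y\<in>carrier G. word_metric G S x y \<le> R \<longrightarrow>
           l1_norm (carrier G) (\<lambda>z. \<tau> x z - \<tau> y z) \<le> \<epsilon>) \<and>
        (\<forall>x\<in>carrier G. {z \<in> carrier G. \<tau> x z \<noteq> 0} \<subseteq> {z \<in> carrier G. word_metric G S x z \<le> c})"
      by (intro exI[of _ "\<lambda>x. pmf (\<tau> x)"] exI[of _ c]) auto
  qed
  with S show ?thesis unfolding group_property_A_def by blast
qed

section \<open>Semidirect products\<close>

text \<open>
  An action of \<open>K\<close> on \<open>H\<close> by group automorphisms.
\<close>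

locale semidirect =
  fixes H :: "('h, 'x) monoid_scheme" and K :: "('k, 'y) monoid_scheme" and \<phi> :: "'k \<Rightarrow> 'h \<Rightarrow> 'h"
  assumes group_H: "group H" and group_K: "group K"
    and act_hom: "k \<in> carrier K \<Longrightarrow> \<phi> k \<in> hom H H"
    and act_mult: "k \<in> carrier K \<Longrightarrow> k' \<in> carrier K \<Longrightarrow> h \<in> carrier H \<Longrightarrow>
      \<phi> (k \<otimes>\<^bsub>K\<^esub> k') h = \<phi> k (\<phi> k' h)"
    and act_one: "h \<in> carrier H \<Longrightarrow> \<phi> \<one>\<^bsub>K\<^esub> h = h"
begin

sublocale H: group H by (rule group_H)
sublocale K: group K by (rule group_K)

abbreviation "SD \<equiv> semidirect_product H K \<phi>"

lemma carrier_SD: "carrier SD = carrier H \<times> carrier K"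
  and mult_SD: "(h, k) \<otimes>\<^bsub>SD\<^esub> (h', k') = (h \<otimes>\<^bsub>H\<^esub> \<phi> k h', k \<otimes>\<^bsub>K\<^esub> k')"
  and one_SD: "\<one>\<^bsub>SD\<^esub> = (\<one>\<^bsub>H\<^esub>, \<one>\<^bsub>K\<^esub>)"
  by (simp_all add: semidirect_product_def)

lemma act_closed: "k \<in> carrier K \<Longrightarrow> h \<in> carrier H \<Longrightarrow> \<phi> k h \<in> carrier H"
  using act_hom by (auto simp: hom_def)

lemma act_H_mult:
  "k \<in> carrier K \<Longrightarrow> h \<in> carrier H \<Longrightarrow> h' \<in> carrier H \<Longrightarrow> \<phi> k (h \<otimes>\<^bsub>H\<^esub> h') = \<phi> k h \<otimes>\<^bsub>H\<^esub> \<phi> k h'"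
  using act_hom by (auto simp: hom_def)

lemma act_H_one: "k \<in> carrier K \<Longrightarrow> \<phi> k \<one>\<^bsub>H\<^esub> = \<one>\<^bsub>H\<^esub>"
  by (metis H.group_axioms act_hom hom_one)

lemma act_H_inv: "k \<in> carrier K \<Longrightarrow> h \<in> carrier H \<Longrightarrow> \<phi> k (inv\<^bsub>H\<^esub> h) = inv\<^bsub>H\<^esub> \<phi> k h"
  using group_hom.hom_inv[of H H "\<phi> k" h] act_hom
  by (simp add: group_hom_def group_hom_axioms_def)

lemma act_inv_cancel: "k \<in> carrier K \<Longrightarrow> h \<in> carrier H \<Longrightarrow> \<phi> (inv\<^bsub>K\<^esub> k) (\<phi> k h) = h"
  by (simp add: act_mult[symmetric] act_one)

lemma group_SD: "group SD"
proof (rule groupI)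
  fix x assume "x \<in> carrier SD"
  then obtain h k where x: "x = (h, k)" "h \<in> carrier H" "k \<in> carrier K" by (auto simp: carrier_SD)
  then show "\<exists>y\<in>carrier SD. y \<otimes>\<^bsub>SD\<^esub> x = \<one>\<^bsub>SD\<^esub>"
    by (intro bexI[of _ "(\<phi> (inv\<^bsub>K\<^esub> k) (inv\<^bsub>H\<^esub> h), inv\<^bsub>K\<^esub> k)"])
       (auto simp: mult_SD one_SD carrier_SD act_closed act_H_mult[symmetric] act_H_one)
qed (auto simp: carrier_SD mult_SD one_SD act_closed act_one act_mult act_H_mult H.m_assoc K.m_assoc)

sublocale SD: group SD by (rule group_SD)

lemma inv_SD:
  assumes "h \<in> carrier H" "k \<in> carrier K"
  shows "inv\<^bsub>SD\<^esub> (h, k) = (\<phi> (inv\<^bsub>K\<^esub> k) (inv\<^bsub>H\<^esub> h), inv\<^bsub>K\<^esub> k)"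
  using assms
  by (intro SD.inv_equality)
     (auto simp: mult_SD one_SD carrier_SD act_closed act_H_mult[symmetric] act_H_one)

text \<open>
  Exactness of an extension: first choose a random \<open>k'\<close> near \<open>k\<close> from the measures for \<open>K\<close>, then look
  at \<open>(h, k)\<close> from \<open>(1, k')\<close>. The difference \<open>(1, k')\<^sup>-\<^sup>1 (h, k)\<close> equals
  \<open>\<phi> (k'\<^sup>-\<^sup>1) h\<close> up to the bounded factor \<open>k'\<^sup>-\<^sup>1 k\<close>, so the measures for \<open>H\<close> apply to it.
\<close>

lemma exact_SD:
  assumes "exact_group H" "exact_group K"
  shows "exact_group SD"
proof (rule SD.exact_groupI)
  fix F :: "('h \<times> 'k) set" and \<epsilon> :: real
  assume F: "finite F" "F \<subseteq> carrier SD" "\<epsilon> > 0"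
  define FK where "FK = snd ` F"
  have FK: "finite FK" "FK \<subseteq> carrier K" using F by (auto simp: FK_def carrier_SD)
  obtain \<sigma> :: "'k \<Rightarrow> 'k pmf" and E where E: "almost_invariant K (\<epsilon> / 2) FK \<sigma>" "finite E" "E \<subseteq> carrier K"
      "\<And>x y. x \<in> carrier K \<Longrightarrow> y \<in> set_pmf (\<sigma> x) \<Longrightarrow> \<exists>e\<in>E. y = x \<otimes>\<^bsub>K\<^esub> e"
    by (rule exact_groupE[OF assms(2) FK half_gt_zero[OF F(3)]]) blast
  define FH where "FH = (\<lambda>(e, h). \<phi> (inv\<^bsub>K\<^esub> e) h) ` (E \<times> fst ` F)"
  have FH: "finite FH" "FH \<subseteq> carrier H" using F(1,2) E(2,3)
    by (auto simp: FH_def carrier_SD intro!: act_closed)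
  obtain \<rho> :: "'h \<Rightarrow> 'h pmf" and D where D: "finite D" "D \<subseteq> carrier H"
      "almost_invariant H (\<epsilon> / 2) FH \<rho>" "localized H D \<rho>"
    by (rule H.exact_group_localized[OF assms(1) FH half_gt_zero[OF F(3)]]) blast
  define \<tau> where "\<tau> x = bind_pmf (\<sigma> (snd x)) (\<lambda>k'. map_pmf (Pair k') (\<rho> (\<phi> (inv\<^bsub>K\<^esub> k') (fst x))))"
    for x :: "'h \<times> 'k"
  define C where "C = (\<lambda>(a, b, d). (\<phi> a d, a \<otimes>\<^bsub>K\<^esub> inv\<^bsub>K\<^esub> b)) ` (E \<times> E \<times> D)"
  have "finite C" using D(1) E(2) by (simp add: C_def)
  moreover have "localized SD C \<tau>"
    unfolding localized_def
  proof (intro ballI impI)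
    fix x y assume xy: "x \<in> carrier SD" "y \<in> carrier SD" "set_pmf (\<tau> x) \<inter> set_pmf (\<tau> y) \<noteq> {}"
    obtain h k where x: "x = (h, k)" "h \<in> carrier H" "k \<in> carrier K" using xy(1) by (auto simp: carrier_SD)
    obtain h1 k1 where y: "y = (h1, k1)" "h1 \<in> carrier H" "k1 \<in> carrier K" using xy(2) by (auto simp: carrier_SD)
    obtain k' z where k': "k' \<in> set_pmf (\<sigma> k)" "k' \<in> set_pmf (\<sigma> k1)"
      and z: "z \<in> set_pmf (\<rho> (\<phi> (inv\<^bsub>K\<^esub> k') h))" "z \<in> set_pmf (\<rho> (\<phi> (inv\<^bsub>K\<^esub> k') h1))"
      using xy(3) by (auto simp: \<tau>_def x y)
    obtain a b where ab: "a \<in> E" "b \<in> E" "k' = k \<otimes>\<^bsub>K\<^esub> a" "k' = k1 \<otimes>\<^bsub>K\<^esub> b"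
      using E(4) x y k' by metis
    have c: "a \<in> carrier K" "b \<in> carrier K" "k' \<in> carrier K" using ab E(3) x y by auto
    have k1: "k1 = k' \<otimes>\<^bsub>K\<^esub> inv\<^bsub>K\<^esub> b" and k: "inv\<^bsub>K\<^esub> k = a \<otimes>\<^bsub>K\<^esub> inv\<^bsub>K\<^esub> k'"
      using ab(3,4) c x y by (metis K.inv_solve_right, simp add: K.inv_mult_group K.m_assoc[symmetric])
    define d where "d = inv\<^bsub>H\<^esub> (\<phi> (inv\<^bsub>K\<^esub> k') h) \<otimes>\<^bsub>H\<^esub> \<phi> (inv\<^bsub>K\<^esub> k') h1"
    have "\<phi> (inv\<^bsub>K\<^esub> k') h \<in> carrier H" "\<phi> (inv\<^bsub>K\<^esub> k') h1 \<in> carrier H"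
      using x y c by (auto simp: act_closed)
    then have d: "d \<in> D" using D(4) z unfolding localized_def d_def by blast
    have "d = \<phi> (inv\<^bsub>K\<^esub> k') (inv\<^bsub>H\<^esub> h \<otimes>\<^bsub>H\<^esub> h1)"
      using x y c by (simp add: d_def act_H_mult act_H_inv)
    then have "\<phi> a d = \<phi> (inv\<^bsub>K\<^esub> k) (inv\<^bsub>H\<^esub> h \<otimes>\<^bsub>H\<^esub> h1)"
      using x y c by (simp add: k act_mult)
    moreover have "inv\<^bsub>K\<^esub> k \<otimes>\<^bsub>K\<^esub> k1 = a \<otimes>\<^bsub>K\<^esub> inv\<^bsub>K\<^esub> b"
      using c unfolding k k1 by (metis K.inv_closed K.m_assoc K.m_closed K.l_inv K.l_one)
    moreover have "inv\<^bsub>SD\<^esub> x \<otimes>\<^bsub>SD\<^esub> y = (\<phi> (inv\<^bsub>K\<^esub> k) (inv\<^bsub>H\<^esub> h \<otimes>\<^bsub>H\<^esub> h1), inv\<^bsub>K\<^esub> k \<otimes>\<^bsub>K\<^esub> k1)"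
      using x y by (simp add: inv_SD mult_SD act_H_mult)
    ultimately have "inv\<^bsub>SD\<^esub> x \<otimes>\<^bsub>SD\<^esub> y = (\<phi> a d, a \<otimes>\<^bsub>K\<^esub> inv\<^bsub>K\<^esub> b)" by simp
    with ab(1,2) d show "inv\<^bsub>SD\<^esub> x \<otimes>\<^bsub>SD\<^esub> y \<in> C" unfolding C_def by (intro image_eqI[of _ _ "(a, b, d)"]) auto
  qed
  moreover have "almost_invariant SD \<epsilon> F \<tau>"
    unfolding almost_invariant_def
  proof (intro ballI)
    fix x s assume xs: "x \<in> carrier SD" "s \<in> F"
    obtain h k where x: "x = (h, k)" "h \<in> carrier H" "k \<in> carrier K" using xs(1) by (auto simp: carrier_SD)
    obtain f l where s: "s = (f, l)" "f \<in> carrier H" "l \<in> carrier K" "f \<in> fst ` F" "l \<in> FK"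
      using xs(2) F(2) by (force simp: carrier_SD FK_def)
    let ?h = "h \<otimes>\<^bsub>H\<^esub> \<phi> k f"
    let ?\<tau> = "bind_pmf (\<sigma> k) (\<lambda>k'. map_pmf (Pair k') (\<rho> (\<phi> (inv\<^bsub>K\<^esub> k') ?h)))"
    have "pmf_close (\<epsilon> / 2) (\<tau> x) ?\<tau>"
      unfolding \<tau>_def x fst_conv snd_conv
    proof (intro pmf_close_bind_right pmf_close_map)
      fix k' assume "k' \<in> set_pmf (\<sigma> k)"
      then obtain e where e: "e \<in> E" "k' = k \<otimes>\<^bsub>K\<^esub> e" using E(4) x by blast
      then have c: "e \<in> carrier K" "k' \<in> carrier K" using E(3) x by auto
      have "inv\<^bsub>K\<^esub> k' \<otimes>\<^bsub>K\<^esub> k = inv\<^bsub>K\<^esub> e" using e c x by (simp add: K.inv_mult_group K.m_assoc)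
      then have "\<phi> (inv\<^bsub>K\<^esub> k') ?h = \<phi> (inv\<^bsub>K\<^esub> k') h \<otimes>\<^bsub>H\<^esub> \<phi> (inv\<^bsub>K\<^esub> e) f"
        using x s c by (simp add: act_H_mult act_closed act_mult[symmetric])
      moreover have "\<phi> (inv\<^bsub>K\<^esub> e) f \<in> FH" using e(1) s(4) unfolding FH_def by force
      ultimately show "pmf_close (\<epsilon> / 2) (\<rho> (\<phi> (inv\<^bsub>K\<^esub> k') h)) (\<rho> (\<phi> (inv\<^bsub>K\<^esub> k') ?h))"
        using D(3) c x unfolding almost_invariant_def by (auto simp: act_closed)
    qed (use F in auto)
    moreover have "pmf_close (\<epsilon> / 2) ?\<tau> (\<tau> (x \<otimes>\<^bsub>SD\<^esub> s))"
      unfolding \<tau>_def x s mult_SD fst_conv snd_conv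
      by (rule pmf_close_bind_left) (use E(1) x s in \<open>auto simp: almost_invariant_def\<close>)
    ultimately show "pmf_close \<epsilon> (\<tau> x) (\<tau> (x \<otimes>\<^bsub>SD\<^esub> s))"
      using pmf_close_trans by fastforce
  qed
  ultimately show "\<exists>(\<tau> :: 'h \<times> 'k \<Rightarrow> ('k \<times> 'h) pmf) E. finite E \<and> almost_invariant SD \<epsilon> F \<tau> \<and> localized SD E \<tau>"
    by blast
qed

text \<open>
  Inside the semidirect product \<open>K\<close> acts on \<open>H\<close> by conjugation, so a finite set whose
  translates under \<open>K\<close> generate \<open>H\<close> is enough. For the wreath product it is a single point mass.
\<close>

lemma finitely_generated_SD:
  assumes "finitely_generated K" "finite T" "T \<subseteq> carrier H"
    and gen: "carrier H \<subseteq> generate H (\<Union>k\<in>carrier K. \<phi> k ` T)"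
  shows "finitely_generated SD"
proof -
  obtain S where S: "finite S" "S \<subseteq> carrier K" "generate K S = carrier K"
    by (rule finitely_generatedE[OF assms(1)])
  let ?S = "(\<lambda>t. (t, \<one>\<^bsub>K\<^esub>)) ` T \<union> (\<lambda>k. (\<one>\<^bsub>H\<^esub>, k)) ` S"
  let ?Q = "generate SD ?S"
  have sub: "?S \<subseteq> carrier SD" using S assms(3) by (auto simp: carrier_SD)
  interpret Q: subgroup ?Q SD by (rule SD.generate_is_subgroup[OF sub])
  have K: "(\<one>\<^bsub>H\<^esub>, k) \<in> ?Q" if "k \<in> generate K S" for k
    using that
  proof induction
    case one
    then show ?case using Q.one_closed by (simp add: one_SD)
  next
    case (incl k)
    then show ?case by (intro generate.incl) auto
  next
    case (inv k)
    then have "inv\<^bsub>SD\<^esub> (\<one>\<^bsub>H\<^esub>, k) \<in> ?Q" by (intro generate.inv) auto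
    then show ?case using inv S(2) by (auto simp: inv_SD act_H_one)
  next
    case (eng k l)
    then have "(\<one>\<^bsub>H\<^esub>, k) \<otimes>\<^bsub>SD\<^esub> (\<one>\<^bsub>H\<^esub>, l) \<in> ?Q" by simp
    moreover have "k \<in> carrier K" using eng S by auto
    ultimately show ?case by (simp add: mult_SD act_H_one)
  qed
  have T: "(\<phi> k t, \<one>\<^bsub>K\<^esub>) \<in> ?Q" if "k \<in> carrier K" "t \<in> T" for k t
  proof -
    have "(t, \<one>\<^bsub>K\<^esub>) \<in> ?Q" using that(2) by (intro generate.incl) auto
    moreover have "(\<one>\<^bsub>H\<^esub>, k) \<in> ?Q" "(\<one>\<^bsub>H\<^esub>, inv\<^bsub>K\<^esub> k) \<in> ?Q" using K S(3) that(1) by auto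
    ultimately have "(\<one>\<^bsub>H\<^esub>, k) \<otimes>\<^bsub>SD\<^esub> (t, \<one>\<^bsub>K\<^esub>) \<otimes>\<^bsub>SD\<^esub> (\<one>\<^bsub>H\<^esub>, inv\<^bsub>K\<^esub> k) \<in> ?Q" by blast
    then show ?thesis using that assms(3) by (auto simp: mult_SD act_H_one act_closed subset_iff)
  qed
  let ?U = "\<Union>k\<in>carrier K. \<phi> k ` T"
  have U: "?U \<subseteq> carrier H" using assms(3) by (auto simp: act_closed subset_iff)
  have H: "(h, \<one>\<^bsub>K\<^esub>) \<in> ?Q" if "h \<in> generate H ?U" for h
    using that
  proof induction
    case one
    then show ?case using Q.one_closed by (simp add: one_SD)
  next
    case (incl h)
    then show ?case using T by auto
  next
    case (inv h)
    then have h: "(h, \<one>\<^bsub>K\<^esub>) \<in> ?Q" using T by auto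
    have hH: "h \<in> carrier H" using inv U by blast
    have "inv\<^bsub>SD\<^esub> (h, \<one>\<^bsub>K\<^esub>) \<in> ?Q" using h by blast
    then show ?case using hH by (simp add: inv_SD act_one)
  next
    case (eng h l)
    then have "(h, \<one>\<^bsub>K\<^esub>) \<otimes>\<^bsub>SD\<^esub> (l, \<one>\<^bsub>K\<^esub>) \<in> ?Q" by simp
    moreover have "l \<in> carrier H" using eng H.generate_incl[OF U] by blast
    ultimately show ?case by (simp add: mult_SD act_one)
  qed
  have "carrier SD \<subseteq> ?Q"
  proof
    fix x assume "x \<in> carrier SD"
    then obtain h k where x: "x = (h, k)" "h \<in> carrier H" "k \<in> carrier K" by (auto simp: carrier_SD)
    then have "(h, \<one>\<^bsub>K\<^esub>) \<otimes>\<^bsub>SD\<^esub> (\<one>\<^bsub>H\<^esub>, k) \<in> ?Q" using H K gen S(3) by (intro Q.m_closed) auto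
    then show "x \<in> ?Q" using x by (simp add: mult_SD act_H_one)
  qed
  then show ?thesis using S(1) assms(2) sub by (intro SD.finitely_generatedI[of ?S]) auto
qed

end


section \<open>Wreath products with the group of order two\<close>

text \<open>
  Map \<open>x\<close> to the coset of \<open>x\<close> modulo a finite subgroup that contains the given finite set. The
  measures are then exactly invariant.
\<close>

lemma (in group) exact_locally_finite:
  assumes "\<And>F. finite F \<Longrightarrow> F \<subseteq> carrier G \<Longrightarrow> \<exists>H. subgroup H G \<and> finite H \<and> F \<subseteq> H"
  shows "exact_group G"
proof (rule exact_groupI)
  fix F :: "'a set" and \<epsilon> :: real
  assume F: "finite F" "F \<subseteq> carrier G" "\<epsilon> > 0"
  obtain H where H: "subgroup H G" "finite H" "F \<subseteq> H" using assms[OF F(1,2)] by blast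
  let ?\<tau> = "\<lambda>x. return_pmf (x <# H)"
  have "almost_invariant G \<epsilon> F ?\<tau>"
    unfolding almost_invariant_def
  proof (intro ballI)
    fix x s assume xs: "x \<in> carrier G" "s \<in> F"
    then have "s \<in> H" "s \<in> carrier G" using H F by auto
    then have "x \<otimes> s \<in> x <# H" by (auto simp: l_coset_def)
    then have "x <# H = (x \<otimes> s) <# H" using l_repr_independence[OF _ xs(1) H(1)] by blast
    then show "pmf_close \<epsilon> (?\<tau> x) (?\<tau> (x \<otimes> s))" using F(3) by (simp add: pmf_close_refl)
  qed
  moreover have "localized G H ?\<tau>"
    unfolding localized_def
  proof (intro ballI impI)
    fix x y assume xy: "x \<in> carrier G" "y \<in> carrier G" "set_pmf (?\<tau> x) \<inter> set_pmf (?\<tau> y) \<noteq> {}"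
    then have "y \<in> x <# H" using lcos_self[OF xy(2) H(1)] by simp
    then show "inv x \<otimes> y \<in> H" using subgroup.lcos_module_imp[OF H(1) is_group xy(1)] by blast
  qed
  ultimately show "\<exists>(\<tau> :: 'a \<Rightarrow> 'a set pmf) E. finite E \<and> almost_invariant G \<epsilon> F \<tau> \<and> localized G E \<tau>"
    using H(2) by blast
qed

lemma (in group) lcosets_action:
  assumes "subgroup H G" "c \<in> lcosets H"
  shows "g \<in> carrier G \<Longrightarrow> g <# c \<in> lcosets H"
    and "\<one> <# c = c"
    and "g \<in> carrier G \<Longrightarrow> h \<in> carrier G \<Longrightarrow> g <# (h <# c) = (g \<otimes> h) <# c"
    and "g \<in> carrier G \<Longrightarrow> inv g <# (g <# c) = c"
    and "g \<in> carrier G \<Longrightarrow> g <# (inv g <# c) = c"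
proof -
  have c: "c \<subseteq> carrier G" using subgroup.lcosets_carrier[OF assms(1) is_group assms(2)] .
  have H: "H \<subseteq> carrier G" using assms(1) by (rule subgroup.subset)
  show one: "\<one> <# c = c" using c by (rule lcos_mult_one)
  show m: "g <# (h <# c) = (g \<otimes> h) <# c" if "g \<in> carrier G" "h \<in> carrier G" for g h
    using lcos_m_assoc[OF c that] .
  show "g <# c \<in> lcosets H" if g: "g \<in> carrier G"
  proof -
    obtain a where a: "a \<in> carrier G" "c = a <# H" using assms(2) by (auto simp: LCOSETS_def)
    then show ?thesis using g H by (auto simp: lcos_m_assoc LCOSETS_def)
  qed
  show "inv g <# (g <# c) = c" if "g \<in> carrier G" using that by (simp add: m one)
  show "g <# (inv g <# c) = c" if "g \<in> carrier G" using that by (simp add: m one)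
qed

locale wreath_Z2 = group G for G :: "('g, 'y) monoid_scheme" (structure) +
  fixes H :: "'g set"
  assumes H: "subgroup H G"
begin

abbreviation "base \<equiv> sum_group (lcosets H) (\<lambda>_. integer_mod_group 2)"
abbreviation "shift \<equiv> (\<lambda>g f. \<lambda>c\<in>lcosets H. f (inv g <# c)) :: 'g \<Rightarrow> ('g set \<Rightarrow> int) \<Rightarrow> 'g set \<Rightarrow> int"

lemma base_carrier: "carrier base = {x \<in> \<Pi>\<^sub>E i\<in>lcosets H. {0..<2}. finite {i \<in> lcosets H. x i \<noteq> 0}}"
  by (subst carrier_sum_group) (auto simp: carrier_integer_mod_group)

lemma group_base: "group base"
  by (rule sum_group) simp

lemma shift_closed:
  assumes "g \<in> carrier G" "f \<in> carrier base"
  shows "shift g f \<in> carrier base"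
proof -
  have "{c \<in> lcosets H. f (inv g <# c) \<noteq> 0} \<subseteq> (\<lambda>c. g <# c) ` {c \<in> lcosets H. f c \<noteq> 0}"
  proof safe
    fix c assume c: "c \<in> lcosets H" "f (inv g <# c) \<noteq> 0"
    then show "c \<in> (\<lambda>c. g <# c) ` {c \<in> lcosets H. f c \<noteq> 0}"
      using assms(1) lcosets_action[OF H] by (intro image_eqI[of _ _ "inv g <# c"]) auto
  qed
  then have "finite {c \<in> lcosets H. f (inv g <# c) \<noteq> 0}"
    using assms(2) by (auto simp: base_carrier intro: finite_subset)
  moreover have "{c \<in> lcosets H. shift g f c \<noteq> 0} = {c \<in> lcosets H. f (inv g <# c) \<noteq> 0}" by auto
  moreover have "shift g f \<in> (\<Pi>\<^sub>E i\<in>lcosets H. {0..<2})"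
    using assms lcosets_action(1)[OF H] by (auto simp: base_carrier PiE_iff)
  ultimately show ?thesis by (simp add: base_carrier)
qed

lemma semidirect_wreath: "semidirect base G shift"
proof (rule semidirect.intro)
  show "group base" "group G" by (rule group_base, rule is_group)
next
  fix k assume k: "k \<in> carrier G"
  show "shift k \<in> hom base base"
    using k shift_closed lcosets_action(1)[OF H]
    by (auto simp: hom_def fun_eq_iff restrict_def)
  show "shift (k \<otimes> k') h = shift k (shift k' h)" if "k' \<in> carrier G" "h \<in> carrier base" for k' h
    using k that lcosets_action(1,3)[OF H]
    by (auto simp: fun_eq_iff restrict_def inv_mult_group)
next
  fix h assume "h \<in> carrier base"
  then show "shift \<one> h = h"
    using lcosets_action(2)[OF H] by (auto simp: fun_eq_iff base_carrier PiE_iff extensional_def restrict_def)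
qed

sublocale semidirect base G shift
  by (rule semidirect_wreath)

lemma exact_base: "exact_group base"
proof (rule group.exact_locally_finite[OF group_base])
  fix F assume F: "finite F" "F \<subseteq> carrier base"
  define J where "J = (\<Union>f\<in>F. {c \<in> lcosets H. f c \<noteq> 0})"
  have J: "finite J" using F by (auto simp: J_def base_carrier)
  let ?U = "{f \<in> carrier base. \<forall>c\<in>lcosets H - J. f c = 0}"
  have "subgroup ?U base"
  proof (rule group.subgroupI[OF group_base])
    have "\<one>\<^bsub>base\<^esub> \<in> ?U" using H.one_closed by auto
    then show "?U \<noteq> {}" by blast
  next
    fix a assume a: "a \<in> ?U"
    then have "inv\<^bsub>base\<^esub> a \<in> carrier base" by (intro H.inv_closed) simp
    moreover have "(inv\<^bsub>base\<^esub> a) c = 0" if "c \<in> lcosets H - J" for c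
      using a that by (subst inv_sum_group) auto
    ultimately show "inv\<^bsub>base\<^esub> a \<in> ?U" by simp
  next
    fix a b assume ab: "a \<in> ?U" "b \<in> ?U"
    then have "a \<otimes>\<^bsub>base\<^esub> b \<in> carrier base" by (intro H.m_closed) auto
    then show "a \<otimes>\<^bsub>base\<^esub> b \<in> ?U" using ab by auto
  qed auto
  moreover have "finite ?U"
  proof (rule inj_on_finite[where B = "\<Pi>\<^sub>E c\<in>J. {0..<2::int}"])
    show "inj_on (\<lambda>f. restrict f J) ?U"
    proof (rule inj_onI)
      fix f g assume fg: "f \<in> ?U" "g \<in> ?U" "restrict f J = restrict g J"
      show "f = g"
      proof (rule ext)
        fix c
        consider "c \<in> J" | "c \<in> lcosets H - J" | "c \<notin> lcosets H" by blast
        then show "f c = g c"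
        proof cases
          case 1
          then show ?thesis using fg(3) by (metis restrict_apply')
        qed (use fg in \<open>auto simp: base_carrier PiE_iff extensional_def\<close>)
      qed
    qed
    show "(\<lambda>f. restrict f J) ` ?U \<subseteq> (\<Pi>\<^sub>E c\<in>J. {0..<2})"
      by (auto simp: base_carrier J_def PiE_iff)
    show "finite (\<Pi>\<^sub>E c\<in>J. {0..<2::int})" using J by (intro finite_PiE) auto
  qed
  moreover have "F \<subseteq> ?U" using F(2) by (auto simp: J_def)
  ultimately show "\<exists>U. subgroup U base \<and> finite U \<and> F \<subseteq> U" by blast
qed

definition point :: "'g set \<Rightarrow> 'g set \<Rightarrow> int" where
  "point c = (\<lambda>i\<in>lcosets H. if i = c then 1 else 0)"

lemma point_closed: "point c \<in> carrier base"
proof -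
  have "{i \<in> lcosets H. point c i \<noteq> 0} \<subseteq> {c}" by (auto simp: point_def)
  then show ?thesis by (auto simp: base_carrier point_def intro: finite_subset)
qed

lemma shift_point: "g \<in> carrier G \<Longrightarrow> c \<in> lcosets H \<Longrightarrow> shift g (point c) = point (g <# c)"
  using lcosets_action(1,4,5)[OF H] by (fastforce simp: point_def fun_eq_iff restrict_def)

text \<open>
  In \<open>\<int>/2\<close> an element of the support is removed by adding its point mass, which gives an induction
  on the support.
\<close>

lemma generate_points: "carrier base \<subseteq> generate base (point ` (lcosets H))"
proof
  fix f assume f: "f \<in> carrier base"
  then have "finite {c \<in> lcosets H. f c \<noteq> 0}" by (simp add: base_carrier)
  then show "f \<in> generate base (point ` (lcosets H))"
    using f
  proof (induction "{c \<in> lcosets H. f c \<noteq> 0}" arbitrary: f rule: finite_psubset_induct)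
    case psubset
    show ?case
    proof (cases "{c \<in> lcosets H. f c \<noteq> 0} = {}")
      case True
      then have "f = \<one>\<^bsub>base\<^esub>" using psubset.prems by (auto simp: base_carrier PiE_iff extensional_def fun_eq_iff)
      then show ?thesis by (metis generate.one)
    next
      case False
      then obtain c where c: "c \<in> lcosets H" "f c \<noteq> 0" by blast
      then have fc: "f c = 1" using psubset.prems by (force simp: base_carrier PiE_iff)
      let ?f = "f \<otimes>\<^bsub>base\<^esub> point c"
      have cl: "?f \<in> carrier base" using psubset.prems point_closed by (rule H.m_closed)
      have val: "?f i = (if i = c then 0 else f i)" if "i \<in> lcosets H" for i
        using that fc psubset.prems by (auto simp: point_def base_carrier PiE_iff)
      have "{i \<in> lcosets H. ?f i \<noteq> 0} \<subset> {i \<in> lcosets H. f i \<noteq> 0}"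
        using val c by (auto simp: psubset_eq)
      then have "?f \<in> generate base (point ` (lcosets H))" using psubset.hyps cl by blast
      moreover have "point c \<in> generate base (point ` (lcosets H))" using c by (intro generate.incl) auto
      ultimately have "?f \<otimes>\<^bsub>base\<^esub> point c \<in> generate base (point ` (lcosets H))" by (rule generate.eng)
      moreover have "?f \<otimes>\<^bsub>base\<^esub> point c = f"
      proof (rule ext)
        fix i show "(?f \<otimes>\<^bsub>base\<^esub> point c) i = f i"
          using val[of i] fc psubset.prems
          by (cases "i \<in> lcosets H") (auto simp: point_def base_carrier PiE_iff extensional_def)
      qed
      ultimately show ?thesis by simp
    qed
  qed
qed

theorem wreath_property_A:
  assumes "exact_group G" "finitely_generated G"
  shows "group_property_A (generalized_wreath_product (integer_mod_group 2) G H)"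
proof -
  have "point ` (lcosets H) \<subseteq> (\<Union>g\<in>carrier G. shift g ` {point H})"
  proof
    fix p assume "p \<in> point ` (lcosets H)"
    then obtain g where g: "g \<in> carrier G" "p = point (g <# H)" by (auto simp: LCOSETS_def)
    have "H \<in> lcosets H" using lcos_mult_one[OF subgroup.subset[OF H]] unfolding LCOSETS_def by force
    then have "p = shift g (point H)" using g shift_point by simp
    then show "p \<in> (\<Union>g\<in>carrier G. shift g ` {point H})" using g by blast
  qed
  then have "carrier base \<subseteq> generate base (\<Union>g\<in>carrier G. shift g ` {point H})"
    using generate_points H.mono_generate by blast
  then have "finitely_generated SD"
    using assms(2) point_closed by (intro finitely_generated_SD[where T = "{point H}"]) auto
  then show ?thesis
    unfolding generalized_wreath_product_def
    using exact_SD[OF exact_base assms(1)] SD.exact_imp_group_property_A by blast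
qed

end

section \<open>Universal Coxeter groups\<close>

text \<open>
  Left multiplication of a reduced word by a letter, with \<open>c c = 1\<close>.
\<close>

fun push :: "'c \<Rightarrow> 'c list \<Rightarrow> 'c list" where
  "push c [] = [c]"
| "push c (d # w) = (if d = c then w else c # d # w)"

text \<open>
  The free product of groups of order two, one for every element of \<open>X\<close>. Its elements are the words
  without equal neighbours, so that no quotient has to be formed.
\<close>

definition coxeter_group :: "'c set \<Rightarrow> 'c list monoid" where
  "coxeter_group X = \<lparr>carrier = {w \<in> lists X. distinct_adj w}, mult = foldr push, one = []\<rparr>"

lemma coxeter_simps:
  "carrier (coxeter_group X) = {w \<in> lists X. distinct_adj w}"
  "mult (coxeter_group X) = foldr push"
  "one (coxeter_group X) = []"
  by (simp_all add: coxeter_group_def)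

lemma distinct_adj_push: "distinct_adj w \<Longrightarrow> distinct_adj (push c w)"
  by (cases w) (auto dest: distinct_adj_ConsD)

lemma set_push: "set (push c w) \<subseteq> insert c (set w)"
  by (cases w) auto

lemma push_push: "distinct_adj w \<Longrightarrow> push c (push c w) = w"
  by (cases w; cases "tl w") (auto simp: distinct_adj_Cons)

lemma distinct_adj_foldr_push: "distinct_adj w \<Longrightarrow> distinct_adj (foldr push u w)"
  by (induction u) (auto intro: distinct_adj_push)

lemma set_foldr_push: "set (foldr push u w) \<subseteq> set u \<union> set w"
  by (induction u) (use set_push in fastforce)+

text \<open>
  Since pushing the same letter twice does nothing, it does not matter whether a cancellation takes
  place before or after the multiplication by \<open>w\<close>. Associativity follows from this.
\<close>

lemma foldr_push_push:
  "distinct_adj w \<Longrightarrow> foldr push (push c v) w = push c (foldr push v w)"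
  by (cases v) (auto simp: push_push distinct_adj_foldr_push)

lemma foldr_push_assoc:
  "distinct_adj w \<Longrightarrow> foldr push (foldr push u v) w = foldr push u (foldr push v w)"
  by (induction u) (auto simp: foldr_push_push)

lemma foldr_push_append: "distinct_adj (u @ w) \<Longrightarrow> foldr push u w = u @ w"
proof (induction u)
  case (Cons c u)
  then have "foldr push u w = u @ w" by (auto dest: distinct_adj_ConsD)
  with Cons.prems show ?case by (cases "u @ w") (auto simp: distinct_adj_Cons)
qed simp

lemma foldr_push_rev: "distinct_adj w \<Longrightarrow> foldr push (rev u) (foldr push u w) = w"
  by (induction u arbitrary: w) (auto simp: push_push distinct_adj_foldr_push)

lemma group_coxeter: "group (coxeter_group X)"
proof (rule groupI)
  fix u assume u: "u \<in> carrier (coxeter_group X)"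
  then have "foldr push (rev u) u = []"
    using foldr_push_rev[of "[]" u] foldr_push_append[of u "[]"] by (simp add: coxeter_simps)
  then show "\<exists>v\<in>carrier (coxeter_group X). v \<otimes>\<^bsub>coxeter_group X\<^esub> u = \<one>\<^bsub>coxeter_group X\<^esub>"
    using u by (intro bexI[of _ "rev u"]) (auto simp: coxeter_simps)
qed (use set_foldr_push in \<open>fastforce simp: coxeter_simps foldr_push_assoc
       intro: distinct_adj_foldr_push\<close>)+

lemma foldr_push_letter:
  "distinct_adj x \<Longrightarrow> foldr push x [a] = (if x \<noteq> [] \<and> last x = a then butlast x else x @ [a])"
proof (induction x)
  case (Cons c x)
  then have IH: "foldr push x [a] = (if x \<noteq> [] \<and> last x = a then butlast x else x @ [a])"
    by (auto dest: distinct_adj_ConsD)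
  show ?case
    using Cons.prems unfolding foldr.simps comp_apply IH
    by (cases x; cases "tl x") (auto simp: distinct_adj_Cons)
qed simp

text \<open>
  One step towards the root of the Cayley tree, but only along letters of \<open>C\<close>. The restriction
  keeps the path inside \<open>x\<close> times the finite set of short words over \<open>C\<close>, although the
  tree branches infinitely.
\<close>

definition trunc :: "'c set \<Rightarrow> 'c list \<Rightarrow> 'c list" where
  "trunc C x = (if x \<noteq> [] \<and> last x \<in> C then butlast x else x)"

lemma trunc_funpow_suffix: "\<exists>p. x = (trunc C ^^ k) x @ p \<and> set p \<subseteq> C \<and> length p \<le> k"
proof (induction k)
  case (Suc k)
  then obtain p where p: "x = (trunc C ^^ k) x @ p" "set p \<subseteq> C" "length p \<le> k" by blast
  let ?z = "(trunc C ^^ k) x"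
  show ?case
  proof (cases "?z \<noteq> [] \<and> last ?z \<in> C")
    case True
    then have "?z = (trunc C ^^ Suc k) x @ [last ?z]" by (simp add: trunc_def)
    then have "x = (trunc C ^^ Suc k) x @ ([last ?z] @ p)" using p(1) by (metis append.assoc)
    then show ?thesis using True p by (intro exI[of _ "[last ?z] @ p"]) auto
  next
    case False
    then have "(trunc C ^^ Suc k) x = ?z" by (auto simp: trunc_def)
    then show ?thesis using p by (intro exI[of _ p]) auto
  qed
qed simp

text \<open>
  The uniform measure on the first \<open>N\<close> points of the path from \<open>x\<close>; when the path stops early, its
  end carries the remaining mass.
\<close>

definition path_pmf :: "'c set \<Rightarrow> nat \<Rightarrow> 'c list \<Rightarrow> 'c list pmf" where
  "path_pmf C N x = map_pmf (\<lambda>k. (trunc C ^^ k) x) (pmf_of_set {..<N})"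

lemma path_pmf_close_trunc:
  assumes "0 < N"
  shows "pmf_close (2 / real N) (path_pmf C N y) (path_pmf C N (trunc C y))"
proof -
  have "path_pmf C N (trunc C y) = map_pmf (\<lambda>k. (trunc C ^^ Suc k) y) (pmf_of_set {..<N})"
    by (simp add: path_pmf_def funpow_swap1)
  also have "\<dots> = map_pmf (\<lambda>k. (trunc C ^^ k) y) (map_pmf Suc (pmf_of_set {..<N}))"
    by (simp add: map_pmf_comp)
  also have "map_pmf Suc (pmf_of_set {..<N}) = pmf_of_set (Suc ` {..<N})"
    using assms by (intro map_pmf_of_set_inj) auto
  finally have eq: "path_pmf C N (trunc C y) = map_pmf (\<lambda>k. (trunc C ^^ k) y) (pmf_of_set (Suc ` {..<N}))" .
  have "{..<N} - Suc ` {..<N} \<subseteq> {0}"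
  proof
    fix k assume k: "k \<in> {..<N} - Suc ` {..<N}"
    show "k \<in> {0}" using k by (cases k) auto
  qed
  then have "card ({..<N} - Suc ` {..<N}) \<le> card {0::nat}" by (intro card_mono) auto
  then have "card ({..<N} - Suc ` {..<N}) \<le> 1" by simp
  then have "pmf_close (2 * real 1 / real N) (pmf_of_set {..<N}) (pmf_of_set (Suc ` {..<N}))"
    using assms by (intro pmf_close_uniform) (simp_all add: card_image)
  then show ?thesis unfolding eq unfolding path_pmf_def by (intro pmf_close_map) simp
qed

text \<open>
  Multiplying \<open>x\<close> by a letter of \<open>C\<close> on the right appends or deletes the last letter; in either case one
  of the two words is the truncation of the other, so the two paths differ by a shift of one step.
\<close>

lemma exact_coxeter: "exact_group (coxeter_group X)"
proof -
  let ?W = "coxeter_group X"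
  interpret W: group ?W by (rule group_coxeter)
  show ?thesis
  proof (rule W.exact_groupI)
    fix F :: "'a list set" and \<epsilon> :: real
    assume F: "finite F" "F \<subseteq> carrier ?W" "\<epsilon> > 0"
    \<comment> \<open>Only finitely many letters occur in \<open>F\<close>; the paths are allowed to use only these.\<close>
    define C where "C = (\<Union>s\<in>F. set s)"
    define m where "m = (\<Sum>s\<in>F. length s)"
    have m: "length s \<le> m" if "s \<in> F" for s using member_le_sum[of s F length] that F(1) by (simp add: m_def)
    define N where "N = nat \<lceil>2 * real m / \<epsilon>\<rceil> + 1"
    have N: "0 < N" "2 / real N * real m \<le> \<epsilon>"
    proof -
      have "2 * real m / \<epsilon> \<le> real N" unfolding N_def by linarith
      then have "2 * real m \<le> \<epsilon> * real N" using F(3) by (simp add: divide_le_eq mult.commute)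
      moreover show "0 < N" by (simp add: N_def)
      ultimately show "2 / real N * real m \<le> \<epsilon>" by (simp add: divide_le_eq)
    qed
    have step: "pmf_close (2 / real N) (path_pmf C N x) (path_pmf C N (foldr push x [a]))"
      if "distinct_adj x" "a \<in> C" for x a
    proof (cases "x \<noteq> [] \<and> last x = a")
      case True
      then have "foldr push x [a] = trunc C x" using that by (simp add: foldr_push_letter trunc_def)
      then show ?thesis using path_pmf_close_trunc[OF N(1)] by simp
    next
      case False
      then have "trunc C (foldr push x [a]) = x" using that by (auto simp: foldr_push_letter trunc_def)
      then show ?thesis using path_pmf_close_trunc[OF N(1), of C "foldr push x [a]"] pmf_close_sym by fastforce
    qed
    have steps: "pmf_close (2 / real N * real (length s)) (path_pmf C N x) (path_pmf C N (foldr push x s))"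
      if "distinct_adj x" "set s \<subseteq> C" "distinct_adj s" for x s
      using that
    proof (induction s arbitrary: x)
      case Nil
      then show ?case using foldr_push_append[of x "[]"] by (simp add: pmf_close_refl)
    next
      case (Cons a s)
      have s: "distinct_adj s" using Cons.prems by (auto dest: distinct_adj_ConsD)
      have "a # s = foldr push [a] s" using Cons.prems(3) foldr_push_append[of "[a]" s] by simp
      then have eq: "foldr push x (a # s) = foldr push (foldr push x [a]) s"
        using foldr_push_assoc[OF s] by metis
      have "pmf_close (2 / real N + 2 / real N * real (length s)) (path_pmf C N x) (path_pmf C N (foldr push x (a # s)))"
        unfolding eq using Cons.prems s
        by (intro pmf_close_trans[OF step Cons.IH]) (auto intro: distinct_adj_foldr_push)
      then show ?case by (simp add: distrib_left add_divide_distrib)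
    qed
    have "almost_invariant ?W \<epsilon> F (path_pmf C N)"
      unfolding almost_invariant_def
    proof (intro ballI)
      fix x s assume xs: "x \<in> carrier ?W" "s \<in> F"
      then have s: "distinct_adj x" "set s \<subseteq> C" "distinct_adj s"
        using F(2) by (auto simp: coxeter_simps C_def)
      have "2 / real N * real (length s) \<le> 2 / real N * real m"
        using m[OF xs(2)] by (intro mult_left_mono) auto
      then show "pmf_close \<epsilon> (path_pmf C N x) (path_pmf C N (x \<otimes>\<^bsub>?W\<^esub> s))"
        using pmf_close_mono[OF steps[OF s]] N(2) by (auto simp: coxeter_simps)
    qed
    moreover define L where "L = {p. set p \<subseteq> C \<and> length p \<le> N}"
    define E where "E = (\<lambda>(p, q). inv\<^bsub>?W\<^esub> p \<otimes>\<^bsub>?W\<^esub> q) ` (L \<times> L)"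
    have "finite L" unfolding L_def using F(1) by (intro finite_lists_length_le) (auto simp: C_def)
    then have "finite E" by (simp add: E_def)
    moreover have "localized ?W E (path_pmf C N)"
      unfolding localized_def
    proof (intro ballI impI)
      fix x y assume xy: "x \<in> carrier ?W" "y \<in> carrier ?W"
        "set_pmf (path_pmf C N x) \<inter> set_pmf (path_pmf C N y) \<noteq> {}"
      have "set_pmf (pmf_of_set {..<N}) = {..<N}" using N(1) by (intro set_pmf_of_set) auto
      then obtain k l where kl: "k < N" "l < N" "(trunc C ^^ k) x = (trunc C ^^ l) y"
        using xy(3) by (auto simp: path_pmf_def)
      define z where "z = (trunc C ^^ k) x"
      obtain p where p: "x = z @ p" "set p \<subseteq> C" "length p \<le> k"
        using trunc_funpow_suffix[of x k C] z_def by metis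
      obtain q where q: "y = z @ q" "set q \<subseteq> C" "length q \<le> l"
        using trunc_funpow_suffix[of y l C] z_def kl(3) by metis
      have cl: "z \<in> carrier ?W" "p \<in> carrier ?W" "q \<in> carrier ?W"
        using xy(1,2) p q by (auto simp: coxeter_simps distinct_adj_append_iff)
      have eq: "x = z \<otimes>\<^bsub>?W\<^esub> p" "y = z \<otimes>\<^bsub>?W\<^esub> q"
        using xy(1,2) p(1) q(1) foldr_push_append[of z p] foldr_push_append[of z q] by (simp_all add: coxeter_simps)
      have "inv\<^bsub>?W\<^esub> z \<otimes>\<^bsub>?W\<^esub> (z \<otimes>\<^bsub>?W\<^esub> q) = q" using cl by (simp add: W.m_assoc[symmetric])
      then have "inv\<^bsub>?W\<^esub> x \<otimes>\<^bsub>?W\<^esub> y = inv\<^bsub>?W\<^esub> p \<otimes>\<^bsub>?W\<^esub> q"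
        unfolding eq using cl by (simp add: W.inv_mult_group W.m_assoc)
      moreover have "p \<in> L" "q \<in> L" using p q kl by (auto simp: L_def)
      ultimately show "inv\<^bsub>?W\<^esub> x \<otimes>\<^bsub>?W\<^esub> y \<in> E" unfolding E_def by force
    qed
    ultimately show "\<exists>(\<tau> :: 'a list \<Rightarrow> 'a list pmf) E. finite E \<and> almost_invariant ?W \<epsilon> F \<tau> \<and> localized ?W E \<tau>"
      by blast
  qed
qed

section \<open>Amalgamated free products\<close>

lemma (in group) mult_inv_cancel:
  "x \<in> carrier G \<Longrightarrow> y \<in> carrier G \<Longrightarrow> inv x \<otimes> (x \<otimes> y) = y"
  "x \<in> carrier G \<Longrightarrow> y \<in> carrier G \<Longrightarrow> x \<otimes> (inv x \<otimes> y) = y"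
  by (simp_all add: m_assoc[symmetric])

locale amalgam = G1: group G1 + G2: group G2
  for G1 :: "('a, 'x) monoid_scheme" and G2 :: "('b, 'y) monoid_scheme" +
  fixes C :: "('c, 'z) monoid_scheme" and f1 :: "'c \<Rightarrow> 'a" and f2 :: "'c \<Rightarrow> 'b"
  assumes f1: "c \<in> carrier C \<Longrightarrow> f1 c \<in> carrier G1"
    and f2: "c \<in> carrier C \<Longrightarrow> f2 c \<in> carrier G2"
begin

abbreviation "cong_words \<equiv> amalgam_cong G1 G2 C f1 f2"
abbreviation "words \<equiv> amalgam_words G1 G2"
abbreviation "A \<equiv> amalgamated_free_product G1 G2 C f1 f2"

lemma words_simps:
  "[] \<in> words"
  "x # v \<in> words \<longleftrightarrow> x \<in> carrier G1 <+> carrier G2 \<and> v \<in> words"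
  "v @ w \<in> words \<longleftrightarrow> v \<in> words \<and> w \<in> words"
  by (auto simp: amalgam_words_def)

lemma cong_words_in_words: "cong_words v w \<Longrightarrow> v \<in> words \<and> w \<in> words"
  by (induction rule: amalgam_cong.induct) (auto simp: words_simps f1 f2)

definition cls :: "('a + 'b) list \<Rightarrow> ('a + 'b) list set" where
  "cls v = {(v, w). cong_words v w} `` {v}"

lemma equiv_cong: "equiv words {(v, w). cong_words v w}"
proof (rule equivI)
  show "refl_on words {(v, w). cong_words v w}"
    using amalgam_cong.refl by (auto simp: refl_on_def)
  show "sym {(v, w). cong_words v w}" by (auto intro: symI amalgam_cong.sym)
  show "trans {(v, w). cong_words v w}" by (rule transI) (auto intro: amalgam_cong.trans)
  show "{(v, w). cong_words v w} \<subseteq> words \<times> words" using cong_words_in_words by blast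
qed

lemma cls_eq_iff: "v \<in> words \<Longrightarrow> w \<in> words \<Longrightarrow> cls v = cls w \<longleftrightarrow> cong_words v w"
  unfolding cls_def using eq_equiv_class_iff[OF equiv_cong] by simp

lemma cls_eq: "cong_words v w \<Longrightarrow> cls v = cls w"
  using cls_eq_iff cong_words_in_words by blast

lemma carrier_A: "carrier A = cls ` words"
  by (auto simp: amalgamated_free_product_def Let_def quotient_def cls_def)

lemma one_A: "\<one>\<^bsub>A\<^esub> = cls []"
  by (simp add: amalgamated_free_product_def Let_def cls_def)

lemma mult_A:
  assumes "v \<in> words" "w \<in> words"
  shows "cls v \<otimes>\<^bsub>A\<^esub> cls w = cls (v @ w)"
proof -
  have "cls v \<otimes>\<^bsub>A\<^esub> cls w = (\<Union>v'\<in>cls v. \<Union>w'\<in>cls w. cls (v' @ w'))"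
    by (simp add: amalgamated_free_product_def Let_def cls_def)
  also have "\<dots> = (\<Union>v'\<in>cls v. \<Union>w'\<in>cls w. cls (v @ w))"
  proof (intro SUP_cong HOL.refl)
    fix v' w' assume "v' \<in> cls v" "w' \<in> cls w"
    then have "cong_words (v @ w) (v' @ w')" unfolding cls_def by (auto intro: amalgam_cong.append)
    then show "cls (v' @ w') = cls (v @ w)" by (simp add: cls_eq)
  qed
  also have "\<dots> = cls (v @ w)"
    using assms amalgam_cong.refl[of v] amalgam_cong.refl[of w] unfolding cls_def by fastforce
  finally show ?thesis .
qed

lemma cls_Cons: "x # v \<in> words \<Longrightarrow> cls (x # v) = cls [x] \<otimes>\<^bsub>A\<^esub> cls v"
  by (subst mult_A) (auto simp: words_simps)

lemma letter_inverse:
  assumes "x \<in> carrier G1 <+> carrier G2"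
  shows "\<exists>y \<in> carrier G1 <+> carrier G2. cong_words [y, x] []"
  using assms
proof
  fix a assume a: "a \<in> carrier G1" "x = Inl a"
  then have "cong_words [Inl (inv\<^bsub>G1\<^esub> a), Inl a] [Inl (inv\<^bsub>G1\<^esub> a \<otimes>\<^bsub>G1\<^esub> a)]"
    by (intro amalgam_cong.mult_left) auto
  then have "cong_words [Inl (inv\<^bsub>G1\<^esub> a), Inl a] [Inl \<one>\<^bsub>G1\<^esub>]" using a by simp
  from amalgam_cong.trans[OF this amalgam_cong.one_left]
  have "cong_words [Inl (inv\<^bsub>G1\<^esub> a), Inl a] []" .
  with a show ?thesis by (intro bexI[of _ "Inl (inv\<^bsub>G1\<^esub> a)"]) auto
next
  fix a assume a: "a \<in> carrier G2" "x = Inr a"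
  then have "cong_words [Inr (inv\<^bsub>G2\<^esub> a), Inr a] [Inr (inv\<^bsub>G2\<^esub> a \<otimes>\<^bsub>G2\<^esub> a)]"
    by (intro amalgam_cong.mult_right) auto
  then have "cong_words [Inr (inv\<^bsub>G2\<^esub> a), Inr a] [Inr \<one>\<^bsub>G2\<^esub>]" using a by simp
  from amalgam_cong.trans[OF this amalgam_cong.one_right]
  have "cong_words [Inr (inv\<^bsub>G2\<^esub> a), Inr a] []" .
  with a show ?thesis by (intro bexI[of _ "Inr (inv\<^bsub>G2\<^esub> a)"]) auto
qed

lemma word_inverse: "v \<in> words \<Longrightarrow> \<exists>u\<in>words. cong_words (u @ v) []"
proof (induction v)
  case Nil
  then show ?case by (intro bexI[of _ "[]"]) (auto simp: words_simps intro: amalgam_cong.refl)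
next
  case (Cons x v)
  then obtain u where u: "u \<in> words" "cong_words (u @ v) []" by (auto simp: words_simps)
  obtain y where y: "y \<in> carrier G1 <+> carrier G2" "cong_words [y, x] []"
    using letter_inverse[of x] Cons.prems unfolding words_simps(2) by blast
  have "cong_words (u @ ([y, x] @ v)) (u @ ([] @ v))"
    using u Cons.prems y by (intro amalgam_cong.append amalgam_cong.refl) (auto simp: words_simps)
  then have "cong_words ((u @ [y]) @ x # v) []" using u(2) amalgam_cong.trans by fastforce
  then show ?case using u y by (intro bexI[of _ "u @ [y]"]) (auto simp: words_simps)
qed

lemma group_A: "group A"
proof (rule groupI)
  fix V assume "V \<in> carrier A"
  then obtain v where v: "v \<in> words" "V = cls v" by (auto simp: carrier_A)
  obtain u where u: "u \<in> words" "cong_words (u @ v) []" using word_inverse[OF v(1)] by blast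
  then show "\<exists>U\<in>carrier A. U \<otimes>\<^bsub>A\<^esub> V = \<one>\<^bsub>A\<^esub>"
    using v cls_eq[OF u(2)] u(1) by (intro bexI[of _ "cls u"]) (simp_all add: mult_A one_A carrier_A)
qed (auto simp: carrier_A one_A mult_A words_simps)

sublocale A: group A by (rule group_A)

abbreviation "inl g \<equiv> cls [Inl g]"
abbreviation "inr g \<equiv> cls [Inr g]"

lemma inl_closed: "g \<in> carrier G1 \<Longrightarrow> inl g \<in> carrier A"
  and inr_closed: "h \<in> carrier G2 \<Longrightarrow> inr h \<in> carrier A"
  by (auto simp: carrier_A words_simps)

lemma inl_mult: "g \<in> carrier G1 \<Longrightarrow> h \<in> carrier G1 \<Longrightarrow> inl (g \<otimes>\<^bsub>G1\<^esub> h) = inl g \<otimes>\<^bsub>A\<^esub> inl h"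
  by (subst mult_A) (auto simp: words_simps intro!: cls_eq amalgam_cong.mult_left[THEN amalgam_cong.sym])

lemma inr_mult: "g \<in> carrier G2 \<Longrightarrow> h \<in> carrier G2 \<Longrightarrow> inr (g \<otimes>\<^bsub>G2\<^esub> h) = inr g \<otimes>\<^bsub>A\<^esub> inr h"
  by (subst mult_A) (auto simp: words_simps intro!: cls_eq amalgam_cong.mult_right[THEN amalgam_cong.sym])

lemma inl_hom: "group_hom G1 A inl" and inr_hom: "group_hom G2 A inr"
  by (unfold_locales, auto simp: hom_def inl_closed inl_mult inr_closed inr_mult)+

lemma inl_eq_inr: "c \<in> carrier C \<Longrightarrow> inl (f1 c) = inr (f2 c)"
  by (intro cls_eq amalgam_cong.amalgamate)

lemma inl_one: "inl \<one>\<^bsub>G1\<^esub> = \<one>\<^bsub>A\<^esub>" and inr_one: "inr \<one>\<^bsub>G2\<^esub> = \<one>\<^bsub>A\<^esub>"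
  by (rule group_hom.hom_one[OF inl_hom], rule group_hom.hom_one[OF inr_hom])

lemma finitely_generated_A:
  assumes "finitely_generated G1" "finitely_generated G2"
  shows "finitely_generated A"
proof -
  obtain S where S: "finite S" "S \<subseteq> carrier G1" "generate G1 S = carrier G1"
    by (rule finitely_generatedE[OF assms(1)])
  obtain T where T: "finite T" "T \<subseteq> carrier G2" "generate G2 T = carrier G2"
    by (rule finitely_generatedE[OF assms(2)])
  let ?U = "inl ` S \<union> inr ` T"
  have sub: "?U \<subseteq> carrier A" using S T by (auto intro: inl_closed inr_closed)
  interpret U: subgroup "generate A ?U" A by (rule A.generate_is_subgroup[OF sub])
  have "inl ` carrier G1 \<subseteq> generate A ?U"
    using group_hom.generate_img[OF inl_hom S(2)] A.mono_generate[of "inl ` S" ?U] S(3) by auto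
  moreover have "inr ` carrier G2 \<subseteq> generate A ?U"
    using group_hom.generate_img[OF inr_hom T(2)] A.mono_generate[of "inr ` T" ?U] T(3) by auto
  ultimately have letters: "cls [x] \<in> generate A ?U" if "x \<in> carrier G1 <+> carrier G2" for x
    using that by auto
  have "cls v \<in> generate A ?U" if "v \<in> words" for v
    using that
  proof (induction v)
    case Nil
    then show ?case using U.one_closed by (simp add: one_A)
  next
    case (Cons x v)
    then show ?case using letters[of x] by (subst cls_Cons) (simp_all add: words_simps)
  qed
  then have "carrier A \<subseteq> generate A ?U" by (auto simp: carrier_A)
  then show ?thesis using S(1) T(1) sub by (intro A.finitely_generatedI[of ?U]) auto
qed

end

section \<open>The double of a group along a subgroup\<close>

text \<open>
  Both factors are the group \<open>G\<close>, and they are glued along the image \<open>H\<close> of \<open>\<iota>\<close>.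
\<close>

locale double = G: group G for G :: "('a, 'x) monoid_scheme" +
  fixes C :: "('c, 'z) monoid_scheme" and \<iota> :: "'c \<Rightarrow> 'a"
  assumes sub: "subgroup (\<iota> ` carrier C) G"
begin

abbreviation "H \<equiv> \<iota> ` carrier C"
abbreviation "X \<equiv> lcosets\<^bsub>G\<^esub> H"

lemma H_subset: "H \<subseteq> carrier G" using sub by (rule subgroup.subset)

sublocale amalgam G G C \<iota> \<iota>
  using H_subset by unfold_locales auto

abbreviation "W \<equiv> coxeter_group X"
abbreviation "act g w \<equiv> map (\<lambda>c. g <#\<^bsub>G\<^esub> c) w"

lemma H_in_X: "H \<in> X"
  using G.lcos_mult_one[OF H_subset] unfolding LCOSETS_def by force

lemmas X_action = G.lcosets_action[OF sub]

lemma act_inj: "g \<in> carrier G \<Longrightarrow> c \<in> X \<Longrightarrow> d \<in> X \<Longrightarrow> g <#\<^bsub>G\<^esub> c = g <#\<^bsub>G\<^esub> d \<longleftrightarrow> c = d"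
  using X_action(4) by metis

lemma distinct_adj_act: "g \<in> carrier G \<Longrightarrow> set w \<subseteq> X \<Longrightarrow> distinct_adj w \<Longrightarrow> distinct_adj (act g w)"
  by (induction w rule: induct_list012) (auto simp: act_inj)

lemma act_push:
  "g \<in> carrier G \<Longrightarrow> c \<in> X \<Longrightarrow> set w \<subseteq> X \<Longrightarrow> act g (push c w) = push (g <#\<^bsub>G\<^esub> c) (act g w)"
  by (cases w) (auto simp: act_inj)

lemma act_foldr_push:
  "g \<in> carrier G \<Longrightarrow> set u \<subseteq> X \<Longrightarrow> set w \<subseteq> X \<Longrightarrow> act g (foldr push u w) = foldr push (act g u) (act g w)"
proof (induction u)
  case (Cons c u)
  moreover have "set (foldr push u w) \<subseteq> X" using Cons.prems set_foldr_push[of u w] by auto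
  ultimately show ?case by (simp add: act_push)
qed simp

sublocale semidirect W G act
proof (rule semidirect.intro)
  show "group W" by (rule group_coxeter)
  show "group G" by (rule G.is_group)
next
  fix g assume g: "g \<in> carrier G"
  have cl: "act g w \<in> carrier W" if "w \<in> carrier W" for w
    using that g X_action(1) distinct_adj_act[of g w] by (auto simp: coxeter_simps)
  have "act g (foldr push u w) = foldr push (act g u) (act g w)" if "u \<in> carrier W" "w \<in> carrier W" for u w
    using that g by (intro act_foldr_push) (auto simp: coxeter_simps)
  with cl show "act g \<in> hom W W" by (auto intro!: homI simp: coxeter_simps(2))
  fix h w assume "h \<in> carrier G" "w \<in> carrier W"
  then show "act (g \<otimes>\<^bsub>G\<^esub> h) w = act g (act h w)"
    using g X_action(3) by (auto simp: coxeter_simps)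
next
  fix w assume "w \<in> carrier W"
  then show "act \<one>\<^bsub>G\<^esub> w = w"
    using X_action(2) by (auto simp: coxeter_simps intro: map_idI)
qed


abbreviation "letter c \<equiv> [c] :: 'a set list"

lemma letter_closed: "c \<in> X \<Longrightarrow> letter c \<in> carrier W"
  by (simp add: coxeter_simps)

text \<open>
  The second factor goes to \<open>G\<close> itself, and the first one to the conjugate of \<open>G\<close> by the letter
  of the trivial coset \<open>H\<close>: the conjugate of \<open>g\<close> is the product of the letters \<open>H\<close> and
  \<open>g H\<close>, followed by \<open>g\<close>. For \<open>g\<close> in \<open>H\<close> the two letters cancel, so both copies of \<open>H\<close> agree.
\<close>

fun embed_letter :: "'a + 'a \<Rightarrow> 'a set list \<times> 'a" where
  "embed_letter (Inl g) = (letter H \<otimes>\<^bsub>W\<^esub> letter (g <#\<^bsub>G\<^esub> H), g)"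
| "embed_letter (Inr g) = (\<one>\<^bsub>W\<^esub>, g)"

definition embed_word :: "('a + 'a) list \<Rightarrow> 'a set list \<times> 'a" where
  "embed_word v = foldr (\<lambda>x b. embed_letter x \<otimes>\<^bsub>SD\<^esub> b) v \<one>\<^bsub>SD\<^esub>"

lemma letter_mult_self: "c \<in> X \<Longrightarrow> letter c \<otimes>\<^bsub>W\<^esub> letter c = \<one>\<^bsub>W\<^esub>"
  by (simp add: coxeter_simps)

lemma coset_in_X: "g \<in> carrier G \<Longrightarrow> g <#\<^bsub>G\<^esub> H \<in> X"
  using X_action(1)[OF H_in_X] by blast

lemma embed_letter_closed: "x \<in> carrier G <+> carrier G \<Longrightarrow> embed_letter x \<in> carrier SD"
  using letter_closed[OF H_in_X] letter_closed[OF coset_in_X] by (auto simp: carrier_SD)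

lemma embed_word_closed: "v \<in> words \<Longrightarrow> embed_word v \<in> carrier SD"
proof (induction v)
  case (Cons x v)
  then show ?case using embed_letter_closed[of x] by (simp add: embed_word_def words_simps)
qed (simp add: embed_word_def)

lemma embed_word_append: "v \<in> words \<Longrightarrow> w \<in> words \<Longrightarrow> embed_word (v @ w) = embed_word v \<otimes>\<^bsub>SD\<^esub> embed_word w"
proof (induction v)
  case Nil
  then show ?case using embed_word_closed[of w] by (simp add: embed_word_def)
next
  case (Cons x v)
  have "embed_word ((x # v) @ w) = embed_letter x \<otimes>\<^bsub>SD\<^esub> embed_word (v @ w)" by (simp add: embed_word_def)
  also have "\<dots> = embed_letter x \<otimes>\<^bsub>SD\<^esub> (embed_word v \<otimes>\<^bsub>SD\<^esub> embed_word w)"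
    using Cons by (simp add: words_simps)
  also have "\<dots> = embed_letter x \<otimes>\<^bsub>SD\<^esub> embed_word v \<otimes>\<^bsub>SD\<^esub> embed_word w"
    using Cons.prems embed_letter_closed[of x] embed_word_closed[of v] embed_word_closed[of w]
    by (simp add: words_simps SD.m_assoc)
  also have "embed_letter x \<otimes>\<^bsub>SD\<^esub> embed_word v = embed_word (x # v)" by (simp add: embed_word_def)
  finally show ?case .
qed

lemma embed_word_single: "x \<in> carrier G <+> carrier G \<Longrightarrow> embed_word [x] = embed_letter x"
  using embed_letter_closed[of x] by (simp add: embed_word_def)

lemma embed_word_two:
  "x \<in> carrier G <+> carrier G \<Longrightarrow> y \<in> carrier G <+> carrier G \<Longrightarrow>
    embed_word [x, y] = embed_letter x \<otimes>\<^bsub>SD\<^esub> embed_letter y"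
  using embed_letter_closed[of x] embed_letter_closed[of y] by (simp add: embed_word_def)

lemma embed_cong: "cong_words v w \<Longrightarrow> embed_word v = embed_word w"
proof (induction rule: amalgam_cong.induct)
  case (append v v' w w')
  then show ?case using cong_words_in_words[of v v'] cong_words_in_words[of w w'] by (simp add: embed_word_append)
next
  case one_left
  have "\<one>\<^bsub>G\<^esub> <#\<^bsub>G\<^esub> H = H" using H_subset by (rule G.lcos_mult_one)
  then have "embed_letter (Inl \<one>\<^bsub>G\<^esub>) = \<one>\<^bsub>SD\<^esub>" using letter_mult_self[OF H_in_X] by (simp add: one_SD)
  then show ?case by (simp add: embed_word_def)
next
  case one_right
  then show ?case by (simp add: embed_word_def one_SD[symmetric])
next
  case (mult_left x y)
  let ?a = "letter H" and ?b = "letter (x <#\<^bsub>G\<^esub> H)" and ?c = "letter ((x \<otimes>\<^bsub>G\<^esub> y) <#\<^bsub>G\<^esub> H)"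
  have cl: "?a \<in> carrier W" "?b \<in> carrier W" "?c \<in> carrier W"
    using mult_left letter_closed[OF H_in_X] letter_closed[OF coset_in_X] by auto
  have yX: "y <#\<^bsub>G\<^esub> H \<in> X" using coset_in_X mult_left by blast
  have "act x (?a \<otimes>\<^bsub>W\<^esub> letter (y <#\<^bsub>G\<^esub> H)) = ?b \<otimes>\<^bsub>W\<^esub> ?c"
    using mult_left X_action(3)[OF H_in_X] letter_closed[OF H_in_X] letter_closed[OF yX]
    by (subst act_H_mult) auto
  then have "embed_letter (Inl x) \<otimes>\<^bsub>SD\<^esub> embed_letter (Inl y) = (?a \<otimes>\<^bsub>W\<^esub> ?b \<otimes>\<^bsub>W\<^esub> (?b \<otimes>\<^bsub>W\<^esub> ?c), x \<otimes>\<^bsub>G\<^esub> y)"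
    by (simp only: embed_letter.simps mult_SD)
  also have "?a \<otimes>\<^bsub>W\<^esub> ?b \<otimes>\<^bsub>W\<^esub> (?b \<otimes>\<^bsub>W\<^esub> ?c) = ?a \<otimes>\<^bsub>W\<^esub> (?b \<otimes>\<^bsub>W\<^esub> ?b \<otimes>\<^bsub>W\<^esub> ?c)"
    using cl by (simp only: H.m_assoc H.m_closed)
  also have "?b \<otimes>\<^bsub>W\<^esub> ?b = \<one>\<^bsub>W\<^esub>" using coset_in_X mult_left by (intro letter_mult_self) auto
  also have "\<one>\<^bsub>W\<^esub> \<otimes>\<^bsub>W\<^esub> ?c = ?c" using cl by (intro H.l_one)
  also have "(?a \<otimes>\<^bsub>W\<^esub> ?c, x \<otimes>\<^bsub>G\<^esub> y) = embed_letter (Inl (x \<otimes>\<^bsub>G\<^esub> y))" by simp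
  finally show ?case using mult_left by (simp only: embed_word_two embed_word_single InlI G.m_closed)
next
  case (mult_right x y)
  moreover from this have "embed_letter (Inr x) \<otimes>\<^bsub>SD\<^esub> embed_letter (Inr y) = embed_letter (Inr (x \<otimes>\<^bsub>G\<^esub> y))"
    by (simp only: embed_letter.simps mult_SD act_H_one H.l_one H.one_closed)
  ultimately show ?case by (simp only: embed_word_two embed_word_single InrI G.m_closed)
next
  case (amalgamate c)
  then have "\<iota> c <#\<^bsub>G\<^esub> H = H"
    using sub G.is_group by (metis G.coset_join3 H_subset image_eqI subset_iff)
  then have "embed_letter (Inl (\<iota> c)) = embed_letter (Inr (\<iota> c))"
    using letter_mult_self[OF H_in_X] by simp
  then show ?case by (simp add: embed_word_def)
qed auto

definition embed :: "('a + 'a) list set \<Rightarrow> 'a set list \<times> 'a" where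
  "embed V = embed_word (SOME v. v \<in> words \<and> cls v = V)"

lemma embed_cls:
  assumes "v \<in> words" shows "embed (cls v) = embed_word v"
proof -
  define u where "u = (SOME u. u \<in> words \<and> cls u = cls v)"
  have "u \<in> words \<and> cls u = cls v" unfolding u_def by (rule someI[of _ v]) (simp add: assms)
  then have "cong_words u v" using assms cls_eq_iff by blast
  then show ?thesis unfolding embed_def u_def[symmetric] by (rule embed_cong)
qed

lemma embed_hom: "embed \<in> hom A SD"
proof (rule homI)
  show "embed V \<in> carrier SD" if "V \<in> carrier A" for V
    using that embed_word_closed embed_cls by (auto simp: carrier_A)
  show "embed (V \<otimes>\<^bsub>A\<^esub> V') = embed V \<otimes>\<^bsub>SD\<^esub> embed V'" if "V \<in> carrier A" "V' \<in> carrier A" for V V'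
    using that by (auto simp: carrier_A mult_A embed_cls embed_word_append words_simps)
qed

text \<open>
  The obstruction to \<open>g\<close> being the same element in both factors. It depends on the coset
  \<open>g H\<close> only and corresponds to the product of the letters \<open>H\<close> and \<open>g H\<close>.
\<close>

definition defect :: "'a \<Rightarrow> ('a + 'a) list set" where
  "defect g = inl g \<otimes>\<^bsub>A\<^esub> inv\<^bsub>A\<^esub> inr g"

definition coset_defect :: "'a set \<Rightarrow> ('a + 'a) list set" where
  "coset_defect c = defect (SOME g. g \<in> carrier G \<and> g <#\<^bsub>G\<^esub> H = c)"

lemma defect_closed: "g \<in> carrier G \<Longrightarrow> defect g \<in> carrier A"
  by (simp add: defect_def inl_closed inr_closed)

lemma defect_coset:
  assumes "g \<in> carrier G" "h \<in> carrier G" "g <#\<^bsub>G\<^esub> H = h <#\<^bsub>G\<^esub> H"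
  shows "defect g = defect h"
proof -
  have "h \<in> g <#\<^bsub>G\<^esub> H" using G.lcos_self[OF assms(2) sub] assms(3) by simp
  then obtain c where c: "c \<in> carrier C" "h = g \<otimes>\<^bsub>G\<^esub> \<iota> c" by (auto simp: l_coset_def)
  have "defect h = inl g \<otimes>\<^bsub>A\<^esub> inr (\<iota> c) \<otimes>\<^bsub>A\<^esub> (inv\<^bsub>A\<^esub> inr (\<iota> c) \<otimes>\<^bsub>A\<^esub> inv\<^bsub>A\<^esub> inr g)"
    using assms(1) c f1[of c]
    by (simp add: defect_def inl_mult inr_mult inl_eq_inr A.inv_mult_group inr_closed)
  also have "\<dots> = defect g"
    using assms(1) f1[OF c(1)]
    by (simp add: defect_def inr_closed inl_closed A.m_assoc A.mult_inv_cancel)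
  finally show ?thesis by simp
qed

lemma coset_defect:
  assumes "g \<in> carrier G"
  shows "coset_defect (g <#\<^bsub>G\<^esub> H) = defect g"
proof -
  define h where "h = (SOME h. h \<in> carrier G \<and> h <#\<^bsub>G\<^esub> H = g <#\<^bsub>G\<^esub> H)"
  have "h \<in> carrier G \<and> h <#\<^bsub>G\<^esub> H = g <#\<^bsub>G\<^esub> H"
    unfolding h_def by (rule someI[of _ g]) (simp add: assms)
  then show ?thesis unfolding coset_defect_def h_def[symmetric] using assms by (intro defect_coset) auto
qed

lemma coset_defect_closed: "c \<in> X \<Longrightarrow> coset_defect c \<in> carrier A"
  by (auto simp: LCOSETS_def coset_defect defect_closed)

lemma coset_defect_H: "coset_defect H = \<one>\<^bsub>A\<^esub>"
  using coset_defect[OF G.one_closed] G.lcos_mult_one[OF H_subset]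
  by (simp add: defect_def inl_one inr_one)

text \<open>
  The defect behaves like a path between vertices of the Bass-Serre tree that belong to different
  factors: translation by \<open>g\<close> acts through the first factor at one end and through the second
  factor at the other.
\<close>

lemma coset_defect_act:
  assumes "g \<in> carrier G" "c \<in> X"
  shows "coset_defect (g <#\<^bsub>G\<^esub> c) = inl g \<otimes>\<^bsub>A\<^esub> coset_defect c \<otimes>\<^bsub>A\<^esub> inv\<^bsub>A\<^esub> inr g"
proof -
  obtain k where k: "k \<in> carrier G" "c = k <#\<^bsub>G\<^esub> H" using assms(2) by (auto simp: LCOSETS_def)
  then have "g <#\<^bsub>G\<^esub> c = (g \<otimes>\<^bsub>G\<^esub> k) <#\<^bsub>G\<^esub> H" using assms X_action(3)[OF H_in_X] by simp
  then show ?thesis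
    using assms k by (simp add: coset_defect defect_def inl_mult inr_mult A.inv_mult_group
        inl_closed inr_closed A.m_assoc)
qed

text \<open>
  The Boolean says at which of the two kinds of vertices of the Bass-Serre tree one stands; it
  alternates along a word.
\<close>

fun side :: "bool \<Rightarrow> 'a \<Rightarrow> ('a + 'a) list set" where
  "side True g = inr g"
| "side False g = inl g"

fun signed_defect :: "bool \<Rightarrow> 'a set \<Rightarrow> ('a + 'a) list set" where
  "signed_defect True c = inv\<^bsub>A\<^esub> coset_defect c"
| "signed_defect False c = coset_defect c"

text \<open>
  A word \<open>c\<^sub>1 c\<^sub>2 c\<^sub>3 c\<^sub>4\<close> of cosets is read as a product of defects with alternating
  exponents \<open>-1\<close> and \<open>1\<close>. On words of odd length the group element \<open>h\<close> is put into the first factor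
  instead of the second, so that the map is compatible with multiplication by elements of the
  amalgam without any condition on the parity.
\<close>

fun retract :: "bool \<Rightarrow> 'a set list \<Rightarrow> 'a \<Rightarrow> ('a + 'a) list set" where
  "retract p [] h = side p h"
| "retract p (c # w) h = signed_defect p c \<otimes>\<^bsub>A\<^esub> retract (\<not> p) w h"

lemma side_closed: "g \<in> carrier G \<Longrightarrow> side p g \<in> carrier A"
  by (cases p) (auto simp: inl_closed inr_closed)

lemma side_mult: "g \<in> carrier G \<Longrightarrow> h \<in> carrier G \<Longrightarrow> side p (g \<otimes>\<^bsub>G\<^esub> h) = side p g \<otimes>\<^bsub>A\<^esub> side p h"
  by (cases p) (auto simp: inl_mult inr_mult)

lemma signed_defect_closed: "c \<in> X \<Longrightarrow> signed_defect p c \<in> carrier A"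
  by (cases p) (auto simp: coset_defect_closed)

lemma retract_closed: "set w \<subseteq> X \<Longrightarrow> h \<in> carrier G \<Longrightarrow> retract p w h \<in> carrier A"
  by (induction w arbitrary: p) (auto simp: side_closed signed_defect_closed)

lemma signed_defect_cancel: "c \<in> X \<Longrightarrow> signed_defect p c \<otimes>\<^bsub>A\<^esub> signed_defect (\<not> p) c = \<one>\<^bsub>A\<^esub>"
  by (cases p) (auto simp: coset_defect_closed)

lemma signed_defect_act:
  "g \<in> carrier G \<Longrightarrow> c \<in> X \<Longrightarrow>
    signed_defect p (g <#\<^bsub>G\<^esub> c) = side p g \<otimes>\<^bsub>A\<^esub> signed_defect p c \<otimes>\<^bsub>A\<^esub> inv\<^bsub>A\<^esub> side (\<not> p) g"
  by (cases p) (auto simp: coset_defect_act A.inv_mult_group coset_defect_closed inl_closed inr_closed A.m_assoc)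

lemma retract_push:
  assumes "c \<in> X" "set w \<subseteq> X" "h \<in> carrier G"
  shows "retract p (push c w) h = signed_defect p c \<otimes>\<^bsub>A\<^esub> retract (\<not> p) w h"
proof (cases w)
  case (Cons d v)
  show ?thesis
  proof (cases "d = c")
    case True
    have "signed_defect p c \<otimes>\<^bsub>A\<^esub> (signed_defect (\<not> p) c \<otimes>\<^bsub>A\<^esub> retract p v h) = retract p v h"
      using assms Cons by (simp add: A.m_assoc[symmetric] signed_defect_closed signed_defect_cancel retract_closed)
    then show ?thesis using Cons True by simp
  qed (use Cons in simp)
qed simp

text \<open>
  The conjugating factors of neighbouring defects cancel, because \<open>side\<close> alternates as well.
\<close>

lemma retract_act:
  assumes "g \<in> carrier G" "set w \<subseteq> X" "h \<in> carrier G"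
  shows "retract p (act g w) (g \<otimes>\<^bsub>G\<^esub> h) = side p g \<otimes>\<^bsub>A\<^esub> retract p w h"
  using assms(2)
proof (induction w arbitrary: p)
  case Nil
  then show ?case using assms by (simp add: side_mult)
next
  case (Cons c w)
  then have cl: "side p g \<in> carrier A" "side (\<not> p) g \<in> carrier A" "signed_defect p c \<in> carrier A"
    "retract (\<not> p) w h \<in> carrier A"
    using assms by (auto simp: side_closed signed_defect_closed retract_closed)
  have "retract p (act g (c # w)) (g \<otimes>\<^bsub>G\<^esub> h) =
      side p g \<otimes>\<^bsub>A\<^esub> signed_defect p c \<otimes>\<^bsub>A\<^esub> inv\<^bsub>A\<^esub> side (\<not> p) g \<otimes>\<^bsub>A\<^esub> (side (\<not> p) g \<otimes>\<^bsub>A\<^esub> retract (\<not> p) w h)"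
    using Cons assms by (simp add: signed_defect_act)
  also have "\<dots> = side p g \<otimes>\<^bsub>A\<^esub> retract p (c # w) h"
    using cl by (simp add: A.m_assoc A.mult_inv_cancel)
  finally show ?case .
qed

text \<open>
  The retraction commutes with left multiplication by the images of both factors; hence it undoes
  \<open>embed_word\<close>, letter by letter, and \<open>embed\<close> is injective.
\<close>

lemma retract_embed_letter:
  assumes "x \<in> carrier G <+> carrier G" "w \<in> carrier W" "h \<in> carrier G"
  shows "(case embed_letter x \<otimes>\<^bsub>SD\<^esub> (w, h) of (u, k) \<Rightarrow> retract True u k) = cls [x] \<otimes>\<^bsub>A\<^esub> retract True w h"
  using assms(1)
proof
  fix g assume g: "g \<in> carrier G" "x = Inl g"
  have w: "set w \<subseteq> X" "distinct_adj w" using assms(2) by (auto simp: coxeter_simps)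
  have aw: "set (act g w) \<subseteq> X" "distinct_adj (act g w)"
    using w X_action(1) g distinct_adj_act by auto
  let ?c = "g <#\<^bsub>G\<^esub> H"
  have cX: "?c \<in> X" using coset_in_X g by blast
  have "foldr push (foldr push [H] [?c]) (act g w) = push H (push ?c (act g w))"
    using aw by (subst foldr_push_assoc) auto
  then have "embed_letter x \<otimes>\<^bsub>SD\<^esub> (w, h) = (push H (push ?c (act g w)), g \<otimes>\<^bsub>G\<^esub> h)"
    unfolding g(2) embed_letter.simps mult_SD coxeter_simps(2) by simp
  moreover have "retract True (push H (push ?c (act g w))) (g \<otimes>\<^bsub>G\<^esub> h) =
      inv\<^bsub>A\<^esub> coset_defect H \<otimes>\<^bsub>A\<^esub> (coset_defect ?c \<otimes>\<^bsub>A\<^esub> (inr g \<otimes>\<^bsub>A\<^esub> retract True w h))"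
    using H_in_X cX aw w g assms(3) subset_trans[OF set_push[of ?c "act g w"], of X]
    by (simp add: retract_push retract_act)
  moreover have "\<dots> = inl g \<otimes>\<^bsub>A\<^esub> retract True w h"
    using g w assms(3) unfolding coset_defect_H coset_defect[OF g(1)] defect_def
    by (simp add: inl_closed inr_closed retract_closed A.m_assoc A.mult_inv_cancel)
  ultimately show ?thesis using g by simp
next
  fix g assume g: "g \<in> carrier G" "x = Inr g"
  have w: "set w \<subseteq> X" using assms(2) by (auto simp: coxeter_simps)
  have "act g w \<in> carrier W" using act_closed g assms by blast
  then have "embed_letter x \<otimes>\<^bsub>SD\<^esub> (w, h) = (act g w, g \<otimes>\<^bsub>G\<^esub> h)"
    unfolding g(2) embed_letter.simps mult_SD by simp
  then show ?thesis using g w assms(3) by (simp add: retract_act)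
qed

lemma retract_embed_word: "v \<in> words \<Longrightarrow> (case embed_word v of (u, k) \<Rightarrow> retract True u k) = cls v"
proof (induction v)
  case Nil
  then show ?case by (simp add: embed_word_def one_SD coxeter_simps inr_one one_A)
next
  case (Cons x v)
  obtain w h where wh: "embed_word v = (w, h)" by fastforce
  have "w \<in> carrier W" "h \<in> carrier G" using wh embed_word_closed[of v] Cons.prems by (auto simp: words_simps carrier_SD)
  moreover have "embed_word (x # v) = embed_letter x \<otimes>\<^bsub>SD\<^esub> (w, h)" using wh by (simp add: embed_word_def)
  ultimately show ?case
    using retract_embed_letter[of x w h] Cons wh cls_Cons[of x v] by (simp add: words_simps)
qed

lemma embed_inj: "inj_on embed (carrier A)"
proof (rule inj_onI)
  fix V V' assume "V \<in> carrier A" "V' \<in> carrier A" "embed V = embed V'"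
  then show "V = V'" using retract_embed_word by (auto simp: carrier_A embed_cls) metis+
qed

theorem amalgam_property_A:
  assumes "exact_group G" "finitely_generated G"
  shows "group_property_A A"
proof -
  have "exact_group SD" using exact_SD[OF exact_coxeter assms(1)] .
  then have "exact_group A"
    using exact_group_inj_hom[OF A.is_group SD.is_group _ embed_hom embed_inj] by blast
  then show ?thesis using finitely_generated_A assms(2) by (intro A.exact_imp_group_property_A) auto
qed

end

section \<open>Matrices over a field with an absolute value\<close>

text \<open>
  An enumeration of the index type. It supplies the order that the notion of a triangular matrix
  needs.
\<close>

definition pos :: "'r::finite \<Rightarrow> nat" where
  "pos = to_nat_on UNIV"

lemma pos_eq_iff [simp]: "pos i = pos j \<longleftrightarrow> i = j"
  by (simp add: pos_def uncountable_def)

definition pos_bound :: "'r::finite itself \<Rightarrow> nat" where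
  "pos_bound _ = Suc (Max (range (pos :: 'r \<Rightarrow> nat)))"

lemma pos_less_bound: "pos (i :: 'r::finite) < pos_bound TYPE('r)"
  by (simp add: pos_bound_def less_Suc_eq_le)

lemma mult_matrix_nth: "(A ** B) $ i $ j = (\<Sum>k\<in>UNIV. A $ i $ k * B $ k $ j)"
  by (simp add: matrix_matrix_mult_def)

lemma mat_nth: "mat a $ i $ j = (if i = j then a else 0)"
  by (simp add: mat_def)

lemma sum_single:
  fixes f :: "'r::finite \<Rightarrow> 'k::comm_monoid_add"
  assumes "\<And>l. l \<noteq> i \<Longrightarrow> f l = 0"
  shows "(\<Sum>l\<in>UNIV. f l) = f i"
  using sum.mono_neutral_right[of UNIV "{i}" f] assms by simp

definition inverse_pair :: "'k::semiring_1 ^ 'r::finite ^ 'r \<Rightarrow> 'k ^ 'r ^ 'r \<Rightarrow> bool" where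
  "inverse_pair A B \<longleftrightarrow> A ** B = mat 1 \<and> B ** A = mat 1"

lemma inverse_pair_sym: "inverse_pair A B \<Longrightarrow> inverse_pair B A"
  by (simp add: inverse_pair_def)

lemma inverse_pair_mult:
  assumes "inverse_pair A B" "inverse_pair C D"
  shows "inverse_pair (A ** C) (D ** B)"
  using assms unfolding inverse_pair_def
  by (metis matrix_mul_assoc matrix_mul_lid matrix_mul_rid)

lemma inverse_pair_cancel:
  assumes "inverse_pair A B"
  shows "A ** (B ** C) = C" "B ** (A ** C) = C"
  using assms by (simp_all add: inverse_pair_def matrix_mul_assoc matrix_mul_lid)

lemma inverse_pair_one: "inverse_pair (mat 1) (mat 1)"
  by (simp add: inverse_pair_def)

definition diag :: "('r \<Rightarrow> 'k) \<Rightarrow> 'k::comm_ring_1 ^ 'r::finite ^ 'r" where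
  "diag d = (\<chi> i j. if i = j then d i else 0)"

lemma diag_nth: "diag d $ i $ j = (if i = j then d i else 0)"
  by (simp add: diag_def)

lemma diag_mult_left: "(diag d ** A) $ i $ j = d i * A $ i $ j"
  by (subst mult_matrix_nth, subst sum_single[of i]) (auto simp: diag_nth)

lemma diag_mult_right: "(A ** diag d) $ i $ j = A $ i $ j * d j"
  by (subst mult_matrix_nth, subst sum_single[of j]) (auto simp: diag_nth)

lemma diag_mult: "diag d ** diag e = diag (\<lambda>i. d i * e i)"
  by (auto simp: vec_eq_iff diag_mult_left diag_nth)

lemma diag_one: "diag (\<lambda>_. 1) = mat 1"
  by (simp add: vec_eq_iff diag_nth mat_nth)

lemma inverse_pair_diag: "(\<And>i. d i * e i = 1) \<Longrightarrow> inverse_pair (diag d) (diag e)"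
  by (simp add: inverse_pair_def diag_mult diag_one mult.commute)

definition upper :: "'k::zero ^ 'r::finite ^ 'r \<Rightarrow> bool" where
  "upper A \<longleftrightarrow> (\<forall>i j. pos j < pos i \<longrightarrow> A $ i $ j = 0)"

lemma upper_mult:
  fixes A B :: "'k::comm_ring_1 ^ 'r::finite ^ 'r"
  assumes "upper A" "upper B"
  shows "upper (A ** B)" and "(A ** B) $ i $ i = A $ i $ i * B $ i $ i"
proof -
  have z: "A $ i $ l * B $ l $ j = 0" if "pos j < pos i \<or> (j = i \<and> l \<noteq> i)" for i j l
  proof -
    have "pos l < pos i \<or> pos j < pos l"
      using that pos_eq_iff[of l i] by (auto simp del: pos_eq_iff)
    then show ?thesis using assms by (auto simp: upper_def)
  qed
  then show "upper (A ** B)" by (simp add: upper_def mult_matrix_nth)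
  show "(A ** B) $ i $ i = A $ i $ i * B $ i $ i"
    unfolding mult_matrix_nth by (rule sum_single) (use z in auto)
qed

text \<open>
  Induction over the rows from the bottom: when all lower rows of \<open>B\<close> are known to be triangular, only
  one term of the matrix product survives.
\<close>

lemma upper_inverse:
  fixes A B :: "'k::field ^ 'r::finite ^ 'r"
  assumes A: "upper A" and AB: "A ** B = mat 1"
  shows "upper B" and "A $ i $ i * B $ i $ i = 1"
proof -
  have P: "A $ i $ i * B $ i $ i = 1 \<and> (\<forall>j. pos j < pos i \<longrightarrow> B $ i $ j = 0)" for i
  proof (induction "pos_bound TYPE('r) - pos i" arbitrary: i rule: less_induct)
    case less
    have IH: "B $ l $ j = 0" if "pos i < pos l" "pos j < pos l" for l j
      using less[of l] that pos_less_bound[of l] by (simp add: diff_less_mono2)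
    have eq: "A $ i $ i * B $ i $ j = mat 1 $ i $ j" if "pos j \<le> pos i" for j
    proof -
      have "(\<Sum>l\<in>UNIV. A $ i $ l * B $ l $ j) = A $ i $ i * B $ i $ j"
      proof (rule sum_single)
        fix l assume "l \<noteq> i"
        then have "pos l < pos i \<or> pos i < pos l" using pos_eq_iff[of l i] by linarith
        then show "A $ i $ l * B $ l $ j = 0" using A IH[of l j] that by (auto simp: upper_def)
      qed
      then show ?thesis using AB by (simp add: mult_matrix_nth[symmetric])
    qed
    have d: "A $ i $ i * B $ i $ i = 1" using eq[of i] by (simp add: mat_nth)
    moreover have "B $ i $ j = 0" if "pos j < pos i" for j
    proof -
      have "A $ i $ i * B $ i $ j = 0" using eq[of j] that by (auto simp: mat_nth)
      then show ?thesis using d by auto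
    qed
    ultimately show ?case by blast
  qed
  show "upper B" using P by (simp add: upper_def)
  show "A $ i $ i * B $ i $ i = 1" using P by blast
qed

section \<open>Boxes in the lattice of exponents\<close>

definition int_box :: "('r \<Rightarrow> int) \<Rightarrow> nat \<Rightarrow> ('r::finite \<Rightarrow> int) set" where
  "int_box a N = (\<Pi>\<^sub>E i\<in>UNIV. {a i..<a i + int N})"

lemma int_box_iff: "t \<in> int_box a N \<longleftrightarrow> (\<forall>i. a i \<le> t i \<and> t i < a i + int N)"
  by (auto simp: int_box_def PiE_iff)

lemma card_int_box: "card (int_box a N :: ('r::finite \<Rightarrow> int) set) = N ^ CARD('r)"
  by (simp add: int_box_def card_PiE)

lemma finite_int_box: "finite (int_box a N)"
  unfolding int_box_def by (rule finite_PiE) auto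

text \<open>
  A point of the box leaves the shifted box through one of the coordinates, and each coordinate has at
  most \<open>K\<close> critical values.
\<close>

lemma card_int_box_shift:
  fixes a \<kappa> :: "'r::finite \<Rightarrow> int"
  assumes "\<And>i. \<bar>\<kappa> i\<bar> \<le> int K"
  shows "card (int_box a N - int_box (\<lambda>i. a i + \<kappa> i) N) \<le> CARD('r) * K * N ^ (CARD('r) - 1)"
proof -
  let ?I = "\<lambda>i. {a i..<a i + int N}" and ?J = "\<lambda>i. {a i + \<kappa> i..<a i + \<kappa> i + int N}"
  let ?B = "\<lambda>i. \<Pi>\<^sub>E j\<in>UNIV. if j = i then ?I i - ?J i else ?I j"
  have "int_box a N - int_box (\<lambda>i. a i + \<kappa> i) N \<subseteq> (\<Union>i\<in>UNIV. ?B i)"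
    by (force simp: int_box_def PiE_iff)
  moreover have fin: "finite (?B i)" for i by (rule finite_PiE) auto
  ultimately have "card (int_box a N - int_box (\<lambda>i. a i + \<kappa> i) N) \<le> card (\<Union>i\<in>UNIV. ?B i)"
    by (intro card_mono) auto
  also have "\<dots> \<le> (\<Sum>i\<in>UNIV. card (?B i))" by (rule card_UN_le) simp
  also have "\<dots> \<le> (\<Sum>i\<in>(UNIV :: 'r set). K * N ^ (CARD('r) - 1))"
  proof (rule sum_mono)
    fix i :: 'r
    have "?I i - ?J i \<subseteq> {a i..<a i + \<kappa> i} \<union> {a i + \<kappa> i + int N..<a i + int N}" by auto
    then have "card (?I i - ?J i) \<le> card ({a i..<a i + \<kappa> i} \<union> {a i + \<kappa> i + int N..<a i + int N})"
      by (intro card_mono) auto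
    also have "\<dots> \<le> card {a i..<a i + \<kappa> i} + card {a i + \<kappa> i + int N..<a i + int N}" by (rule card_Un_le)
    also have "\<dots> \<le> K" using assms[of i] by simp
    finally have c: "card (?I i - ?J i) \<le> K" .
    have "card (?B i) = (\<Prod>j\<in>UNIV. card (if j = i then ?I i - ?J i else ?I j))" by (simp add: card_PiE)
    also have "\<dots> = card (?I i - ?J i) * (\<Prod>j\<in>UNIV - {i}. card (if j = i then ?I i - ?J i else ?I j))"
      by (subst prod.remove[of _ i]) auto
    also have "(\<Prod>j\<in>UNIV - {i}. card (if j = i then ?I i - ?J i else ?I j)) = (\<Prod>j\<in>UNIV - {i}. N)"
      by (intro prod.cong) auto
    also have "\<dots> = N ^ (CARD('r) - 1)" by (simp add: card_Diff_singleton)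
    finally show "card (?B i) \<le> K * N ^ (CARD('r) - 1)" using c by simp
  qed
  also have "\<dots> = CARD('r) * K * N ^ (CARD('r) - 1)" by simp
  finally show ?thesis .
qed

lemma pmf_close_int_box_shift:
  fixes a \<kappa> :: "'r::finite \<Rightarrow> int"
  assumes "\<And>i. \<bar>\<kappa> i\<bar> \<le> int K" "0 < N"
  shows "pmf_close (2 * real (CARD('r) * K) / real N) (pmf_of_set (int_box a N))
    (map_pmf (\<lambda>t i. t i + \<kappa> i) (pmf_of_set (int_box a N)))"
proof -
  have ne: "int_box a N \<noteq> {}" using card_int_box[of a N] assms(2) by auto
  have "(\<lambda>t i. t i + \<kappa> i) ` int_box a N = int_box (\<lambda>i. a i + \<kappa> i) N"
  proof safe
    fix t assume "t \<in> int_box (\<lambda>i. a i + \<kappa> i) N"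
    then show "t \<in> (\<lambda>t i. t i + \<kappa> i) ` int_box a N"
      by (intro image_eqI[of _ _ "\<lambda>i. t i - \<kappa> i"]) (auto simp: int_box_iff algebra_simps)
  qed (auto simp: int_box_iff)
  moreover have "inj_on (\<lambda>t i. t i + \<kappa> i) (int_box a N)" by (auto simp: inj_on_def fun_eq_iff)
  ultimately have eq: "map_pmf (\<lambda>t i. t i + \<kappa> i) (pmf_of_set (int_box a N)) = pmf_of_set (int_box (\<lambda>i. a i + \<kappa> i) N)"
    using ne finite_int_box by (subst map_pmf_of_set_inj) auto
  have eq2: "2 * real (CARD('r) * K * N ^ (CARD('r) - 1)) / real (N ^ CARD('r)) = 2 * real (CARD('r) * K) / real N"
    using assms(2) by (cases "CARD('r)") (auto simp: field_simps)
  have "0 < N ^ CARD('r)" using assms(2) by simp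
  from pmf_close_uniform[OF finite_int_box finite_int_box card_int_box card_int_box this
      card_int_box_shift[of \<kappa> K a N, OF assms(1)]]
  show ?thesis unfolding eq eq2 .
qed

section \<open>Absolute values and the Iwasawa decomposition\<close>

text \<open>
  The element \<open>\<pi>\<close> is the variable of a field of Laurent series or the real number \<open>1/2\<close>. Its
  powers serve as diagonal entries: every nonzero element is a power of \<open>\<pi>\<close> times an element whose
  absolute value lies between \<open>1\<close> and \<open>1 / nrm \<pi>\<close>.
\<close>

locale absolute_value =
  fixes nrm :: "'k::field \<Rightarrow> real" and \<pi> :: 'k
  assumes nrm_0: "nrm 0 = 0"
    and nrm_pos: "x \<noteq> 0 \<Longrightarrow> 0 < nrm x"
    and nrm_mult: "nrm (x * y) = nrm x * nrm y"
    and nrm_add: "nrm (x + y) \<le> nrm x + nrm y"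
    and nrm_\<pi>: "0 < nrm \<pi>" "nrm \<pi> < 1"
begin

lemma nrm_nonneg: "0 \<le> nrm x"
  using nrm_pos[of x] nrm_0 by (cases "x = 0") auto

lemma nrm_1: "nrm 1 = 1"
  using nrm_mult[of 1 1] nrm_pos[of 1] by simp

lemma nrm_minus: "nrm (- x) = nrm x"
proof -
  have "nrm (- 1) * nrm (- 1) = 1" using nrm_mult[of "- 1" "- 1"] nrm_1 by simp
  then have "nrm (- 1) = 1" using nrm_nonneg[of "- 1"] by (metis abs_of_nonneg abs_mult_self_eq mult_cancel_left1 real_sqrt_abs2 real_sqrt_one)
  then show ?thesis using nrm_mult[of "- 1" x] by simp
qed

lemma nrm_divide: "nrm (x / y) = nrm x / nrm y"
proof (cases "y = 0")
  case False
  then have "nrm (x / y) * nrm y = nrm x" by (simp flip: nrm_mult)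
  then show ?thesis using nrm_pos[OF False] by (simp add: field_simps)
qed (simp add: nrm_0)

lemma nrm_power: "nrm (x ^ n) = nrm x ^ n"
  by (induction n) (auto simp: nrm_1 nrm_mult)

lemma nrm_powi: "nrm (x powi k) = nrm x powi k"
  by (auto simp: power_int_def nrm_power nrm_divide nrm_1 inverse_eq_divide)

lemma nrm_sum: "nrm (sum f A) \<le> (\<Sum>x\<in>A. nrm (f x))"
  by (induction A rule: infinite_finite_induct) (auto simp: nrm_0 intro: order_trans[OF nrm_add])

lemma \<pi>_nonzero: "\<pi> \<noteq> 0"
  using nrm_\<pi>(1) nrm_0 by auto

lemma nrm_\<pi>_mono: "j \<le> k \<Longrightarrow> nrm \<pi> powi k \<le> nrm \<pi> powi j"
  using nrm_\<pi> by (intro power_int_decreasing) auto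

lemma nrm_\<pi>_tendsto: "0 < e \<Longrightarrow> \<exists>n :: nat. nrm \<pi> ^ n < e"
  using nrm_\<pi> real_arch_pow_inv by blast

definition mbound :: "real \<Rightarrow> 'k ^ 'r::finite ^ 'r \<Rightarrow> bool" where
  "mbound C A \<longleftrightarrow> (\<forall>i j. nrm (A $ i $ j) \<le> C)"

lemma mbound_mono: "mbound C A \<Longrightarrow> C \<le> D \<Longrightarrow> mbound D A"
  unfolding mbound_def by (meson order_trans)

lemma mbound_nonneg: "mbound C A \<Longrightarrow> 0 \<le> C"
  unfolding mbound_def by (meson nrm_nonneg order_trans)

lemma mbound_mult:
  fixes A B :: "'k ^ 'r::finite ^ 'r"
  assumes "mbound C A" "mbound D B"
  shows "mbound (real CARD('r) * C * D) (A ** B)"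
  unfolding mbound_def
proof (intro allI)
  fix i j
  have "nrm ((A ** B) $ i $ j) \<le> (\<Sum>k\<in>UNIV. nrm (A $ i $ k * B $ k $ j))"
    unfolding mult_matrix_nth by (rule nrm_sum)
  also have "\<dots> \<le> (\<Sum>k\<in>(UNIV :: 'r set). C * D)"
    using assms mbound_nonneg[OF assms(1)]
    by (intro sum_mono) (auto simp: nrm_mult mbound_def intro!: mult_mono nrm_nonneg)
  finally show "nrm ((A ** B) $ i $ j) \<le> real CARD('r) * C * D" by simp
qed

lemma mbound_one: "mbound 1 (mat 1)"
  by (auto simp: mbound_def mat_nth nrm_0 nrm_1)

lemma mbound_finite:
  assumes "finite M"
  shows "\<exists>C\<ge>0. \<forall>A\<in>M. mbound C A"
proof (intro exI conjI ballI)
  let ?C = "\<Sum>A\<in>M. \<Sum>i\<in>UNIV. \<Sum>j\<in>UNIV. nrm (A $ i $ j)"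
  show "0 \<le> ?C" by (intro sum_nonneg nrm_nonneg)
  fix A assume A: "A \<in> M"
  show "mbound ?C A"
    unfolding mbound_def
  proof (intro allI)
    fix i j
    have "nrm (A $ i $ j) \<le> (\<Sum>j\<in>UNIV. nrm (A $ i $ j))"
      by (rule member_le_sum) (auto intro: nrm_nonneg)
    also have "\<dots> \<le> (\<Sum>i\<in>UNIV. \<Sum>j\<in>UNIV. nrm (A $ i $ j))"
      by (rule member_le_sum) (auto intro: nrm_nonneg sum_nonneg)
    also have "\<dots> \<le> ?C"
      by (rule member_le_sum[OF A _ assms]) (auto intro: nrm_nonneg sum_nonneg)
    finally show "nrm (A $ i $ j) \<le> ?C" .
  qed
qed


text \<open>
  Right multiplication by this matrix adds \<open>c l\<close> times column \<open>i\<close> to column \<open>l\<close>, for all \<open>l\<close> at once.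
\<close>

definition column_op :: "'r \<Rightarrow> ('r \<Rightarrow> 'k) \<Rightarrow> 'k ^ 'r::finite ^ 'r" where
  "column_op i c = (\<chi> k l. (if k = l then 1 else 0) + (if k = i then c l else 0))"

lemma mult_column_op: "(A ** column_op i c) $ k $ l = A $ k $ l + A $ k $ i * c l"
proof -
  have "(A ** column_op i c) $ k $ l =
      (\<Sum>m\<in>UNIV. (if m = l then A $ k $ m else 0) + (if m = i then A $ k $ m * c l else 0))"
    unfolding mult_matrix_nth by (intro sum.cong) (auto simp: column_op_def distrib_left)
  then show ?thesis by (simp add: sum.distrib)
qed

lemma inverse_pair_column_op:
  assumes "c i = 0"
  shows "inverse_pair (column_op i c) (column_op i (\<lambda>l. - c l))"
  using assms unfolding inverse_pair_def
  by (auto simp: vec_eq_iff mult_column_op mat_nth) (auto simp: column_op_def)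

definition swap_matrix :: "'r \<Rightarrow> 'r \<Rightarrow> 'k ^ 'r::finite ^ 'r" where
  "swap_matrix i j = (\<chi> k l. if k = Transposition.transpose i j l then 1 else 0)"

lemma mult_swap_matrix: "(A ** swap_matrix i j) $ k $ l = A $ k $ Transposition.transpose i j l"
  by (subst mult_matrix_nth, subst sum_single[of "Transposition.transpose i j l"]) (auto simp: swap_matrix_def)

lemma inverse_pair_swap_matrix: "inverse_pair (swap_matrix i j) (swap_matrix i j)"
  unfolding inverse_pair_def by (auto simp: vec_eq_iff mult_swap_matrix mat_nth) (auto simp: swap_matrix_def)

lemma mbound_swap: "mbound 1 (swap_matrix i j)"
  by (auto simp: mbound_def swap_matrix_def nrm_0 nrm_1)

text \<open>
  In row \<open>i\<close> take an entry of maximal absolute value among the columns up to \<open>i\<close> as pivot, swap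
  it to the diagonal and clear the entries to its left. By the choice of the pivot all coefficients of
  these column operations have absolute value at most \<open>1\<close>. Lower rows vanish in all columns involved.
\<close>

lemma triangularize_step:
  fixes A :: "'k ^ 'r::finite ^ 'r" and i :: 'r
  assumes zero: "\<And>k l. pos i < pos k \<Longrightarrow> pos l < pos k \<Longrightarrow> A $ k $ l = 0"
  obtains h h' where "inverse_pair h h'" "mbound (real CARD('r)) h" "mbound (real CARD('r)) h'"
    "\<And>k l. pos i \<le> pos k \<Longrightarrow> pos l < pos k \<Longrightarrow> (A ** h) $ k $ l = 0"
proof -
  let ?J = "{j. pos j \<le> pos i}"
  have J: "finite ?J" "i \<in> ?J" by auto
  then have "Max ((\<lambda>j. nrm (A $ i $ j)) ` ?J) \<in> (\<lambda>j. nrm (A $ i $ j)) ` ?J" by (intro Max_in) auto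
  then obtain m where m: "m \<in> ?J" "Max ((\<lambda>j. nrm (A $ i $ j)) ` ?J) = nrm (A $ i $ m)" by blast
  have max: "nrm (A $ i $ j) \<le> nrm (A $ i $ m)" if "j \<in> ?J" for j
    unfolding m(2)[symmetric] using that J by (intro Max_ge) auto
  let ?t = "Transposition.transpose i m"
  have t: "pos (?t l) < pos k" if "pos l < pos k" "pos i < pos k" for k l
    using that m(1) by (auto simp: Transposition.transpose_def)
  have tJ: "?t l \<in> ?J" if "l \<in> ?J" for l using that m(1) by (auto simp: Transposition.transpose_def)
  define c where "c l = (if pos l < pos i then - A $ i $ ?t l / A $ i $ m else 0)" for l
  define e :: "'k ^ 'r ^ 'r" where "e = column_op i c"
  define e' :: "'k ^ 'r ^ 'r" where "e' = column_op i (\<lambda>l. - c l)"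
  have c: "nrm (c l) \<le> 1" for l
  proof (cases "A $ i $ m = 0 \<or> \<not> pos l < pos i")
    case False
    then have "nrm (A $ i $ ?t l) \<le> nrm (A $ i $ m)" by (intro max tJ) auto
    then show ?thesis using False nrm_pos[of "A $ i $ m"] by (simp add: c_def nrm_divide nrm_minus)
  qed (auto simp: c_def nrm_0)
  have "mbound 1 e" "mbound 1 e'"
    using c by (auto simp: mbound_def e_def e'_def column_op_def nrm_0 nrm_1 nrm_minus c_def)
  then have "mbound (real CARD('r)) (swap_matrix i m ** e)" "mbound (real CARD('r)) (e' ** swap_matrix i m)"
    using mbound_mult[OF mbound_swap, of 1 e] mbound_mult[OF _ mbound_swap, of 1 e'] by auto
  moreover have "inverse_pair (swap_matrix i m ** e) (e' ** swap_matrix i m)"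
    unfolding e_def e'_def
    by (intro inverse_pair_mult inverse_pair_swap_matrix inverse_pair_column_op) (simp add: c_def)
  moreover have "(A ** (swap_matrix i m ** e)) $ k $ l = 0" if kl: "pos i \<le> pos k" "pos l < pos k" for k l
  proof -
    have eq: "(A ** (swap_matrix i m ** e)) $ k $ l = A $ k $ ?t l + A $ k $ m * c l"
      unfolding matrix_mul_assoc e_def mult_column_op mult_swap_matrix by simp
    show ?thesis
    proof (cases "k = i")
      case True
      show ?thesis
      proof (cases "A $ i $ m = 0")
        case zm: True
        have "nrm (A $ i $ ?t l) \<le> 0" using max[OF tJ[of l]] kl True zm nrm_0 by simp
        then have "A $ i $ ?t l = 0" using nrm_pos[of "A $ i $ ?t l"] by fastforce
        then show ?thesis using eq True zm by simp
      next
        case False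
        then show ?thesis using eq True kl by (simp add: c_def)
      qed
    next
      case False
      then have "pos i < pos k" using kl by (auto simp: less_le)
      then have "A $ k $ ?t l = 0" "A $ k $ m = 0" using zero t[of l k] kl m(1) by auto
      then show ?thesis using eq by simp
    qed
  qed
  ultimately show ?thesis using that by blast
qed

lemma triangularize_rows:
  "\<exists>C\<ge>0. \<forall>A :: 'k ^ 'r::finite ^ 'r. \<exists>h h'. inverse_pair h h' \<and> mbound C h \<and> mbound C h' \<and>
     (\<forall>k l. pos_bound TYPE('r) \<le> pos k + n \<longrightarrow> pos l < pos k \<longrightarrow> (A ** h) $ k $ l = 0)"
proof (induction n)
  case 0
  have "\<not> pos_bound TYPE('r) \<le> pos k" for k :: 'r using pos_less_bound[of k] by simp
  then show ?case
    by (intro exI[of _ 1] conjI allI exI[of _ "mat 1"]) (auto simp: inverse_pair_one mbound_one)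
next
  case (Suc n)
  then obtain C where C: "0 \<le> C" "\<forall>A :: 'k ^ 'r ^ 'r. \<exists>h h'. inverse_pair h h' \<and> mbound C h \<and> mbound C h' \<and>
     (\<forall>k l. pos_bound TYPE('r) \<le> pos k + n \<longrightarrow> pos l < pos k \<longrightarrow> (A ** h) $ k $ l = 0)" by blast
  let ?R = "real CARD('r)"
  have R: "1 \<le> ?R" by (simp add: Suc_leI)
  have CR: "C \<le> ?R * C * ?R"
    using mult_mono[of 1 "?R * ?R" C C] R C(1) mult_mono[of 1 ?R 1 ?R] by (simp add: ac_simps)
  show ?case
  proof (rule exI[of _ "?R * C * ?R"], intro conjI allI)
    show "0 \<le> ?R * C * ?R" using C(1) by simp
    fix A :: "'k ^ 'r ^ 'r"
    obtain h h' where h: "inverse_pair h h'" "mbound C h" "mbound C h'"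
      "\<And>k l. pos_bound TYPE('r) \<le> pos k + n \<Longrightarrow> pos l < pos k \<Longrightarrow> (A ** h) $ k $ l = 0"
      using C(2) by blast
    show "\<exists>h h'. inverse_pair h h' \<and> mbound (?R * C * ?R) h \<and> mbound (?R * C * ?R) h' \<and>
     (\<forall>k l. pos_bound TYPE('r) \<le> pos k + Suc n \<longrightarrow> pos l < pos k \<longrightarrow> (A ** h) $ k $ l = 0)"
    proof (cases "\<exists>i :: 'r. pos_bound TYPE('r) = pos i + Suc n")
      case True
      then obtain i :: 'r where i: "pos_bound TYPE('r) = pos i + Suc n" by blast
      have "(A ** h) $ k $ l = 0" if "pos i < pos k" "pos l < pos k" for k l
        using that i by (intro h(4)) auto
      then obtain e e' where e: "inverse_pair e e'" "mbound ?R e" "mbound ?R e'"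
          "\<And>k l. pos i \<le> pos k \<Longrightarrow> pos l < pos k \<Longrightarrow> (A ** h ** e) $ k $ l = 0"
        using triangularize_step[of i "A ** h"] by metis
      have "mbound (?R * C * ?R) (h ** e)" "mbound (?R * ?R * C) (e' ** h')"
        using mbound_mult h e by blast+
      then show ?thesis
        using inverse_pair_mult[OF h(1) e(1)] e(4) i
        by (intro exI[of _ "h ** e"] exI[of _ "e' ** h'"]) (auto simp: matrix_mul_assoc ac_simps)
    next
      case False
      have "pos_bound TYPE('r) \<le> pos k + n" if "pos_bound TYPE('r) \<le> pos k + Suc n" for k :: 'r
        using False that by (metis le_SucE add_Suc_right)
      then show ?thesis using h mbound_mono[OF h(2) CR] mbound_mono[OF h(3) CR] by blast
    qed
  qed
qed

lemma triangularize:
  "\<exists>C\<ge>0. \<forall>A :: 'k ^ 'r::finite ^ 'r. \<exists>h h'. inverse_pair h h' \<and> mbound C h \<and> mbound C h' \<and> upper (A ** h)"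
  using triangularize_rows[where 'r = 'r and n = "pos_bound TYPE('r)"] by (simp add: upper_def)

lemma ln_nrm_\<pi>: "ln (nrm \<pi> powi k) = real_of_int k * ln (nrm \<pi>)"
  using nrm_\<pi> by (simp flip: powr_real_of_int' add: ln_powr)

lemma \<pi>_scale:
  assumes "x \<noteq> 0"
  obtains k u where "x = \<pi> powi k * u" "1 \<le> nrm u" "nrm u \<le> 1 / nrm \<pi>"
proof -
  define k where "k = \<lceil>ln (nrm x) / ln (nrm \<pi>)\<rceil>"
  have x: "0 < nrm x" using nrm_pos[OF assms] .
  have l: "ln (nrm \<pi>) < 0" using nrm_\<pi> by simp
  have "ln (nrm x) / ln (nrm \<pi>) \<le> real_of_int k" unfolding k_def by linarith
  then have "real_of_int k * ln (nrm \<pi>) \<le> ln (nrm x)" using l by (simp add: field_simps)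
  then have a: "nrm \<pi> powi k \<le> nrm x"
    using x nrm_\<pi> ln_le_cancel_iff[of "nrm \<pi> powi k" "nrm x"] ln_nrm_\<pi>[of k] by simp
  have "real_of_int (k - 1) < ln (nrm x) / ln (nrm \<pi>)" unfolding k_def by linarith
  then have "ln (nrm x) < real_of_int (k - 1) * ln (nrm \<pi>)" using l by (simp only: neg_less_divide_eq)
  then have b: "nrm x < nrm \<pi> powi (k - 1)"
    using x nrm_\<pi> ln_less_cancel_iff[of "nrm x" "nrm \<pi> powi (k - 1)"] ln_nrm_\<pi>[of "k - 1"] by simp
  let ?u = "x / \<pi> powi k"
  have "nrm ?u = nrm x / nrm \<pi> powi k" by (simp add: nrm_divide nrm_powi)
  moreover have p: "0 < nrm \<pi> powi k" using nrm_\<pi> by simp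
  then have "1 \<le> nrm x / nrm \<pi> powi k" using a by (simp add: le_divide_eq)
  moreover have "nrm x / nrm \<pi> powi k \<le> 1 / nrm \<pi>"
  proof -
    have "nrm \<pi> powi (k - 1) = nrm \<pi> powi k / nrm \<pi>" using nrm_\<pi> by (simp add: power_int_diff)
    then have "nrm x / nrm \<pi> powi k \<le> nrm \<pi> powi k / nrm \<pi> / nrm \<pi> powi k"
      using b p by (intro divide_right_mono) auto
    then show ?thesis using p nrm_\<pi> by simp
  qed
  ultimately show ?thesis using \<pi>_nonzero by (intro that[of k ?u]) auto
qed


text \<open>
  A uniform Iwasawa decomposition \<open>A = (A h) h\<^sup>-\<^sup>1\<close> with a triangular matrix \<open>A h\<close> and bounded
  \<open>h\<close>. After the triangularization the diagonal entries are changed into powers of \<open>\<pi>\<close> at the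
  expense of a bounded factor.
\<close>

lemma iwasawa:
  "\<exists>C\<ge>0. \<forall>A B :: 'k ^ 'r::finite ^ 'r. inverse_pair A B \<longrightarrow> (\<exists>h h' k. inverse_pair h h' \<and> mbound C h \<and>
     mbound C h' \<and> upper (A ** h) \<and> (\<forall>i. (A ** h) $ i $ i = \<pi> powi k i))"
proof -
  obtain C where C: "0 \<le> C" "\<forall>A :: 'k ^ 'r ^ 'r. \<exists>h h'. inverse_pair h h' \<and> mbound C h \<and> mbound C h' \<and> upper (A ** h)"
    using triangularize by blast
  let ?R = "real CARD('r)"
  let ?D = "?R * C * (1 / nrm \<pi>)"
  have "0 \<le> ?D" using C(1) nrm_\<pi> by simp
  moreover have "\<exists>h h' k. inverse_pair h h' \<and> mbound ?D h \<and> mbound ?D h' \<and> upper (A ** h) \<and> (\<forall>i. (A ** h) $ i $ i = \<pi> powi k i)"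
    if AB: "inverse_pair A B" for A B :: "'k ^ 'r ^ 'r"
  proof -
    obtain h h' where h: "inverse_pair h h'" "mbound C h" "mbound C h'" "upper (A ** h)" using C(2) by blast
    have "inverse_pair (A ** h) (h' ** B)" using AB h(1) by (rule inverse_pair_mult)
    then have "(A ** h) $ i $ i * (h' ** B) $ i $ i = 1" for i
      using upper_inverse(2)[OF h(4)] unfolding inverse_pair_def by blast
    then have nz: "(A ** h) $ i $ i \<noteq> 0" for i by (metis mult_zero_left zero_neq_one)
    have "\<exists>k u. (A ** h) $ i $ i = \<pi> powi k * u \<and> 1 \<le> nrm u \<and> nrm u \<le> 1 / nrm \<pi>" for i
      by (rule \<pi>_scale[OF nz[of i]]) blast
    then obtain k u where ku: "\<And>i. (A ** h) $ i $ i = \<pi> powi k i * u i" "\<And>i. 1 \<le> nrm (u i)" "\<And>i. nrm (u i) \<le> 1 / nrm \<pi>"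
      by metis
    have u: "u i \<noteq> 0" for i using ku(2)[of i] nrm_0 by auto
    define d where "d = diag (\<lambda>i. 1 / u i)"
    define d' where "d' = diag u"
    have p1: "1 \<le> 1 / nrm \<pi>" using nrm_\<pi> by simp
    have "nrm (1 / u i) \<le> 1 / nrm \<pi>" for i
    proof -
      have "nrm (1 / u i) \<le> 1" using ku(2)[of i] by (simp add: nrm_divide nrm_1)
      then show ?thesis using p1 by linarith
    qed
    then have "mbound (1 / nrm \<pi>) d" "mbound (1 / nrm \<pi>) d'"
      using ku(3) nrm_\<pi> by (auto simp: mbound_def d_def d'_def diag_nth nrm_0)
    then have "mbound ?D (h ** d)" "mbound ?D (d' ** h')"
      using mbound_mult[OF h(2), of "1 / nrm \<pi>" d] mbound_mult[OF _ h(3), of "1 / nrm \<pi>" d'] by (auto simp: ac_simps)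
    moreover have "inverse_pair (h ** d) (d' ** h')"
      unfolding d_def d'_def using u by (intro inverse_pair_mult h inverse_pair_diag) simp
    moreover have "upper (A ** (h ** d))"
      using h(4) by (simp add: matrix_mul_assoc upper_def d_def diag_mult_right)
    moreover have "(A ** (h ** d)) $ i $ i = \<pi> powi k i" for i
      using u by (simp add: matrix_mul_assoc d_def diag_mult_right ku(1))
    ultimately show ?thesis by blast
  qed
  ultimately show ?thesis by blast
qed

section \<open>Almost invariant measures for linear groups\<close>

definition torus :: "('r \<Rightarrow> int) \<Rightarrow> 'k ^ 'r::finite ^ 'r" where
  "torus t = diag (\<lambda>i. \<pi> powi t i)"

lemma inverse_pair_torus: "inverse_pair (torus t) (torus (\<lambda>i. - t i))"
  unfolding torus_def by (rule inverse_pair_diag) (simp add: power_int_minus \<pi>_nonzero)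

text \<open>
  A random choice of a point near a matrix \<open>w\<close>, in a set that does not depend on \<open>w\<close>. It has to be
  uniformly continuous for the left invariant uniformity of \<open>GL\<^sub>r(K)\<close>, and matrices that can lead to
  the same point differ by a bounded factor.
\<close>

definition gl_sampling :: "('k ^ 'r::finite ^ 'r \<Rightarrow> 'y pmf) \<Rightarrow> bool" where
  "gl_sampling \<phi> \<longleftrightarrow>
     (\<forall>\<epsilon>>0. \<exists>\<eta>>0. \<forall>w w' m m'. inverse_pair w w' \<longrightarrow> inverse_pair m m' \<longrightarrow>
        mbound \<eta> (m - mat 1) \<longrightarrow> mbound \<eta> (m' - mat 1) \<longrightarrow> pmf_close \<epsilon> (\<phi> w) (\<phi> (w ** m))) \<and>
     (\<exists>D\<ge>0. \<forall>w w' v v'. inverse_pair w w' \<longrightarrow> inverse_pair v v' \<longrightarrow>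
        set_pmf (\<phi> w) \<inter> set_pmf (\<phi> v) \<noteq> {} \<longrightarrow> mbound D (w' ** v))"

text \<open>
  The entry \<open>(i, j)\<close> of the conjugate is multiplied by \<open>\<pi>\<close> to the power \<open>t j - s i\<close>, which is at
  least \<open>M\<close> above the diagonal; on the diagonal this factor turns the entry into \<open>1\<close>.
\<close>

lemma torus_contraction:
  fixes M :: nat
  assumes m: "upper m" "mbound C m" "\<And>i. m $ i $ i = \<pi> powi (s i - t i)"
    and st: "\<And>i j. pos i < pos j \<Longrightarrow> int M \<le> t j - s i" and \<eta>: "0 \<le> \<eta>" "nrm \<pi> ^ M * C \<le> \<eta>"
  shows "mbound \<eta> (torus (\<lambda>i. - s i) ** m ** torus t - mat 1)"
  unfolding mbound_def
proof (intro allI)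
  fix i j
  have e: "(torus (\<lambda>i. - s i) ** m ** torus t) $ i $ j = \<pi> powi (t j - s i) * m $ i $ j"
  proof -
    have "\<pi> powi (t j - s i) = \<pi> powi (- s i + t j)" by simp
    also have "\<dots> = \<pi> powi (- s i) * \<pi> powi t j" using \<pi>_nonzero by (intro power_int_add) auto
    finally show ?thesis by (simp add: torus_def diag_mult_left diag_mult_right)
  qed
  consider "i = j" | "pos j < pos i" | "pos i < pos j" using pos_eq_iff[of i j] by (metis linorder_neqE_nat)
  then show "nrm ((torus (\<lambda>i. - s i) ** m ** torus t - mat 1) $ i $ j) \<le> \<eta>"
  proof cases
    case 1
    then have "(torus (\<lambda>i. - s i) ** m ** torus t) $ i $ j = 1"
      unfolding e using m(3) \<pi>_nonzero power_int_add[of \<pi> "t j - s j" "s j - t j"] by simp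
    then show ?thesis using 1 \<eta>(1) by (simp add: mat_nth nrm_0)
  next
    case 2
    then have "i \<noteq> j" by auto
    then show ?thesis using 2 m(1) \<eta>(1) by (simp add: e mat_nth upper_def nrm_0)
  next
    case 3
    have "nrm \<pi> powi (t j - s i) * nrm (m $ i $ j) \<le> nrm \<pi> powi int M * C"
      using m(2) nrm_\<pi>_mono[OF st[OF 3]] nrm_\<pi> by (intro mult_mono) (auto simp: mbound_def nrm_nonneg)
    then have "nrm (\<pi> powi (t j - s i) * m $ i $ j) \<le> \<eta>" using \<eta>(2) by (simp add: nrm_mult nrm_powi)
    moreover have "i \<noteq> j" using 3 by auto
    ultimately show ?thesis by (simp add: e mat_nth)
  qed
qed

text \<open>
  Write \<open>\<rho> x = b x h\<^sup>-\<^sup>1\<close> by the Iwasawa decomposition and sample near \<open>b x t\<close>, with \<open>t\<close> uniformly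
  distributed over diagonal matrices whose exponents grow by at least \<open>M\<close> from one index to the next.
  If \<open>x\<close> is replaced by \<open>x s\<close>, then \<open>b x\<close> is replaced by \<open>b x m\<close> for a triangular matrix \<open>m\<close> that
  is bounded in terms of \<open>s\<close>. Its diagonal part shifts the exponents of \<open>t\<close> by at most \<open>K\<close>, which
  the average over a box of side \<open>N\<close> does not notice, and what remains is contracted by \<open>t\<close>. The
  constants are chosen in the order \<open>C\<close>, \<open>K\<close>, \<open>\<eta>\<close>, \<open>N\<close>, \<open>M\<close>.
\<close>

theorem gl_sampling_almost_invariant:
  fixes \<rho> :: "'a \<Rightarrow> 'k ^ 'r::finite ^ 'r" and \<phi> :: "'k ^ 'r ^ 'r \<Rightarrow> 'y pmf" and G :: "('a, 'b) monoid_scheme" (structure)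
  assumes "group G"
    and \<rho>_mult: "\<And>x y. x \<in> carrier G \<Longrightarrow> y \<in> carrier G \<Longrightarrow> \<rho> (x \<otimes>\<^bsub>G\<^esub> y) = \<rho> x ** \<rho> y"
    and \<rho>_one: "\<rho> \<one>\<^bsub>G\<^esub> = mat 1"
    and \<phi>: "gl_sampling \<phi>"
    and F: "finite F" "F \<subseteq> carrier G" and "\<epsilon> > 0"
  shows "\<exists>(\<tau> :: 'a \<Rightarrow> 'y pmf) C. almost_invariant G \<epsilon> F \<tau> \<and> localized G {x \<in> carrier G. mbound C (\<rho> x)} \<tau>"
proof -
  interpret group G by fact
  let ?R = "real CARD('r)"
  have \<rho>_inv: "inverse_pair (\<rho> x) (\<rho> (inv x))" if "x \<in> carrier G" for x
    using that \<rho>_mult[of x "inv x"] \<rho>_mult[of "inv x" x] \<rho>_one by (simp add: inverse_pair_def)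
  obtain C where C: "0 \<le> C" "\<forall>A B :: 'k ^ 'r ^ 'r. inverse_pair A B \<longrightarrow> (\<exists>h h' k. inverse_pair h h' \<and> mbound C h \<and>
     mbound C h' \<and> upper (A ** h) \<and> (\<forall>i. (A ** h) $ i $ i = \<pi> powi k i))"
    using iwasawa by blast
  have "\<exists>h h' k. inverse_pair h h' \<and> mbound C h \<and>
     mbound C h' \<and> upper (\<rho> x ** h) \<and> (\<forall>i. (\<rho> x ** h) $ i $ i = \<pi> powi k i)" if "x \<in> carrier G" for x
    using C(2) \<rho>_inv[OF that] by blast
  then obtain h h' k where h: "\<And>x. x \<in> carrier G \<Longrightarrow> inverse_pair (h x) (h' x)"
    "\<And>x. x \<in> carrier G \<Longrightarrow> mbound C (h x)" "\<And>x. x \<in> carrier G \<Longrightarrow> mbound C (h' x)"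
    "\<And>x. x \<in> carrier G \<Longrightarrow> upper (\<rho> x ** h x)"
    "\<And>x i. x \<in> carrier G \<Longrightarrow> (\<rho> x ** h x) $ i $ i = \<pi> powi k x i"
    by metis
  define b where "b x = \<rho> x ** h x" for x
  define b' where "b' x = h' x ** \<rho> (inv x)" for x
  have bb': "inverse_pair (b x) (b' x)" if "x \<in> carrier G" for x
    unfolding b_def b'_def using that by (intro inverse_pair_mult \<rho>_inv h)
  have b: "upper (b x)" "b x $ i $ i = \<pi> powi k x i" if "x \<in> carrier G" for x i
    using h(4,5)[OF that] by (auto simp: b_def)
  have b': "upper (b' x)" "b' x $ i $ i = \<pi> powi (- k x i)" if "x \<in> carrier G" for x i
  proof -
    have bb: "b x ** b' x = mat 1" using bb'[OF that] by (simp add: inverse_pair_def)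
    show "upper (b' x)" by (rule upper_inverse(1)[OF b(1)[OF that] bb])
    have "\<pi> powi k x i * b' x $ i $ i = 1" using upper_inverse(2)[OF b(1)[OF that] bb, of i] b(2)[OF that] by simp
    then show "b' x $ i $ i = \<pi> powi (- k x i)"
      using \<pi>_nonzero by (simp add: power_int_minus inverse_eq_divide eq_divide_eq mult.commute)
  qed
  have step: "b' x ** b y = h' x ** \<rho> (inv x \<otimes> y) ** h y" if "x \<in> carrier G" "y \<in> carrier G" for x y
    using that by (simp add: b_def b'_def \<rho>_mult matrix_mul_assoc)
  obtain S where S: "0 \<le> S" "\<And>s. s \<in> F \<union> m_inv G ` F \<Longrightarrow> mbound S (\<rho> s)"
    using mbound_finite[of "\<rho> ` (F \<union> m_inv G ` F)"] F(1) by auto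
  define C1 where "C1 = ?R * (?R * C * S) * C"
  have C1: "0 \<le> C1" using C(1) S(1) by (simp add: C1_def)
  have m: "mbound C1 (b' x ** b (x \<otimes> s))" "mbound C1 (b' (x \<otimes> s) ** b x)" if "x \<in> carrier G" "s \<in> F" for x s
  proof -
    have s: "s \<in> carrier G" using that F by auto
    have "inv x \<otimes> (x \<otimes> s) = s" "inv (x \<otimes> s) \<otimes> x = inv s"
      using that s by (simp_all add: m_assoc[symmetric] inv_mult_group) (simp add: m_assoc)
    then have "b' x ** b (x \<otimes> s) = h' x ** \<rho> s ** h (x \<otimes> s)"
        "b' (x \<otimes> s) ** b x = h' (x \<otimes> s) ** \<rho> (inv s) ** h x"
      using step[of x "x \<otimes> s"] step[of "x \<otimes> s" x] that s by auto
    moreover have "mbound S (\<rho> s)" "mbound S (\<rho> (inv s))" using S(2) that by auto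
    ultimately show "mbound C1 (b' x ** b (x \<otimes> s))" "mbound C1 (b' (x \<otimes> s) ** b x)"
      unfolding C1_def using h(2,3) that s by (auto intro!: mbound_mult)
  qed
  \<comment> \<open>The shift of the exponents on the diagonal, which is bounded because both \<open>m\<close> and its inverse are.\<close>
  define \<kappa> where "\<kappa> x s i = k (x \<otimes> s) i - k x i" for x s i
  have diag_m: "(b' x ** b (x \<otimes> s)) $ i $ i = \<pi> powi \<kappa> x s i" "upper (b' x ** b (x \<otimes> s))"
      "(b' (x \<otimes> s) ** b x) $ i $ i = \<pi> powi (- \<kappa> x s i)" "upper (b' (x \<otimes> s) ** b x)"
    if "x \<in> carrier G" "s \<in> F" for x s i
  proof -
    have s: "x \<otimes> s \<in> carrier G" using that F by auto
    show "upper (b' x ** b (x \<otimes> s))" "upper (b' (x \<otimes> s) ** b x)"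
      using b(1) b'(1) that s by (auto intro: upper_mult(1))
    show "(b' x ** b (x \<otimes> s)) $ i $ i = \<pi> powi \<kappa> x s i"
      using upper_mult(2)[OF b'(1)[OF that(1)] b(1)[OF s]] b(2)[OF s] b'(2)[OF that(1)] \<pi>_nonzero
      by (simp add: \<kappa>_def power_int_add[symmetric])
    show "(b' (x \<otimes> s) ** b x) $ i $ i = \<pi> powi (- \<kappa> x s i)"
      using upper_mult(2)[OF b'(1)[OF s] b(1)[OF that(1)]] b'(2)[OF s] b(2)[OF that(1)] \<pi>_nonzero
      by (simp add: \<kappa>_def power_int_add[symmetric])
  qed
  have ninv: "0 < 1 / (C1 + 1)" using C1 by simp
  obtain K :: nat where K: "nrm \<pi> ^ K < 1 / (C1 + 1)" using nrm_\<pi>_tendsto[OF ninv] by blast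
  have K: "C1 < nrm \<pi> powi (- int K)"
  proof -
    have "(C1 + 1) * nrm \<pi> ^ K < 1" using K C1 by (simp add: field_simps)
    then have "C1 + 1 < 1 / nrm \<pi> ^ K" using nrm_\<pi> by (simp add: less_divide_eq)
    then show ?thesis by (simp add: power_int_minus inverse_eq_divide)
  qed
  have \<kappa>_le: "\<bar>\<kappa> x s i\<bar> \<le> int K" if xs: "x \<in> carrier G" "s \<in> F" for x s i
  proof -
    have "- int K \<le> j" if "nrm \<pi> powi j \<le> C1" for j
      using nrm_\<pi>_mono[of j "- int K"] that K by (cases "- int K \<le> j") auto
    moreover have "nrm \<pi> powi \<kappa> x s i \<le> C1" "nrm \<pi> powi (- \<kappa> x s i) \<le> C1"
      using m[OF xs] diag_m(1,3)[OF xs] unfolding mbound_def nrm_powi[symmetric] by metis+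
    ultimately have "- int K \<le> \<kappa> x s i" "- int K \<le> - \<kappa> x s i" by blast+
    then show ?thesis by linarith
  qed
  obtain \<eta> where \<eta>: "\<eta> > 0" "\<And>w w' m m'. inverse_pair w w' \<Longrightarrow> inverse_pair m m' \<Longrightarrow>
        mbound \<eta> (m - mat 1) \<Longrightarrow> mbound \<eta> (m' - mat 1) \<Longrightarrow> pmf_close (\<epsilon> / 2) (\<phi> w) (\<phi> (w ** m))"
    using \<phi> \<open>\<epsilon> > 0\<close> half_gt_zero[of \<epsilon>] unfolding gl_sampling_def by meson
  obtain D where D: "0 \<le> D" "\<And>w w' v v'. inverse_pair w w' \<Longrightarrow> inverse_pair v v' \<Longrightarrow>
        set_pmf (\<phi> w) \<inter> set_pmf (\<phi> v) \<noteq> {} \<Longrightarrow> mbound D (w' ** v)"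
    using \<phi> unfolding gl_sampling_def by meson
  \<comment> \<open>The side \<open>N\<close> of the box makes the effect of a shift by \<open>K\<close> at most \<open>\<epsilon> / 2\<close>.\<close>
  define N where "N = nat \<lceil>2 * real (CARD('r) * K) / (\<epsilon> / 2)\<rceil> + 1"
  have N: "0 < N" "2 * real (CARD('r) * K) / real N \<le> \<epsilon> / 2"
  proof -
    show N0: "0 < N" by (simp add: N_def)
    define c where "c = 2 * real (CARD('r) * K)"
    have "c / (\<epsilon> / 2) \<le> real N" unfolding N_def c_def by linarith
    then have "c \<le> \<epsilon> / 2 * real N" using \<open>\<epsilon> > 0\<close> pos_divide_le_eq[of "\<epsilon> / 2" c "real N"] by (simp add: mult.commute)
    then show "2 * real (CARD('r) * K) / real N \<le> \<epsilon> / 2"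
      unfolding c_def[symmetric] using N0 pos_divide_le_eq[of "real N" c "\<epsilon> / 2"] by simp
  qed
  have "0 < \<eta> / (C1 + 1)" using \<eta>(1) C1 by simp
  then obtain M0 :: nat where M0: "nrm \<pi> ^ M0 < \<eta> / (C1 + 1)" using nrm_\<pi>_tendsto by blast
  have M0: "nrm \<pi> ^ M0 * C1 \<le> \<eta>"
  proof -
    have "nrm \<pi> ^ M0 * C1 \<le> nrm \<pi> ^ M0 * (C1 + 1)" using nrm_\<pi> by (intro mult_left_mono) auto
    also have "\<dots> \<le> \<eta>" using M0 C1 by (simp add: less_divide_eq)
    finally show ?thesis .
  qed
  \<comment> \<open>The gap \<open>M0\<close> contracts entries of size \<open>C1\<close> to \<open>\<eta>\<close>; the summand \<open>K\<close> compensates for the shift by \<open>\<kappa>\<close>.\<close>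
  define M where "M = M0 + K"
  define a :: "'r \<Rightarrow> int" where "a i = int (pos i * (N + M))" for i
  have a: "int M \<le> t j - t i" if "t \<in> int_box a N" "pos i < pos j" for t i j
  proof -
    have "(pos i + 1) * (N + M) \<le> pos j * (N + M)" using that(2) by (intro mult_right_mono) auto
    then have "a i + int N + int M \<le> a j"
      unfolding a_def of_nat_add[symmetric] of_nat_le_iff by (simp add: algebra_simps)
    moreover have "a j \<le> t j" "t i < a i + int N" using that(1) by (auto simp: int_box_iff)
    ultimately show ?thesis by linarith
  qed
  have ne: "int_box a N \<noteq> {}" using card_int_box[of a N] N(1) by auto
  \<comment> \<open>Consecutive coordinates of the box differ by at least \<open>M\<close>, whatever \<open>N\<close> is.\<close>
  define \<tau> where "\<tau> x = bind_pmf (pmf_of_set (int_box a N)) (\<lambda>t. \<phi> (b x ** torus t))" for x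
  have "almost_invariant G \<epsilon> F \<tau>"
    unfolding almost_invariant_def
  proof (intro ballI)
    fix x s assume xs: "x \<in> carrier G" "s \<in> F"
    then have s: "x \<otimes> s \<in> carrier G" using F by auto
    let ?\<kappa> = "\<kappa> x s"
    let ?\<sigma> = "bind_pmf (pmf_of_set (int_box a N)) (\<lambda>t. \<phi> (b x ** torus (\<lambda>i. t i + ?\<kappa> i)))"
    have "pmf_close (\<epsilon> / 2) ?\<sigma> (\<tau> (x \<otimes> s))"
      unfolding \<tau>_def
    proof (rule pmf_close_bind_right)
      fix t assume "t \<in> set_pmf (pmf_of_set (int_box a N))"
      then have t: "t \<in> int_box a N" unfolding set_pmf_of_set[OF ne finite_int_box] .
      let ?t = "\<lambda>i. t i + ?\<kappa> i"
      let ?w = "b x ** torus ?t"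
      \<comment> \<open>\<open>b (x s) t\<close> equals \<open>b x t \<pi>\<^bsup>\<kappa>\<^esup> u\<close> with the contracted factor \<open>u\<close>.\<close>
      let ?u = "torus (\<lambda>i. - ?t i) ** (b' x ** b (x \<otimes> s)) ** torus t"
      let ?u' = "torus (\<lambda>i. - t i) ** (b' (x \<otimes> s) ** b x) ** torus ?t"
      have w: "inverse_pair ?w (torus (\<lambda>i. - ?t i) ** b' x)"
        using bb'[OF xs(1)] inverse_pair_torus by (rule inverse_pair_mult)
      have "inverse_pair ((torus (\<lambda>i. - ?t i) ** b' x) ** (b (x \<otimes> s) ** torus t))
          ((torus (\<lambda>i. - t i) ** b' (x \<otimes> s)) ** (b x ** torus ?t))"
        using xs s by (intro inverse_pair_mult inverse_pair_torus inverse_pair_sym[OF inverse_pair_torus] bb' inverse_pair_sym[OF bb'])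
      then have u: "inverse_pair ?u ?u'" by (simp add: matrix_mul_assoc)
      have K': "int M0 \<le> t j - ?t i" "int M0 \<le> ?t j - t i" if "pos i < pos j" for i j
        using a[OF t that] \<kappa>_le[OF xs, of i] \<kappa>_le[OF xs, of j] by (auto simp: M_def)
      have "mbound \<eta> (?u - mat 1)"
        by (rule torus_contraction[where M = M0 and C = C1])
          (use m[OF xs] diag_m[OF xs] K' M0 \<eta>(1) in auto)
      moreover have "mbound \<eta> (?u' - mat 1)"
        by (rule torus_contraction[where M = M0 and C = C1])
          (use m[OF xs] diag_m[OF xs] K' M0 \<eta>(1) in auto)
      ultimately have "pmf_close (\<epsilon> / 2) (\<phi> ?w) (\<phi> (?w ** ?u))" by (rule \<eta>(2)[OF w u])
      moreover have "?w ** ?u = b (x \<otimes> s) ** torus t"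
      proof -
        have "?w ** ?u = b x ** (torus ?t ** (torus (\<lambda>i. - ?t i) ** (b' x ** (b (x \<otimes> s) ** torus t))))"
          by (simp only: matrix_mul_assoc)
        also have "\<dots> = b (x \<otimes> s) ** torus t"
          by (simp only: inverse_pair_cancel(1)[OF inverse_pair_torus] inverse_pair_cancel(1)[OF bb'[OF xs(1)]])
        finally show ?thesis .
      qed
      ultimately show "pmf_close (\<epsilon> / 2) (\<phi> (b x ** torus ?t)) (\<phi> (b (x \<otimes> s) ** torus t))" by simp
    qed (use \<open>\<epsilon> > 0\<close> in simp)
    moreover have "pmf_close (\<epsilon> / 2) (\<tau> x) ?\<sigma>"
    proof -
      have "?\<sigma> = bind_pmf (map_pmf (\<lambda>t i. t i + ?\<kappa> i) (pmf_of_set (int_box a N))) (\<lambda>t. \<phi> (b x ** torus t))"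
        by (simp add: bind_map_pmf)
      moreover have "pmf_close (\<epsilon> / 2) (pmf_of_set (int_box a N)) (map_pmf (\<lambda>t i. t i + ?\<kappa> i) (pmf_of_set (int_box a N)))"
        by (rule pmf_close_mono[OF pmf_close_int_box_shift[OF \<kappa>_le[OF xs] N(1)] N(2)])
      ultimately show ?thesis unfolding \<tau>_def by (simp add: pmf_close_bind_left)
    qed
    ultimately show "pmf_close \<epsilon> (\<tau> x) (\<tau> (x \<otimes> s))" using pmf_close_trans by fastforce
  qed
  moreover obtain T where T: "0 \<le> T" "\<And>t. t \<in> int_box a N \<Longrightarrow> mbound T (torus t :: 'k ^ 'r ^ 'r)"
      "\<And>t. t \<in> int_box a N \<Longrightarrow> mbound T (torus (\<lambda>i. - t i) :: 'k ^ 'r ^ 'r)"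
    using mbound_finite[of "torus ` int_box a N \<union> (\<lambda>t. torus (\<lambda>i. - t i)) ` int_box a N"] finite_int_box[of a N] by auto
  define E where "E = ?R * (?R * (?R * (?R * C * T) * D) * T) * C"
  have "localized G {x \<in> carrier G. mbound E (\<rho> x)} \<tau>"
    unfolding localized_def
  proof (intro ballI impI)
    fix x y assume xy: "x \<in> carrier G" "y \<in> carrier G" "set_pmf (\<tau> x) \<inter> set_pmf (\<tau> y) \<noteq> {}"
    then obtain t u where tu: "t \<in> int_box a N" "u \<in> int_box a N"
        "set_pmf (\<phi> (b x ** torus t)) \<inter> set_pmf (\<phi> (b y ** torus u)) \<noteq> {}"
      using set_pmf_of_set[OF ne finite_int_box] by (auto simp: \<tau>_def)
    have "mbound D ((torus (\<lambda>i. - t i) ** b' x) ** (b y ** torus u))"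
      by (rule D(2)[OF inverse_pair_mult[OF bb'[OF xy(1)] inverse_pair_torus]
            inverse_pair_mult[OF bb'[OF xy(2)] inverse_pair_torus] tu(3)])
    then have bd: "mbound E (h x ** torus t ** ((torus (\<lambda>i. - t i) ** b' x) ** (b y ** torus u)) ** torus (\<lambda>i. - u i) ** h' y)"
      unfolding E_def using h(2,3) xy T tu by (intro mbound_mult) auto
    also have "h x ** torus t ** ((torus (\<lambda>i. - t i) ** b' x) ** (b y ** torus u)) ** torus (\<lambda>i. - u i) ** h' y
        = h x ** (torus t ** (torus (\<lambda>i. - t i) ** (b' x ** (b y ** (torus u ** (torus (\<lambda>i. - u i) ** h' y))))))"
      by (simp only: matrix_mul_assoc)
    also have "\<dots> = h x ** (b' x ** (b y ** h' y))"
      by (simp only: inverse_pair_cancel[OF inverse_pair_torus])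
    also have "\<dots> = h x ** (b' x ** b y) ** h' y" by (simp only: matrix_mul_assoc)
    also have "\<dots> = h x ** (h' x ** (\<rho> (inv x \<otimes> y) ** (h y ** h' y)))"
      unfolding step[OF xy(1,2)] by (simp only: matrix_mul_assoc)
    also have "\<dots> = \<rho> (inv x \<otimes> y)"
      using inverse_pair_cancel(1)[OF h(1)[OF xy(1)]] h(1)[OF xy(2)] by (simp add: inverse_pair_def)
    finally show "inv x \<otimes> y \<in> {x \<in> carrier G. mbound E (\<rho> x)}" using xy by simp
  qed
  ultimately show ?thesis by blast
qed

end

section \<open>Lattices over nonarchimedean fields\<close>

locale nonarchimedean = absolute_value nrm \<pi> for nrm :: "'k::field \<Rightarrow> real" and \<pi> +
  assumes ultrametric: "nrm (x + y) \<le> max (nrm x) (nrm y)"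
begin

lemma nrm_sum_le: "(\<And>x. x \<in> A \<Longrightarrow> nrm (f x) \<le> C) \<Longrightarrow> 0 \<le> C \<Longrightarrow> nrm (sum f A) \<le> C"
proof (induction A rule: infinite_finite_induct)
  case (insert x A)
  then have "max (nrm (f x)) (nrm (sum f A)) \<le> C" by simp
  then show ?case using insert.hyps order_trans[OF ultrametric[of "f x" "sum f A"]] by simp
qed (auto simp: nrm_0)

lemma integral_mult: "mbound 1 A \<Longrightarrow> mbound 1 B \<Longrightarrow> mbound 1 (A ** B)"
  unfolding mbound_def mult_matrix_nth
  by (auto intro!: nrm_sum_le simp: nrm_mult mult_le_one nrm_nonneg)

definition lattice_coset :: "'k ^ 'r::finite ^ 'r \<Rightarrow> ('k ^ 'r ^ 'r) set" where
  "lattice_coset w = {w ** m | m m'. inverse_pair m m' \<and> mbound 1 m \<and> mbound 1 m'}"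

lemma lattice_coset_subset:
  assumes "inverse_pair m m'" "mbound 1 m" "mbound 1 m'"
  shows "lattice_coset (w ** m) \<subseteq> lattice_coset w"
proof
  fix x assume "x \<in> lattice_coset (w ** m)"
  then obtain n n' where n: "x = w ** m ** n" "inverse_pair n n'" "mbound 1 n" "mbound 1 n'"
    by (auto simp: lattice_coset_def)
  then have "x = w ** (m ** n)" "inverse_pair (m ** n) (n' ** m')" "mbound 1 (m ** n)" "mbound 1 (n' ** m')"
    using assms by (auto simp: matrix_mul_assoc intro: inverse_pair_mult integral_mult)
  then show "x \<in> lattice_coset w" unfolding lattice_coset_def by blast
qed

lemma lattice_coset_eq:
  assumes "inverse_pair m m'" "mbound 1 m" "mbound 1 m'"
  shows "lattice_coset (w ** m) = lattice_coset w"
proof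
  have "w ** m ** m' = w" using assms(1) by (simp add: inverse_pair_def matrix_mul_assoc[symmetric] matrix_mul_rid)
  then show "lattice_coset w \<subseteq> lattice_coset (w ** m)"
    using lattice_coset_subset[OF inverse_pair_sym[OF assms(1)] assms(3,2), of "w ** m"] by simp
qed (rule lattice_coset_subset[OF assms])

text \<open>
  By the ultrametric inequality a matrix close to \<open>1\<close> is integral. So the sampling can be
  deterministic: it selects the coset modulo the integral matrices, that is, a lattice.
\<close>

lemma gl_sampling_lattice: "gl_sampling (\<lambda>w :: 'k ^ 'r::finite ^ 'r. return_pmf (lattice_coset w))"
  unfolding gl_sampling_def
proof (intro conjI allI impI)
  fix \<epsilon> :: real assume \<epsilon>: "\<epsilon> > 0"
  have "mbound 1 m" if "mbound 1 (m - mat 1)" for m :: "'k ^ 'r ^ 'r"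
    unfolding mbound_def
  proof (intro allI)
    fix i j
    have "nrm ((m - mat 1) $ i $ j + mat 1 $ i $ j) \<le> 1"
      using that mbound_one by (intro order_trans[OF ultrametric]) (auto simp: mbound_def)
    then show "nrm (m $ i $ j) \<le> 1" by simp
  qed
  then have "pmf_close \<epsilon> (return_pmf (lattice_coset w)) (return_pmf (lattice_coset (w ** m)))"
    if "inverse_pair m m'" "mbound 1 (m - mat 1)" "mbound 1 (m' - mat 1)" for w m m' :: "'k ^ 'r ^ 'r"
    using lattice_coset_eq[of m m' w] that \<epsilon> by (simp add: pmf_close_refl)
  then show "\<exists>\<eta>>0. \<forall>w w' m m' :: 'k ^ 'r ^ 'r. inverse_pair w w' \<longrightarrow> inverse_pair m m' \<longrightarrow>
        mbound \<eta> (m - mat 1) \<longrightarrow> mbound \<eta> (m' - mat 1) \<longrightarrow>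
        pmf_close \<epsilon> (return_pmf (lattice_coset w)) (return_pmf (lattice_coset (w ** m)))"
    by (intro exI[of _ 1] conjI allI impI zero_less_one)
next
  have "mbound 1 (w' ** v)" if "inverse_pair w w'" "lattice_coset w = lattice_coset v"
    for w w' v :: "'k ^ 'r ^ 'r"
  proof -
    have "v ** mat 1 \<in> lattice_coset v"
      unfolding lattice_coset_def using inverse_pair_one mbound_one by blast
    then have "v \<in> lattice_coset w" using that(2) by (simp add: matrix_mul_rid)
    then obtain m where "v = w ** m" "mbound 1 m" by (auto simp: lattice_coset_def)
    then show ?thesis by (simp add: inverse_pair_cancel(2)[OF that(1)])
  qed
  then show "\<exists>D\<ge>0. \<forall>w w' v v' :: 'k ^ 'r ^ 'r. inverse_pair w w' \<longrightarrow> inverse_pair v v' \<longrightarrow>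
        set_pmf (return_pmf (lattice_coset w)) \<inter> set_pmf (return_pmf (lattice_coset v)) \<noteq> {} \<longrightarrow> mbound D (w' ** v)"
  proof (intro exI[of _ 1] conjI allI impI)
    fix w w' v v' :: "'k ^ 'r ^ 'r"
    assume "inverse_pair w w'" "set_pmf (return_pmf (lattice_coset w)) \<inter> set_pmf (return_pmf (lattice_coset v)) \<noteq> {}"
    moreover from this(2) have "lattice_coset w = lattice_coset v" by simp
    ultimately show "mbound 1 (w' ** v)" using \<open>\<And>w w' v. inverse_pair w w' \<Longrightarrow> lattice_coset w = lattice_coset v \<Longrightarrow> mbound 1 (w' ** v)\<close> by blast
  qed simp
qed

end

section \<open>Nets of real matrices\<close>

definition weighted_pmf :: "('z \<Rightarrow> real) \<Rightarrow> 'z set \<Rightarrow> 'z pmf" where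
  "weighted_pmf f A = embed_pmf (\<lambda>z. if z \<in> A then f z / sum f A else 0)"

lemma pmf_weighted:
  assumes "finite A" "\<And>z. z \<in> A \<Longrightarrow> 0 \<le> f z" "0 < sum f A"
  shows "pmf (weighted_pmf f A) z = (if z \<in> A then f z / sum f A else 0)"
  unfolding weighted_pmf_def
proof (rule pmf_embed_pmf)
  show "0 \<le> (if z \<in> A then f z / sum f A else 0)" for z using assms by auto
  have "(\<integral>\<^sup>+ z. ennreal (if z \<in> A then f z / sum f A else 0) \<partial>count_space UNIV) =
      (\<Sum>z\<in>A. ennreal (f z / sum f A))"
    using assms(1) by (subst nn_integral_count_space'[of A]) auto
  also have "\<dots> = ennreal (\<Sum>z\<in>A. f z / sum f A)" using assms by (intro sum_ennreal) auto
  also have "(\<Sum>z\<in>A. f z / sum f A) = 1" using assms(3) by (simp flip: sum_divide_distrib)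
  finally show "(\<integral>\<^sup>+ z. ennreal (if z \<in> A then f z / sum f A else 0) \<partial>count_space UNIV) = 1" by simp
qed

lemma expectation_weighted:
  fixes g :: "'z \<Rightarrow> real"
  assumes "finite A" "\<And>z. z \<in> A \<Longrightarrow> 0 \<le> f z" "0 < sum f A"
  shows "measure_pmf.expectation (weighted_pmf f A) g = (\<Sum>z\<in>A. f z * g z) / sum f A"
proof -
  have "measure_pmf.expectation (weighted_pmf f A) g = (\<Sum>z\<in>A. g z * pmf (weighted_pmf f A) z)"
    using assms(1) pmf_weighted[OF assms] by (intro integral_measure_pmf_real) (auto simp: set_pmf_iff split: if_splits)
  also have "\<dots> = (\<Sum>z\<in>A. f z * g z / sum f A)"
    by (intro sum.cong HOL.refl) (simp add: pmf_weighted[OF assms])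
  finally show ?thesis by (simp add: sum_divide_distrib)
qed

text \<open>
  The difference of two quotients is at most \<open>2 \<Delta> / s\<close>, because normalised sums of test
  functions are bounded by \<open>1\<close>.
\<close>

lemma pmf_close_weighted:
  assumes A: "finite A" "\<And>z. z \<in> A \<Longrightarrow> 0 \<le> f z" "0 < s" "s \<le> sum f A"
    and B: "finite B" "\<And>z. z \<in> B \<Longrightarrow> 0 \<le> g z" "0 < sum g B"
    and zero: "\<And>z. z \<in> B - A \<Longrightarrow> f z = 0" "\<And>z. z \<in> A - B \<Longrightarrow> g z = 0"
    and \<Delta>: "(\<Sum>z\<in>A \<union> B. \<bar>f z - g z\<bar>) \<le> \<Delta>"
  shows "pmf_close (2 * \<Delta> / s) (weighted_pmf f A) (weighted_pmf g B)"
  unfolding pmf_close_def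
proof (intro allI impI)
  fix h :: "'a \<Rightarrow> real" assume h: "\<forall>y. \<bar>h y\<bar> \<le> 1"
  let ?U = "A \<union> B"
  define S where "S = sum f A"
  define T where "T = sum g B"
  define P where "P = (\<Sum>z\<in>A. f z * h z)"
  define Q where "Q = (\<Sum>z\<in>B. g z * h z)"
  have S: "S = sum f ?U" "P = (\<Sum>z\<in>?U. f z * h z)"
    unfolding S_def P_def using A(1) B(1) zero by (auto intro!: sum.mono_neutral_left)
  have T: "T = sum g ?U" "Q = (\<Sum>z\<in>?U. g z * h z)"
    unfolding T_def Q_def using A(1) B(1) zero by (auto intro!: sum.mono_neutral_left)
  have pos: "0 < S" "0 < T" "s \<le> S" using A B by (auto simp: S_def T_def)
  have "\<bar>S - T\<bar> \<le> \<Delta>"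
    unfolding S T sum_subtractf[symmetric] by (rule order_trans[OF sum_abs \<Delta>])
  have "\<bar>P - Q\<bar> = \<bar>\<Sum>z\<in>?U. (f z - g z) * h z\<bar>"
    unfolding S T sum_subtractf[symmetric] by (simp add: left_diff_distrib)
  also have "\<dots> \<le> (\<Sum>z\<in>?U. \<bar>f z - g z\<bar>)"
    using h by (intro order_trans[OF sum_abs] sum_mono) (auto simp: abs_mult mult_left_le)
  finally have PQ: "\<bar>P - Q\<bar> \<le> \<Delta>" using \<Delta> by linarith
  have "\<bar>Q\<bar> \<le> (\<Sum>z\<in>B. \<bar>g z * h z\<bar>)" unfolding Q_def by (rule sum_abs)
  also have "\<dots> \<le> T"
    unfolding T_def using B(2) h by (intro sum_mono) (auto simp: abs_mult mult_left_le)
  finally have QT: "\<bar>Q / T\<bar> \<le> 1" using pos by (simp add: abs_divide)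
  have "P / S - Q / T = ((P - Q) + (Q / T) * (T - S)) / S" using pos by (simp add: field_simps)
  moreover have "\<bar>(P - Q) + (Q / T) * (T - S)\<bar> \<le> 2 * \<Delta>"
  proof -
    have "\<bar>(Q / T) * (T - S)\<bar> \<le> 1 * \<Delta>"
      unfolding abs_mult using QT \<open>\<bar>S - T\<bar> \<le> \<Delta>\<close> by (intro mult_mono) (auto simp: abs_minus_commute)
    then show ?thesis using PQ abs_triangle_ineq[of "P - Q" "(Q / T) * (T - S)"] by linarith
  qed
  ultimately have "\<bar>P / S - Q / T\<bar> \<le> 2 * \<Delta> / S"
    using pos by (simp add: abs_divide divide_right_mono)
  also have "\<dots> \<le> 2 * \<Delta> / s"
    using A(3) pos PQ by (intro divide_left_mono) auto
  finally have "\<bar>P / S - Q / T\<bar> \<le> 2 * \<Delta> / s" .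
  moreover have "measure_pmf.expectation (weighted_pmf f A) h = P / S"
    unfolding P_def S_def using A pos by (intro expectation_weighted) (auto simp: S_def)
  moreover have "measure_pmf.expectation (weighted_pmf g B) h = Q / T"
    unfolding Q_def T_def using B by (intro expectation_weighted) auto
  ultimately show "\<bar>measure_pmf.expectation (weighted_pmf f A) h - measure_pmf.expectation (weighted_pmf g B) h\<bar> \<le> 2 * \<Delta> / s"
    by simp
qed

interpretation real_abs: absolute_value "abs :: real \<Rightarrow> real" "1 / 2"
  by unfold_locales (auto simp: abs_mult)

text \<open>
  A submultiplicative norm, unlike the maximum of the entries.
\<close>

definition mnorm :: "real ^ 'r::finite ^ 'r \<Rightarrow> real" where
  "mnorm A = (\<Sum>i\<in>UNIV. \<Sum>j\<in>UNIV. \<bar>A $ i $ j\<bar>)"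

lemma mnorm_nonneg: "0 \<le> mnorm A"
  unfolding mnorm_def by (intro sum_nonneg) auto

lemma mnorm_triangle: "mnorm (A + B) \<le> mnorm A + mnorm B"
  unfolding mnorm_def sum.distrib[symmetric] by (intro sum_mono) auto

lemma mnorm_minus: "mnorm (A - B) = mnorm (B - A)"
  unfolding mnorm_def by (simp add: abs_minus_commute)

lemma mnorm_one: "mnorm (mat 1 :: real ^ 'r::finite ^ 'r) = real CARD('r)"
proof -
  have "\<bar>mat 1 $ i $ j\<bar> = (if j = i then 1 else 0 :: real)" for i j :: 'r by (simp add: mat_nth)
  then show ?thesis by (simp add: mnorm_def)
qed

lemma mnorm_mult: "mnorm (A ** B) \<le> mnorm A * mnorm (B :: real ^ 'r::finite ^ 'r)"
proof -
  have "mnorm (A ** B) \<le> (\<Sum>i\<in>UNIV. \<Sum>j\<in>UNIV. \<Sum>k\<in>UNIV. \<bar>A $ i $ k\<bar> * \<bar>B $ k $ j\<bar>)"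
    unfolding mnorm_def mult_matrix_nth abs_mult[symmetric] by (intro sum_mono sum_abs)
  also have "\<dots> = (\<Sum>i\<in>UNIV. \<Sum>k\<in>UNIV. \<bar>A $ i $ k\<bar> * (\<Sum>j\<in>UNIV. \<bar>B $ k $ j\<bar>))"
    by (subst sum.swap) (simp add: sum_distrib_left)
  also have "\<dots> \<le> (\<Sum>i\<in>UNIV. \<Sum>k\<in>UNIV. \<bar>A $ i $ k\<bar> * mnorm B)"
    unfolding mnorm_def by (intro sum_mono mult_left_mono member_le_sum) (auto intro: sum_nonneg)
  also have "\<dots> = mnorm A * mnorm B" by (simp add: mnorm_def sum_distrib_right)
  finally show ?thesis .
qed

lemma mbound_mnorm: "mnorm A \<le> C \<Longrightarrow> real_abs.mbound C A"
  unfolding real_abs.mbound_def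
proof (intro allI)
  fix i j assume "mnorm A \<le> C"
  have "\<bar>A $ i $ j\<bar> \<le> (\<Sum>j\<in>UNIV. \<bar>A $ i $ j\<bar>)" by (rule member_le_sum) auto
  also have "\<dots> \<le> mnorm A" unfolding mnorm_def by (rule member_le_sum) (auto intro: sum_nonneg)
  finally show "\<bar>A $ i $ j\<bar> \<le> C" using \<open>mnorm A \<le> C\<close> by simp
qed

lemma mnorm_mbound:
  fixes A :: "real ^ 'r::finite ^ 'r"
  assumes "real_abs.mbound C A"
  shows "mnorm A \<le> real CARD('r) * (real CARD('r) * C)"
proof -
  have "(\<Sum>j\<in>UNIV. \<bar>A $ i $ j\<bar>) \<le> real CARD('r) * C" for i
    using assms unfolding real_abs.mbound_def by (intro sum_bounded_above) auto
  then show ?thesis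
    unfolding mnorm_def using sum_bounded_above[of UNIV "\<lambda>i. \<Sum>j\<in>UNIV. \<bar>A $ i $ j\<bar>"] by simp
qed

lemma mnorm_le_norm: "mnorm (A :: real ^ 'r::finite ^ 'r) \<le> real CARD('r) * (real CARD('r) * norm A)"
  using order_trans[OF component_le_norm_cart Finite_Cartesian_Product.norm_nth_le]
  by (intro mnorm_mbound) (auto simp: real_abs.mbound_def)

lemma norm_le_mnorm: "norm (A :: real ^ 'r::finite ^ 'r) \<le> mnorm A"
proof -
  have "norm A \<le> (\<Sum>i\<in>UNIV. norm (A $ i))" unfolding norm_vec_def by (rule L2_set_le_sum) auto
  also have "\<dots> \<le> mnorm A" unfolding mnorm_def by (intro sum_mono norm_le_l1_cart)
  finally show ?thesis .
qed


definition gl_inv :: "real ^ 'r::finite ^ 'r \<Rightarrow> real ^ 'r ^ 'r" where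
  "gl_inv w = (SOME w'. inverse_pair w w')"

lemma gl_inv_eq: "inverse_pair w w' \<Longrightarrow> gl_inv w = w'"
proof -
  assume w: "inverse_pair w w'"
  then have "inverse_pair w (gl_inv w)" unfolding gl_inv_def by (rule someI)
  then have "w' = w' ** (w ** gl_inv w)" by (simp add: inverse_pair_def matrix_mul_rid)
  also have "\<dots> = gl_inv w" by (rule inverse_pair_cancel(2)[OF w])
  finally show ?thesis by simp
qed

text \<open>
  How far \<open>z\<close> is from \<open>w\<close> in the geometry that is invariant under left multiplication. It is not
  symmetric, but small deviations in one direction are small in the other (\<open>mnorm_inverse\<close>).
\<close>

definition deviation :: "real ^ 'r::finite ^ 'r \<Rightarrow> real ^ 'r ^ 'r \<Rightarrow> real" where
  "deviation w z = mnorm (gl_inv w ** z - mat 1)"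

lemma matrix_diff_ldistrib: "A ** (B - C) = A ** B - A ** (C :: real ^ 'r::finite ^ 'r)"
  by (simp add: vec_eq_iff mult_matrix_nth right_diff_distrib sum_subtractf)

lemma matrix_diff_rdistrib: "(A - B) ** C = A ** C - B ** (C :: real ^ 'r::finite ^ 'r)"
  by (simp add: vec_eq_iff mult_matrix_nth left_diff_distrib sum_subtractf)

text \<open>
  The first terms of the Neumann series: \<open>m' - 1 = (m' - 1)(1 - m) + (1 - m)\<close>.
\<close>

lemma mnorm_inverse:
  assumes "inverse_pair m m'" "mnorm (m - mat 1) \<le> r" "r < 1"
  shows "mnorm (m' - mat 1) \<le> r / (1 - r)"
proof -
  have "m' - mat 1 = (m' - mat 1) ** (mat 1 - m) + (mat 1 - m)"
    using assms(1) by (simp add: inverse_pair_def matrix_diff_ldistrib matrix_diff_rdistrib matrix_mul_lid matrix_mul_rid)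
  then have "mnorm (m' - mat 1) \<le> mnorm ((m' - mat 1) ** (mat 1 - m)) + mnorm (mat 1 - m)"
    by (metis mnorm_triangle)
  also have "\<dots> \<le> mnorm (m' - mat 1) * mnorm (mat 1 - m) + mnorm (mat 1 - m)"
    using mnorm_mult by (intro add_mono) auto
  also have "\<dots> \<le> mnorm (m' - mat 1) * r + r"
    using assms(2) mnorm_nonneg by (intro add_mono mult_left_mono) (auto simp: mnorm_minus)
  finally have "mnorm (m' - mat 1) * (1 - r) \<le> r" by (simp add: right_diff_distrib)
  then show ?thesis using assms(3) by (simp add: le_divide_eq)
qed

lemma mnorm_le_deviation: "mnorm m \<le> mnorm (m - mat 1) + real CARD('r)" for m :: "real ^ 'r::finite ^ 'r"
  using mnorm_triangle[of "m - mat 1" "mat 1"] mnorm_one[where 'r = 'r] by simp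

definition separated :: "(real ^ 'r::finite ^ 'r) set \<Rightarrow> bool" where
  "separated Z \<longleftrightarrow> (\<forall>z\<in>Z. \<exists>z'. inverse_pair z z') \<and> (\<forall>y\<in>Z. \<forall>z\<in>Z. y \<noteq> z \<longrightarrow> 1 / 4 \<le> deviation y z)"

text \<open>
  A maximal separated set. The bound \<open>1/3\<close> is what \<open>mnorm_inverse\<close> makes of \<open>1/4\<close>.
\<close>

lemma ex_separated_net:
  "\<exists>Z :: (real ^ 'r::finite ^ 'r) set. separated Z \<and> (\<forall>w w'. inverse_pair w w' \<longrightarrow> (\<exists>z\<in>Z. deviation w z \<le> 1 / 3))"
proof -
  have "\<Union>C \<in> Collect separated" if C: "subset.chain (Collect separated) C" for C :: "(real ^ 'r ^ 'r) set set"
  proof -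
    have *: "\<exists>U. separated U \<and> y \<in> U \<and> z \<in> U" if yz: "y \<in> \<Union>C" "z \<in> \<Union>C" for y z
    proof -
      obtain U V where UV: "U \<in> C" "V \<in> C" "y \<in> U" "z \<in> V" using yz by blast
      then have "U \<subseteq> V \<or> V \<subseteq> U" "separated U" "separated V" using C by (auto simp: subset_chain_def)
      then show ?thesis using UV by blast
    qed
    show ?thesis
      unfolding separated_def mem_Collect_eq
    proof (intro conjI ballI impI)
      fix z assume "z \<in> \<Union>C"
      then obtain U where "separated U" "z \<in> U" using * by blast
      then show "\<exists>z'. inverse_pair z z'" by (simp add: separated_def)
    next
      fix y z assume "y \<in> \<Union>C" "z \<in> \<Union>C" "y \<noteq> z"
      moreover from this obtain U where "separated U" "y \<in> U" "z \<in> U" using * by blast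
      ultimately show "1 / 4 \<le> deviation y z" by (simp add: separated_def)
    qed
  qed
  from subset_Zorn'[OF this] obtain Z :: "(real ^ 'r ^ 'r) set"
    where Z: "separated Z" "\<And>Y. separated Y \<Longrightarrow> Z \<subseteq> Y \<Longrightarrow> Y = Z" by blast
  have "\<exists>z\<in>Z. deviation w z \<le> 1 / 3" if w: "inverse_pair w w'" for w w'
  proof (cases "w \<in> Z")
    case True
    have "deviation w w = 0"
      using w by (simp add: deviation_def gl_inv_eq[OF w] inverse_pair_def mnorm_def)
    with True show ?thesis by force
  next
    case False
    then have "\<not> separated (insert w Z)" using Z(2)[of "insert w Z"] by blast
    then obtain z where z: "z \<in> Z" "deviation w z < 1 / 4 \<or> deviation z w < 1 / 4"
      using Z(1) w unfolding separated_def by (metis insert_iff not_le)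
    show ?thesis
    proof (cases "deviation w z < 1 / 4")
      case False
      obtain z' where z': "inverse_pair z z'" using Z(1) z(1) unfolding separated_def by meson
      have "inverse_pair (z' ** w) (w' ** z)"
        using w z' by (intro inverse_pair_mult inverse_pair_sym[OF z']) auto
      moreover have "mnorm (z' ** w - mat 1) \<le> 1 / 4"
        using False z(2) by (simp add: deviation_def gl_inv_eq[OF z'])
      ultimately have "mnorm (w' ** z - mat 1) \<le> (1 / 4) / (1 - 1 / 4)" by (rule mnorm_inverse) simp
      then show ?thesis using z(1) by (intro bexI[of _ z]) (auto simp: deviation_def gl_inv_eq[OF w])
    qed (use z in force)
  qed
  with Z(1) show ?thesis by blast
qed

text \<open>
  After translation by the inverse of \<open>w\<close> the points lie in a compact ball around \<open>1\<close>, whose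
  elements have bounded inverses. Separated points therefore stay a fixed distance apart, and total
  boundedness of the ball limits their number independently of \<open>w\<close>.
\<close>

lemma separated_card_bound:
  "\<exists>K. \<forall>(Z :: (real ^ 'r::finite ^ 'r) set) w w'. separated Z \<longrightarrow> inverse_pair w w' \<longrightarrow>
     finite {z \<in> Z. deviation w z < 1 / 2} \<and> card {z \<in> Z. deviation w z < 1 / 2} \<le> K"
proof -
  define R where "R = real CARD('r)"
  have R: "1 \<le> R" by (simp add: R_def Suc_leI)
  \<comment> \<open>A separation of \<open>1/4\<close> becomes \<open>2 e\<close> in the Euclidean norm: one factor \<open>R + 1\<close> comes from an inverse matrix and \<open>R * R\<close> from the comparison of the norms.\<close>
  define e where "e = 1 / (8 * (R + 1) * (R * R))"
  have e: "0 < e" using R by (simp add: e_def)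
  have "compact (cball (mat 1 :: real ^ 'r ^ 'r) (1 / 2))" by simp
  then obtain k where k: "finite k" "cball (mat 1 :: real ^ 'r ^ 'r) (1 / 2) \<subseteq> (\<Union>x\<in>k. ball x e)"
    using e unfolding compact_eq_totally_bounded by meson
  have "finite {z \<in> Z. deviation w z < 1 / 2} \<and> card {z \<in> Z. deviation w z < 1 / 2} \<le> card k"
    if Z: "separated Z" and w: "inverse_pair w w'" for Z :: "(real ^ 'r ^ 'r) set" and w w'
  proof -
    let ?Z = "{z \<in> Z. deviation w z < 1 / 2}"
    have "\<exists>x\<in>k. w' ** z \<in> ball x e" if "z \<in> ?Z" for z
    proof -
      have "norm (w' ** z - mat 1) \<le> 1 / 2"
        using that norm_le_mnorm[of "w' ** z - mat 1"] by (simp add: deviation_def gl_inv_eq[OF w])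
      then have "w' ** z \<in> cball (mat 1) (1 / 2)" by (simp add: dist_norm norm_minus_commute)
      then show ?thesis using k(2) by blast
    qed
    then have ex: "\<exists>x. x \<in> k \<and> w' ** z \<in> ball x e" if "z \<in> ?Z" for z using that by blast
    define c where "c z = (SOME x. x \<in> k \<and> w' ** z \<in> ball x e)" for z
    have c: "c z \<in> k \<and> w' ** z \<in> ball (c z) e" if "z \<in> ?Z" for z
      unfolding c_def by (rule someI_ex[OF ex[OF that]])
    have "inj_on c ?Z"
    proof (rule inj_onI, rule ccontr)
      fix y z assume yz: "y \<in> ?Z" "z \<in> ?Z" "c y = c z" "y \<noteq> z"
      have "y \<in> Z" "z \<in> Z" using yz by auto
      then obtain y' where y': "inverse_pair y y'" using Z unfolding separated_def by meson
      have "dist (w' ** y) (c y) < e" "dist (w' ** z) (c y) < e"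
        using c[OF yz(1)] c[OF yz(2)] yz(3) by (auto simp: dist_commute)
      then have "norm (w' ** z - w' ** y) < 2 * e"
        using dist_triangle_less_add[of "w' ** z" "c y" e "w' ** y" e]
        by (simp add: dist_commute dist_norm norm_minus_commute)
      then have "R * (R * norm (w' ** z - w' ** y)) < R * (R * (2 * e))" using R by simp
      then have "mnorm (w' ** z - w' ** y) < R * (R * (2 * e))"
        using mnorm_le_norm[of "w' ** z - w' ** y"] unfolding R_def by linarith
      moreover have "R * (R * (2 * e)) = 1 / (4 * (R + 1))"
      proof -
        have "e = 1 / (4 * (R + 1)) / (2 * (R * R))" by (simp add: e_def)
        then show ?thesis using R by simp
      qed
      ultimately have small: "mnorm (w' ** z - w' ** y) < 1 / (4 * (R + 1))" by simp
      have "inverse_pair (w' ** y) (y' ** w)"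
        using w y' by (intro inverse_pair_mult inverse_pair_sym[OF w]) auto
      moreover have "mnorm (w' ** y - mat 1) \<le> 1 / 2"
        using yz(1) by (simp add: deviation_def gl_inv_eq[OF w])
      ultimately have "mnorm (y' ** w - mat 1) \<le> (1 / 2) / (1 - 1 / 2)" by (rule mnorm_inverse) simp
      then have "mnorm (y' ** w) \<le> R + 1" using mnorm_le_deviation[of "y' ** w"] by (simp add: R_def)
      moreover have "y' ** z - mat 1 = (y' ** w) ** (w' ** z - w' ** y)"
      proof -
        have "(y' ** w) ** (w' ** z - w' ** y) = y' ** (w ** (w' ** z)) - y' ** (w ** (w' ** y))"
          by (simp only: matrix_diff_ldistrib matrix_mul_assoc)
        also have "\<dots> = y' ** z - mat 1"
          using y' by (simp only: inverse_pair_cancel(1)[OF w]) (simp add: inverse_pair_def)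
        finally show ?thesis by simp
      qed
      ultimately have "mnorm (y' ** z - mat 1) \<le> (R + 1) * mnorm (w' ** z - w' ** y)"
        using order_trans[OF mnorm_mult[of "y' ** w" "w' ** z - w' ** y"] mult_right_mono[OF _ mnorm_nonneg]] by simp
      moreover have "(R + 1) * mnorm (w' ** z - w' ** y) < 1 / 4"
      proof -
        have "(R + 1) * mnorm (w' ** z - w' ** y) < (R + 1) * (1 / (4 * (R + 1)))"
          using small R by (intro mult_strict_left_mono) auto
        also have "\<dots> = 1 / 4" using R by simp
        finally show ?thesis .
      qed
      ultimately have "deviation y z < 1 / 4" by (simp add: deviation_def gl_inv_eq[OF y'])
      moreover have "1 / 4 \<le> deviation y z"
        using Z \<open>y \<in> Z\<close> \<open>z \<in> Z\<close> yz(4) unfolding separated_def by meson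
      ultimately show False by linarith
    qed
    moreover have "c ` ?Z \<subseteq> k" using c by blast
    ultimately show ?thesis using k(1) by (meson card_inj_on_le inj_on_finite)
  qed
  then show ?thesis by blast
qed


lemma deviation_mult:
  assumes w: "inverse_pair w w'" and m: "inverse_pair m m'"
    and "mnorm (m - mat 1) \<le> \<eta>" "mnorm (m' - mat 1) \<le> \<eta>"
    and z: "deviation w z < 1 / 2 \<or> deviation (w ** m) z < 1 / 2"
  shows "\<bar>deviation w z - deviation (w ** m) (z :: real ^ 'r::finite ^ 'r)\<bar> \<le> \<eta> * (real CARD('r) + 1)"
proof -
  have eq: "gl_inv (w ** m) = m' ** w'" "gl_inv w = w'"
    using gl_inv_eq[OF w] gl_inv_eq[OF inverse_pair_mult[OF w m]] by auto
  define a where "a = w' ** z"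
  have b: "m' ** w' ** z = m' ** a" by (simp add: a_def matrix_mul_assoc)
  have dev: "deviation w z = mnorm (a - mat 1)" "deviation (w ** m) z = mnorm (m' ** a - mat 1)"
    unfolding deviation_def eq b by (simp_all only: a_def)
  have "mnorm (a - m' ** a) \<le> \<eta> * (real CARD('r) + 1)"
    using z
  proof
    assume "deviation w z < 1 / 2"
    then have "mnorm a \<le> real CARD('r) + 1" using mnorm_le_deviation[of a] by (simp add: dev)
    moreover have "a - m' ** a = (mat 1 - m') ** a" by (simp add: matrix_diff_rdistrib matrix_mul_lid)
    ultimately show ?thesis
      using assms(4) mult_mono[of "mnorm (mat 1 - m')" \<eta> "mnorm a" "real CARD('r) + 1"] mnorm_mult[of "mat 1 - m'" a]
        mnorm_nonneg[of a] mnorm_nonneg[of "mat 1 - m'"] by (simp add: mnorm_minus)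
  next
    assume "deviation (w ** m) z < 1 / 2"
    then have "mnorm (m' ** a) \<le> real CARD('r) + 1" using mnorm_le_deviation[of "m' ** a"] by (simp add: dev)
    moreover have "a - m' ** a = (m - mat 1) ** (m' ** a)"
      by (simp add: matrix_diff_rdistrib matrix_mul_lid inverse_pair_cancel(1)[OF m])
    ultimately show ?thesis
      using assms(3) mult_mono[of "mnorm (m - mat 1)" \<eta> "mnorm (m' ** a)" "real CARD('r) + 1"] mnorm_mult[of "m - mat 1" "m' ** a"]
        mnorm_nonneg[of "m' ** a"] mnorm_nonneg[of "m - mat 1"] by simp
  qed
  moreover have "\<bar>mnorm (a - mat 1) - mnorm (m' ** a - mat 1)\<bar> \<le> mnorm (a - m' ** a)"
    using mnorm_triangle[of "a - m' ** a" "m' ** a - mat 1"] mnorm_triangle[of "m' ** a - a" "a - mat 1"]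
      mnorm_minus[of a "m' ** a"] by simp
  ultimately show ?thesis by (simp add: dev)
qed

text \<open>
  The radius \<open>1/2\<close> exceeds the covering radius \<open>1/3\<close> of the net, so the weights add up to at
  least \<open>1/6\<close>, and it is less than \<open>1\<close>, as \<open>mnorm_inverse\<close> requires.
\<close>

definition bump :: "real ^ 'r::finite ^ 'r \<Rightarrow> real ^ 'r ^ 'r \<Rightarrow> real" where
  "bump w z = max 0 (1 / 2 - deviation w z)"

text \<open>
  Choose a point of the net with probability proportional to \<open>bump w\<close>. Each weight is a
  Lipschitz function of \<open>w\<close>, and boundedly many of them are nonzero.
\<close>

theorem gl_sampling_real:
  "\<exists>\<phi> :: real ^ 'r::finite ^ 'r \<Rightarrow> (real ^ 'r ^ 'r) pmf. real_abs.gl_sampling \<phi>"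
proof -
  let ?R = "real CARD('r)"
  obtain Z :: "(real ^ 'r ^ 'r) set" where Z: "separated Z"
      "\<And>w w'. inverse_pair w w' \<Longrightarrow> \<exists>z\<in>Z. deviation w z \<le> 1 / 3"
    using ex_separated_net by blast
  define A where "A w = {z \<in> Z. deviation w z < 1 / 2}" for w
  obtain K where K: "\<And>w w'. inverse_pair w w' \<Longrightarrow> finite (A w)" "\<And>w w'. inverse_pair w w' \<Longrightarrow> card (A w) \<le> K"
    using separated_card_bound[where 'r = 'r] Z(1) unfolding A_def by blast
  define \<phi> where "\<phi> w = weighted_pmf (bump w) (A w)" for w
  have bump_nonneg: "0 \<le> bump w z" for w z :: "real ^ 'r ^ 'r" by (simp add: bump_def)
  have total: "1 / 6 \<le> sum (bump w) (A w)" if w: "inverse_pair w w'" for w w'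
  proof -
    obtain z where z: "z \<in> Z" "deviation w z \<le> 1 / 3" using Z(2)[OF w] by blast
    then have "bump w z \<le> sum (bump w) (A w)"
      using K(1)[OF w] bump_nonneg by (intro member_le_sum) (auto simp: A_def)
    then show ?thesis using z(2) by (simp add: bump_def)
  qed
  have set_\<phi>: "set_pmf (\<phi> w) \<subseteq> A w" if w: "inverse_pair w w'" for w w'
    using total[OF w] K(1)[OF w] bump_nonneg pmf_weighted[of "A w" "bump w"]
    by (auto simp: set_pmf_iff \<phi>_def split: if_splits)
  have cont: "\<exists>\<eta>>0. \<forall>w w' m m'. inverse_pair w w' \<longrightarrow> inverse_pair m m' \<longrightarrow>
        real_abs.mbound \<eta> (m - mat 1) \<longrightarrow> real_abs.mbound \<eta> (m' - mat 1) \<longrightarrow> pmf_close \<epsilon> (\<phi> w) (\<phi> (w ** m))"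
    if \<epsilon>: "\<epsilon> > 0" for \<epsilon>
  proof -
    define c where "c = 24 * (real K + 1) * (?R + 1)"
    have c: "0 < c" by (simp add: c_def add_pos_nonneg)
    define \<eta> where "\<eta> = \<epsilon> / c"
    have \<eta>: "0 < \<eta>" using \<epsilon> c by (simp add: \<eta>_def)
    have "pmf_close \<epsilon> (\<phi> w) (\<phi> (w ** m))"
      if w: "inverse_pair w w'" and m: "inverse_pair m m'"
        and bd: "real_abs.mbound (\<eta> / (?R * ?R)) (m - mat 1)" "real_abs.mbound (\<eta> / (?R * ?R)) (m' - mat 1)"
      for w w' m m'
    proof -
      have le: "mnorm (m - mat 1) \<le> \<eta>" "mnorm (m' - mat 1) \<le> \<eta>"
        using mnorm_mbound[OF bd(1)] mnorm_mbound[OF bd(2)] by (simp_all add: mult.assoc[symmetric])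
      have wm: "inverse_pair (w ** m) (m' ** w')" using w m by (rule inverse_pair_mult)
      let ?U = "A w \<union> A (w ** m)"
      have "\<bar>bump w z - bump (w ** m) z\<bar> \<le> \<eta> * (?R + 1)" if "z \<in> ?U" for z
        using deviation_mult[OF w m le, of z] that by (auto simp: bump_def A_def)
      then have "(\<Sum>z\<in>?U. \<bar>bump w z - bump (w ** m) z\<bar>) \<le> real (card ?U) * (\<eta> * (?R + 1))"
        by (intro sum_bounded_above)
      also have "\<dots> \<le> real (2 * K) * (\<eta> * (?R + 1))"
        using card_Un_le[of "A w" "A (w ** m)"] K(2)[OF w] K(2)[OF wm] \<eta> by (intro mult_right_mono) auto
      finally have "pmf_close (2 * (real (2 * K) * (\<eta> * (?R + 1))) / (1 / 6)) (\<phi> w) (\<phi> (w ** m))"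
        unfolding \<phi>_def using total[OF w] total[OF wm] K(1)[OF w] K(1)[OF wm] bump_nonneg
        by (intro pmf_close_weighted) (auto simp: A_def bump_def)
      moreover have "2 * (real (2 * K) * (\<eta> * (?R + 1))) / (1 / 6) \<le> \<epsilon>"
      proof -
        have "2 * (real (2 * K) * (\<eta> * (?R + 1))) / (1 / 6) = \<eta> * (24 * real K * (?R + 1))" by simp
        also have "\<dots> \<le> \<eta> * c" unfolding c_def using \<eta> by (intro mult_left_mono mult_right_mono) auto
        also have "\<dots> = \<epsilon>" using c by (simp add: \<eta>_def)
        finally show ?thesis .
      qed
      ultimately show ?thesis by (rule pmf_close_mono)
    qed
    then show ?thesis using \<eta> by (intro exI[of _ "\<eta> / (?R * ?R)"] conjI allI impI) auto
  qed
  have loc: "real_abs.mbound ((?R + 1) * (?R + 1)) (w' ** v)"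
    if w: "inverse_pair w w'" and v: "inverse_pair v v'" and meet: "set_pmf (\<phi> w) \<inter> set_pmf (\<phi> v) \<noteq> {}" for w w' v v'
  proof -
    obtain z where "z \<in> A w" "z \<in> A v" using meet set_\<phi>[OF w] set_\<phi>[OF v] by blast
    then have z: "z \<in> Z" "mnorm (w' ** z - mat 1) < 1 / 2" "mnorm (v' ** z - mat 1) < 1 / 2"
      by (auto simp: A_def deviation_def gl_inv_eq[OF w] gl_inv_eq[OF v])
    obtain z' where z': "inverse_pair z z'" using Z(1) z(1) unfolding separated_def by meson
    have "inverse_pair (v' ** z) (z' ** v)" using v z' by (intro inverse_pair_mult inverse_pair_sym[OF v])
    then have "mnorm (z' ** v - mat 1) \<le> (1 / 2) / (1 - 1 / 2)" using z(3) by (intro mnorm_inverse) auto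
    then have "mnorm (z' ** v) \<le> ?R + 1" "mnorm (w' ** z) \<le> ?R + 1"
      using mnorm_le_deviation[of "z' ** v"] mnorm_le_deviation[of "w' ** z"] z(2) by auto
    then have "mnorm ((w' ** z) ** (z' ** v)) \<le> (?R + 1) * (?R + 1)"
      by (intro order_trans[OF mnorm_mult[of "w' ** z" "z' ** v"]] mult_mono) (auto simp: mnorm_nonneg)
    moreover have "(w' ** z) ** (z' ** v) = w' ** (z ** (z' ** v))" by (simp only: matrix_mul_assoc)
    ultimately show ?thesis by (intro mbound_mnorm) (simp add: inverse_pair_cancel(1)[OF z'])
  qed
  have "real_abs.gl_sampling \<phi>"
    unfolding real_abs.gl_sampling_def
  proof (rule conjI, intro allI impI)
    show "\<exists>D\<ge>0. \<forall>w w' v v'. inverse_pair w w' \<longrightarrow> inverse_pair v v' \<longrightarrow>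
        set_pmf (\<phi> w) \<inter> set_pmf (\<phi> v) \<noteq> {} \<longrightarrow> real_abs.mbound D (w' ** v)"
      by (intro exI[of _ "(?R + 1) * (?R + 1)"] conjI allI impI loc) auto
  qed (rule cont)
  then show ?thesis by blast
qed

section \<open>The special linear group over the integers\<close>

lemma finite_vectors:
  assumes "finite A"
  shows "finite {v :: 'a ^ 'n::finite. \<forall>i. v $ i \<in> A}"
proof -
  have "{v :: 'a ^ 'n. \<forall>i. v $ i \<in> A} \<subseteq> vec_lambda ` (\<Pi>\<^sub>E i\<in>UNIV. A)"
  proof
    fix v :: "'a ^ 'n" assume "v \<in> {v. \<forall>i. v $ i \<in> A}"
    then show "v \<in> vec_lambda ` (\<Pi>\<^sub>E i\<in>UNIV. A)"
      by (intro image_eqI[of _ _ "vec_nth v"]) auto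
  qed
  then show ?thesis by (rule finite_subset) (intro finite_imageI finite_PiE, auto simp: assms)
qed

lemma finite_matrices:
  assumes "finite A"
  shows "finite {M :: 'a ^ 'n::finite ^ 'm::finite. \<forall>i j. M $ i $ j \<in> A}"
  using finite_vectors[OF finite_vectors[OF assms], where 'n = 'm] by simp

lemma mult_elementary_matrix:
  "(A ** elementary_matrix k l c) $ i $ j = A $ i $ j + (if j = l then A $ i $ k * c else 0)"
proof -
  have "(A ** elementary_matrix k l c) $ i $ j =
      (\<Sum>m\<in>UNIV. (if m = j then A $ i $ m else 0) + (if m = k then if j = l then A $ i $ m * c else 0 else 0))"
    unfolding mult_matrix_nth by (intro sum.cong) (auto simp: elementary_matrix_def mat_nth distrib_left)
  then show ?thesis by (simp add: sum.distrib)
qed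

lemma elementary_matrix_nth:
  "elementary_matrix k l c $ i $ j = (if i = j then 1 else 0) + (if i = k \<and> j = l then c else 0)"
  by (simp add: elementary_matrix_def mat_nth)

lemma elementary_matrix_add:
  "k \<noteq> l \<Longrightarrow> elementary_matrix k l a ** elementary_matrix k l b = elementary_matrix k l (a + b)"
  by (auto simp: vec_eq_iff mult_elementary_matrix elementary_matrix_nth)

lemma elementary_matrix_0: "elementary_matrix k l 0 = mat 1"
  by (simp add: vec_eq_iff elementary_matrix_nth mat_nth)

lemma inverse_pair_elementary: "k \<noteq> l \<Longrightarrow> inverse_pair (elementary_matrix k l c) (elementary_matrix k l (- c))"
  by (simp add: inverse_pair_def elementary_matrix_add elementary_matrix_0)

lemma det_elementary_matrix:
  assumes "k \<noteq> l"
  shows "det (elementary_matrix k l c) = 1"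
proof -
  have "elementary_matrix k l c = (\<chi> i. if i = k then row k (mat 1) + c *s row l (mat 1) else row i (mat 1))"
    using assms by (auto simp: vec_eq_iff elementary_matrix_nth mat_nth row_def)
  then show ?thesis using det_row_operation[OF assms, of "mat 1" c] by (simp add: det_I)
qed

text \<open>
  Elementary matrices and diagonal sign matrices belong to this finite set. Inverses with small
  entries are part of the definition, so that the words in these generators are known to be
  invertible before \<open>SL\<^sub>d(\<int>)\<close> is known to be a group.
\<close>

definition SL_generators :: "(int ^ 'd::finite ^ 'd) set" where
  "SL_generators = {M. det M = 1 \<and> (\<forall>i j. M $ i $ j \<in> {-1, 0, 1}) \<and>
     (\<exists>N. (\<forall>i j. N $ i $ j \<in> {-1, 0, 1}) \<and> inverse_pair M N)}"

inductive_set SL_words :: "(int ^ 'd::finite ^ 'd) set" where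
  one: "mat 1 \<in> SL_words"
| mult: "s \<in> SL_generators \<Longrightarrow> w \<in> SL_words \<Longrightarrow> s ** w \<in> SL_words"

lemma det_inverse_pair:
  fixes M :: "int ^ 'd::finite ^ 'd"
  assumes "inverse_pair M N" "det M = 1"
  shows "det N = 1"
  using assms det_mul[of M N] by (simp add: inverse_pair_def det_I)

lemma SL_generators_inverse:
  assumes "s \<in> SL_generators"
  obtains s' where "s' \<in> SL_generators" "inverse_pair s s'"
  using assms det_inverse_pair inverse_pair_sym unfolding SL_generators_def by blast

lemma SL_words_mult: "v \<in> SL_words \<Longrightarrow> w \<in> SL_words \<Longrightarrow> v ** w \<in> SL_words"
  by (induction rule: SL_words.induct) (auto simp: matrix_mul_lid matrix_mul_assoc[symmetric] intro: SL_words.mult)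

lemma SL_generators_words: "s \<in> SL_generators \<Longrightarrow> s \<in> SL_words"
  using SL_words.mult[OF _ SL_words.one] by (simp add: matrix_mul_rid)

lemma SL_words_inverse: "w \<in> SL_words \<Longrightarrow> \<exists>w'\<in>SL_words. inverse_pair w w'"
proof (induction rule: SL_words.induct)
  case one
  then show ?case using SL_words.one inverse_pair_one by blast
next
  case (mult s w)
  then obtain w' where w': "w' \<in> SL_words" "inverse_pair w w'" by blast
  obtain s' where s': "s' \<in> SL_generators" "inverse_pair s s'" using SL_generators_inverse[OF mult.hyps(1)] .
  have "inverse_pair (s ** w) (w' ** s')" using s'(2) w'(2) by (rule inverse_pair_mult)
  then show ?case using SL_words_mult[OF w'(1) SL_generators_words[OF s'(1)]] by blast
qed

lemma SL_words_det: "w \<in> SL_words \<Longrightarrow> det w = 1"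
  by (induction rule: SL_words.induct) (auto simp: det_I det_mul SL_generators_def)

lemma elementary_in_SL_words:
  fixes k l :: "'d::finite"
  assumes "k \<noteq> l"
  shows "elementary_matrix k l c \<in> SL_words"
proof -
  have gen: "elementary_matrix k l e \<in> SL_generators" if "e \<in> {-1, 1}" for e
    unfolding SL_generators_def
    using that assms inverse_pair_elementary[OF assms, of e] det_elementary_matrix[OF assms, of e]
    by (auto intro!: exI[of _ "elementary_matrix k l (- e)"] simp: elementary_matrix_nth split: if_splits)
  show ?thesis
  proof (induction c rule: int_induct[where k = 0])
    case base
    then show ?case by (simp add: elementary_matrix_0 SL_words.one)
  next
    case (step1 c)
    then show ?case using SL_words.mult[OF gen[of 1] step1(2)] assms by (simp add: elementary_matrix_add add.commute)
  next
    case (step2 c)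
    then show ?case using SL_words.mult[OF gen[of "-1"] step2(2)] assms by (simp add: elementary_matrix_add)
  qed
qed

definition unit_rows :: "'d set \<Rightarrow> int ^ 'd::finite ^ 'd \<Rightarrow> bool" where
  "unit_rows S M \<longleftrightarrow> (\<forall>l\<in>S. \<bar>M $ l $ l\<bar> = 1 \<and> (\<forall>j. j \<noteq> l \<longrightarrow> M $ l $ j = 0))"

lemma unit_rows_elementary:
  "unit_rows S M \<Longrightarrow> k \<notin> S \<Longrightarrow> k \<noteq> l \<Longrightarrow> unit_rows S (M ** elementary_matrix k l c)"
  unfolding unit_rows_def
proof
  fix m assume M: "\<forall>l\<in>S. \<bar>M $ l $ l\<bar> = 1 \<and> (\<forall>j. j \<noteq> l \<longrightarrow> M $ l $ j = 0)" "k \<notin> S" "m \<in> S"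
  then have "M $ m $ k = 0" by metis
  then show "\<bar>(M ** elementary_matrix k l c) $ m $ m\<bar> = 1 \<and>
      (\<forall>j. j \<noteq> m \<longrightarrow> (M ** elementary_matrix k l c) $ m $ j = 0)"
    using M by (auto simp: mult_elementary_matrix)
qed

text \<open>
  The Euclidean algorithm on the columns outside \<open>S\<close>: as long as two entries of row \<open>i\<close> are
  nonzero, the larger one can be decreased in absolute value. Column operations with these columns do not
  affect the rows in \<open>S\<close>, which vanish there.
\<close>

lemma euclid_row:
  fixes M :: "int ^ 'd::finite ^ 'd"
  assumes "unit_rows S M" "i \<notin> S"
  shows "\<exists>w\<in>SL_words. unit_rows S (M ** w) \<and> (\<forall>j. j \<notin> S \<longrightarrow> j \<noteq> i \<longrightarrow> (M ** w) $ i $ j = 0)"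
  using assms(1)
proof (induction "\<Sum>j\<in>- S. nat \<bar>M $ i $ j\<bar>" arbitrary: M rule: less_induct)
  case less
  show ?case
  proof (cases "\<exists>j l. j \<notin> S \<and> l \<notin> S \<and> j \<noteq> l \<and> M $ i $ j \<noteq> 0 \<and> M $ i $ l \<noteq> 0")
    case True
    then obtain j l where jl: "j \<notin> S" "l \<notin> S" "j \<noteq> l" "M $ i $ l \<noteq> 0" "\<bar>M $ i $ l\<bar> \<le> \<bar>M $ i $ j\<bar>"
      by (metis linear)
    define c where "c = - sgn (M $ i $ l) * sgn (M $ i $ j)"
    let ?N = "M ** elementary_matrix l j c"
    have c: "\<bar>M $ i $ j + M $ i $ l * c\<bar> < \<bar>M $ i $ j\<bar>"
      using jl(4,5) by (auto simp: c_def sgn_if abs_if split: if_splits)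
    have "(\<Sum>k\<in>- S. nat \<bar>?N $ i $ k\<bar>) < (\<Sum>k\<in>- S. nat \<bar>M $ i $ k\<bar>)"
    proof (rule sum_strict_mono_ex1)
      show "\<forall>k\<in>- S. nat \<bar>?N $ i $ k\<bar> \<le> nat \<bar>M $ i $ k\<bar>"
        using c by (auto simp: mult_elementary_matrix)
      show "\<exists>k\<in>- S. nat \<bar>?N $ i $ k\<bar> < nat \<bar>M $ i $ k\<bar>"
        using c jl by (intro bexI[of _ j]) (auto simp: mult_elementary_matrix)
    qed simp
    moreover have "unit_rows S ?N" using less.prems jl by (intro unit_rows_elementary) auto
    ultimately obtain w where w: "w \<in> SL_words" "unit_rows S (?N ** w)" "\<forall>j. j \<notin> S \<longrightarrow> j \<noteq> i \<longrightarrow> (?N ** w) $ i $ j = 0"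
      using less.hyps by blast
    have "elementary_matrix l j c ** w \<in> SL_words"
      using jl w(1) by (intro SL_words_mult elementary_in_SL_words) auto
    then show ?thesis using w(2,3) by (intro bexI[of _ "elementary_matrix l j c ** w"]) (auto simp: matrix_mul_assoc)
  next
    case unique: False
    show ?thesis
    proof (cases "\<exists>j. j \<notin> S \<and> j \<noteq> i \<and> M $ i $ j \<noteq> 0")
      case True
      then obtain j where j: "j \<notin> S" "j \<noteq> i" "M $ i $ j \<noteq> 0" by blast
      \<comment> \<open>Move the only nonzero entry from column \<open>j\<close> to column \<open>i\<close>.\<close>
      let ?w = "elementary_matrix j i 1 ** elementary_matrix i j (- 1)"
      have zero: "M $ i $ k = 0" if "k \<notin> S" "k \<noteq> j" for k using unique j that by blast
      have "?w \<in> SL_words" using j by (intro SL_words_mult elementary_in_SL_words) auto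
      moreover have "unit_rows S (M ** ?w)"
        unfolding matrix_mul_assoc using less.prems j assms(2) by (intro unit_rows_elementary) auto
      moreover have "(M ** ?w) $ i $ k = 0" if "k \<notin> S" "k \<noteq> i" for k
        unfolding matrix_mul_assoc using j that assms(2) zero by (auto simp: mult_elementary_matrix)
      ultimately show ?thesis by blast
    next
      case False
      then show ?thesis using less.prems SL_words.one by (intro bexI[of _ "mat 1"]) (auto simp: matrix_mul_rid)
    qed
  qed
qed

text \<open>
  Every nonzero term of the Leibniz expansion of the determinant belongs to a permutation that fixes
  \<open>S\<close> pointwise, hence also \<open>i\<close>; so the pivot divides the determinant.
\<close>

lemma pivot_unit:
  fixes M :: "int ^ 'd::finite ^ 'd"
  assumes "det M = 1" "unit_rows S M" "i \<notin> S" "\<And>j. j \<notin> S \<Longrightarrow> j \<noteq> i \<Longrightarrow> M $ i $ j = 0"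
  shows "\<bar>M $ i $ i\<bar> = 1"
proof -
  have "M $ i $ i dvd of_int (sign p) * (\<Prod>k\<in>UNIV. M $ k $ p k)" if p: "p permutes UNIV" for p
  proof (cases "p i = i")
    case True
    then have "M $ i $ i dvd (\<Prod>k\<in>UNIV. M $ k $ p k)"
      using dvd_prodI[of UNIV i "\<lambda>k. M $ k $ p k"] by simp
    then show ?thesis by simp
  next
    case False
    have "\<exists>k. M $ k $ p k = 0"
    proof (cases "p i \<in> S")
      case True
      have "p (p i) \<noteq> p i" using False permutes_inj[OF p] by (auto dest: injD)
      then show ?thesis using True assms(2) by (auto simp: unit_rows_def)
    qed (use False assms(4) in blast)
    then have "(\<Prod>k\<in>UNIV. M $ k $ p k) = 0" by (simp add: prod_zero_iff)
    then show ?thesis by (simp only: mult_zero_right dvd_0_right)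
  qed
  then have "M $ i $ i dvd det M" unfolding det_def by (intro dvd_sum) auto
  then show ?thesis using assms(1) by simp
qed

lemma clear_row:
  fixes M :: "int ^ 'd::finite ^ 'd"
  assumes "finite T" "T \<subseteq> S" "unit_rows S M" "i \<notin> S" "\<bar>M $ i $ i\<bar> = 1"
    "\<And>j. j \<notin> S \<Longrightarrow> j \<noteq> i \<Longrightarrow> M $ i $ j = 0"
  shows "\<exists>w\<in>SL_words. unit_rows S (M ** w) \<and> \<bar>(M ** w) $ i $ i\<bar> = 1 \<and>
    (\<forall>j. j \<notin> S - T \<longrightarrow> j \<noteq> i \<longrightarrow> (M ** w) $ i $ j = 0)"
  using assms(1,2)
proof (induction T rule: finite_induct)
  case empty
  then show ?case using assms SL_words.one by (intro bexI[of _ "mat 1"]) (auto simp: matrix_mul_rid)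
next
  case (insert t T)
  then obtain w where w: "w \<in> SL_words" "unit_rows S (M ** w)" "\<bar>(M ** w) $ i $ i\<bar> = 1"
    "\<And>j. j \<notin> S - T \<Longrightarrow> j \<noteq> i \<Longrightarrow> (M ** w) $ i $ j = 0" by auto
  let ?a = "(M ** w) $ i $ i"
  define c where "c = - ?a * (M ** w) $ i $ t"
  let ?w = "w ** elementary_matrix i t c"
  have it: "i \<noteq> t" using insert.prems assms(4) by auto
  have "?a * ?a = 1" using w(3) by (metis abs_mult_self_eq mult_1)
  then have "(M ** w) $ i $ t + ?a * c = 0" by (simp add: c_def mult.assoc[symmetric])
  then have "(M ** ?w) $ i $ j = 0" if "j \<notin> S - insert t T" "j \<noteq> i" for j
    unfolding matrix_mul_assoc mult_elementary_matrix using w(4)[of j] that by auto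
  moreover have "\<bar>(M ** ?w) $ i $ i\<bar> = 1"
    unfolding matrix_mul_assoc mult_elementary_matrix using it w(3) by simp
  moreover have "unit_rows S (M ** ?w)"
    unfolding matrix_mul_assoc using w(2) assms(4) it by (intro unit_rows_elementary) auto
  moreover have "?w \<in> SL_words" using w(1) it by (intro SL_words_mult elementary_in_SL_words) auto
  ultimately show ?case by blast
qed

lemma reduce_rows:
  fixes M :: "int ^ 'd::finite ^ 'd"
  assumes "finite S" "det M = 1"
  shows "\<exists>w\<in>SL_words. unit_rows S (M ** w)"
  using assms(1)
proof (induction S rule: finite_induct)
  case empty
  then show ?case using SL_words.one by (auto simp: unit_rows_def)
next
  case (insert i S)
  then obtain u where u: "u \<in> SL_words" "unit_rows S (M ** u)" by blast
  obtain v where v: "v \<in> SL_words" "unit_rows S (M ** u ** v)"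
      "\<And>j. j \<notin> S \<Longrightarrow> j \<noteq> i \<Longrightarrow> (M ** u ** v) $ i $ j = 0"
    using euclid_row[OF u(2) insert.hyps(2)] by blast
  have "det (M ** u ** v) = 1" using assms(2) SL_words_det[OF u(1)] SL_words_det[OF v(1)] by (simp add: det_mul)
  from pivot_unit[OF this v(2) insert.hyps(2) v(3)] have "\<bar>(M ** u ** v) $ i $ i\<bar> = 1" .
  from clear_row[OF insert.hyps(1) subset_refl v(2) insert.hyps(2) this v(3)]
  obtain w where w: "w \<in> SL_words" "unit_rows S (M ** u ** v ** w)" "\<bar>(M ** u ** v ** w) $ i $ i\<bar> = 1"
    "\<And>j. j \<noteq> i \<Longrightarrow> (M ** u ** v ** w) $ i $ j = 0" by auto
  have "unit_rows (insert i S) (M ** (u ** v ** w))"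
    using w(2-4) by (simp add: unit_rows_def matrix_mul_assoc)
  then show ?case using SL_words_mult u(1) v(1) w(1) by blast
qed

text \<open>
  When all rows are reduced, a diagonal matrix of signs remains.
\<close>

lemma SL_words_eq: "SL_words = {M :: int ^ 'd::finite ^ 'd. det M = 1}"
proof
  show "{M :: int ^ 'd ^ 'd. det M = 1} \<subseteq> SL_words"
  proof
    fix M :: "int ^ 'd ^ 'd" assume "M \<in> {M. det M = 1}"
    then have M: "det M = 1" by simp
    obtain w where w: "w \<in> SL_words" "unit_rows UNIV (M ** w)" using reduce_rows[of UNIV M] M by auto
    let ?D = "M ** w"
    have D: "?D = diag (\<lambda>i. ?D $ i $ i)" using w(2) by (auto simp: vec_eq_iff diag_nth unit_rows_def)
    have sq: "?D $ i $ i * ?D $ i $ i = 1" for i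
      using w(2) unfolding unit_rows_def by (metis UNIV_I abs_mult_self_eq mult_1)
    have "inverse_pair ?D ?D" by (subst (1 2) D) (rule inverse_pair_diag[OF sq])
    moreover have "det ?D = 1" using M SL_words_det[OF w(1)] by (simp add: det_mul)
    moreover have "?D $ i $ j \<in> {-1, 0, 1}" for i j
      using w(2) by (cases "i = j") (auto simp: unit_rows_def abs_if split: if_splits)
    ultimately have "?D \<in> SL_generators" unfolding SL_generators_def by blast
    then have D_words: "?D \<in> SL_words" by (rule SL_generators_words)
    obtain w' where w': "w' \<in> SL_words" "inverse_pair w w'" using SL_words_inverse[OF w(1)] by blast
    have "?D ** w' \<in> SL_words" using D_words w'(1) by (rule SL_words_mult)
    moreover have "?D ** w' = M"
      using w'(2) by (simp add: inverse_pair_def matrix_mul_assoc[symmetric] matrix_mul_rid)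
    ultimately show "M \<in> SL_words" by simp
  qed
qed (auto simp: SL_words_det)

lemma SL_simps:
  "carrier SL_int = {M. det M = 1}" "mult SL_int = (**)" "one SL_int = mat 1"
  by (simp_all add: SL_int_def)

lemma group_SL: "group (SL_int :: (int ^ 'd::finite ^ 'd) monoid)"
proof (rule groupI)
  fix M :: "int ^ 'd ^ 'd" assume "M \<in> carrier SL_int"
  then have "M \<in> SL_words" by (simp add: SL_words_eq SL_simps)
  then obtain N where "N \<in> SL_words" "inverse_pair M N" using SL_words_inverse by blast
  then show "\<exists>N\<in>carrier SL_int. N \<otimes>\<^bsub>SL_int\<^esub> M = \<one>\<^bsub>SL_int\<^esub>"
    by (intro bexI[of _ N]) (auto simp: SL_simps inverse_pair_def SL_words_det)
qed (auto simp: SL_simps det_mul det_I matrix_mul_assoc matrix_mul_lid)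

lemma finitely_generated_SL: "finitely_generated (SL_int :: (int ^ 'd::finite ^ 'd) monoid)"
proof -
  let ?G = "SL_int :: (int ^ 'd ^ 'd) monoid"
  interpret group ?G by (rule group_SL)
  have sub: "SL_generators \<subseteq> carrier ?G" by (auto simp: SL_simps SL_generators_def)
  have "finite (SL_generators :: (int ^ 'd ^ 'd) set)"
    by (rule finite_subset[OF _ finite_matrices[of "{-1, 0, 1}"]]) (auto simp: SL_generators_def)
  moreover have "w \<in> generate ?G SL_generators" if "w \<in> SL_words" for w
    using that
  proof induction
    case one
    then show ?case using generate.one[of ?G] by (simp add: SL_simps)
  next
    case (mult s w)
    then have "s \<otimes>\<^bsub>?G\<^esub> w \<in> generate ?G SL_generators" by (intro generate.eng[OF generate.incl])
    then show ?case by (simp add: SL_simps)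
  qed
  then have "carrier ?G \<subseteq> generate ?G SL_generators" using SL_words_eq by (auto simp: SL_simps)
  ultimately show ?thesis using sub by (intro finitely_generatedI)
qed

text \<open>
  A bounded set of real matrices contains only finitely many integer matrices.
\<close>

lemma exact_SL: "exact_group (SL_int :: (int ^ 'd::finite ^ 'd) monoid)"
proof -
  let ?G = "SL_int :: (int ^ 'd ^ 'd) monoid"
  interpret group ?G by (rule group_SL)
  define \<rho> :: "int ^ 'd ^ 'd \<Rightarrow> real ^ 'd ^ 'd" where "\<rho> M = (\<chi> i j. real_of_int (M $ i $ j))" for M
  have \<rho>: "\<rho> (M ** N) = \<rho> M ** \<rho> N" "\<rho> (mat 1) = mat 1" for M N
    by (auto simp: \<rho>_def vec_eq_iff mult_matrix_nth mat_nth)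
  obtain \<phi> :: "real ^ 'd ^ 'd \<Rightarrow> (real ^ 'd ^ 'd) pmf" where \<phi>: "real_abs.gl_sampling \<phi>"
    using gl_sampling_real by blast
  have fin: "finite {M \<in> carrier ?G. real_abs.mbound C (\<rho> M)}" for C
  proof -
    have "{M \<in> carrier ?G. real_abs.mbound C (\<rho> M)} \<subseteq> {M. \<forall>i j. M $ i $ j \<in> {- \<lceil>C\<rceil>..\<lceil>C\<rceil>}}"
    proof safe
      fix M i j assume "real_abs.mbound C (\<rho> M)"
      then have "\<bar>real_of_int (M $ i $ j)\<bar> \<le> C" by (simp add: real_abs.mbound_def \<rho>_def)
      then show "M $ i $ j \<in> {- \<lceil>C\<rceil>..\<lceil>C\<rceil>}" by simp linarith
    qed
    then show ?thesis by (rule finite_subset) (intro finite_matrices, simp)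
  qed
  show ?thesis
  proof (rule exact_groupI)
    fix F :: "(int ^ 'd ^ 'd) set" and \<epsilon> :: real
    assume F: "finite F" "F \<subseteq> carrier ?G" "\<epsilon> > 0"
    have "\<exists>(\<tau> :: int ^ 'd ^ 'd \<Rightarrow> (real ^ 'd ^ 'd) pmf) C. almost_invariant ?G \<epsilon> F \<tau> \<and>
        localized ?G {x \<in> carrier ?G. real_abs.mbound C (\<rho> x)} \<tau>"
      by (rule real_abs.gl_sampling_almost_invariant[OF group_SL _ _ \<phi> F]) (auto simp: SL_simps \<rho>)
    then show "\<exists>(\<tau> :: int ^ 'd ^ 'd \<Rightarrow> (real ^ 'd ^ 'd) pmf) E. finite E \<and> almost_invariant ?G \<epsilon> F \<tau> \<and> localized ?G E \<tau>"
      using fin by meson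
  qed
qed

section \<open>Ring homomorphisms on Laurent polynomials\<close>

definition coeff_extend :: "('v \<Rightarrow> 'k \<Rightarrow> 'b) \<Rightarrow> ('v \<Rightarrow>\<^sub>0 'k::zero) \<Rightarrow> 'b::comm_monoid_add" where
  "coeff_extend F p = (\<Sum>v\<in>Poly_Mapping.keys p. F v (Poly_Mapping.lookup p v))"

lemma poly_mapping_sum_single:
  fixes p :: "'v \<Rightarrow>\<^sub>0 'k::comm_monoid_add"
  shows "p = (\<Sum>v\<in>Poly_Mapping.keys p. Poly_Mapping.single v (Poly_Mapping.lookup p v))"
proof (rule poly_mapping_eqI)
  fix w
  have "Poly_Mapping.lookup (\<Sum>v\<in>Poly_Mapping.keys p. Poly_Mapping.single v (Poly_Mapping.lookup p v)) w =
      (\<Sum>v\<in>Poly_Mapping.keys p. if v = w then Poly_Mapping.lookup p v else 0)"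
    unfolding lookup_sum by (intro sum.cong) (auto simp: lookup_single)
  also have "\<dots> = Poly_Mapping.lookup p w" by (simp add: in_keys_iff)
  finally show "Poly_Mapping.lookup p w =
      Poly_Mapping.lookup (\<Sum>v\<in>Poly_Mapping.keys p. Poly_Mapping.single v (Poly_Mapping.lookup p v)) w" by simp
qed

text \<open>
  Data on the terms \<open>a x\<^sup>v\<close> that extend to a ring homomorphism on the monoid ring of \<open>'v\<close>. Both
  the monomial substitutions and the gradings below arise in this way.
\<close>

locale multiplicative_extension =
  fixes F :: "'v::comm_monoid_add \<Rightarrow> 'k::comm_ring_1 \<Rightarrow> 'b::comm_ring_1"
  assumes F_add: "F v (a + b) = F v a + F v b"
    and F_mult: "F (v + w) (a * b) = F v a * F w b"
    and F_one: "F 0 1 = 1"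
begin

lemma F_zero: "F v 0 = 0"
  using F_add[of v 0 0] by simp

lemma extend_superset:
  assumes "finite A" "Poly_Mapping.keys p \<subseteq> A"
  shows "coeff_extend F p = (\<Sum>v\<in>A. F v (Poly_Mapping.lookup p v))"
  unfolding coeff_extend_def
  using assms by (intro sum.mono_neutral_left) (auto simp: in_keys_iff F_zero)

lemma extend_zero: "coeff_extend F 0 = 0"
  by (simp add: coeff_extend_def)

lemma extend_single: "coeff_extend F (Poly_Mapping.single v a) = F v a"
  by (subst extend_superset[of "{v}"]) auto

lemma extend_add: "coeff_extend F (p + q) = coeff_extend F p + coeff_extend F q"
proof -
  let ?A = "Poly_Mapping.keys p \<union> Poly_Mapping.keys q"
  have "coeff_extend F (p + q) = (\<Sum>v\<in>?A. F v (Poly_Mapping.lookup (p + q) v))"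
    using Poly_Mapping.keys_add[of p q] by (intro extend_superset) auto
  also have "\<dots> = (\<Sum>v\<in>?A. F v (Poly_Mapping.lookup p v)) + (\<Sum>v\<in>?A. F v (Poly_Mapping.lookup q v))"
    by (simp add: lookup_add F_add sum.distrib)
  finally show ?thesis by (simp add: extend_superset[of ?A])
qed

lemma extend_sum: "coeff_extend F (sum f A) = (\<Sum>x\<in>A. coeff_extend F (f x))"
  by (induction A rule: infinite_finite_induct) (auto simp: extend_zero extend_add)

lemma extend_one: "coeff_extend F 1 = 1"
  using extend_single[of 0 1] by (simp add: F_one)

lemma extend_mult: "coeff_extend F (p * q) = coeff_extend F p * coeff_extend F q"
proof -
  let ?s = "\<lambda>p v. Poly_Mapping.single v (Poly_Mapping.lookup p v)"
  let ?K = "Poly_Mapping.keys"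
  have "p * q = (\<Sum>v\<in>?K p. ?s p v) * (\<Sum>w\<in>?K q. ?s q w)" using poly_mapping_sum_single by metis
  also have "\<dots> = (\<Sum>v\<in>?K p. \<Sum>w\<in>?K q. Poly_Mapping.single (v + w) (Poly_Mapping.lookup p v * Poly_Mapping.lookup q w))"
    by (simp add: sum_product mult_single)
  finally have "coeff_extend F (p * q) =
      (\<Sum>v\<in>?K p. \<Sum>w\<in>?K q. F v (Poly_Mapping.lookup p v) * F w (Poly_Mapping.lookup q w))"
    by (simp add: extend_sum extend_single F_mult)
  then show ?thesis by (simp add: coeff_extend_def sum_product)
qed

end

lemma monomial_act_eq: "monomial_act M = coeff_extend (\<lambda>v a. Poly_Mapping.single (M *v v) a)"
  by (simp add: fun_eq_iff monomial_act_def coeff_extend_def)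

interpretation monomial: multiplicative_extension "\<lambda>v a. Poly_Mapping.single (M *v v) a" for M :: "int ^ 'd::finite ^ 'd"
  by unfold_locales (auto simp: single_add mult_single matrix_vector_right_distrib)

lemma monomial_act_mult: "monomial_act (M ** N) p = monomial_act M (monomial_act N p)"
  unfolding monomial_act_eq
  by (subst (2) coeff_extend_def, simp add: monomial.extend_sum monomial.extend_single)
    (simp add: coeff_extend_def matrix_vector_mul_assoc)

lemma monomial_act_one: "monomial_act (mat 1) p = p"
  unfolding monomial_act_eq coeff_extend_def by (simp add: poly_mapping_sum_single[symmetric])

definition map_entries :: "('a \<Rightarrow> 'b) \<Rightarrow> 'a ^ 'm ^ 'n \<Rightarrow> 'b ^ 'm ^ 'n" where
  "map_entries f P = (\<chi> i j. f (P $ i $ j))"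

definition ring_map :: "('a::comm_ring_1 \<Rightarrow> 'b::comm_ring_1) \<Rightarrow> bool" where
  "ring_map f \<longleftrightarrow> f 1 = 1 \<and> (\<forall>x y. f (x + y) = f x + f y) \<and> (\<forall>x y. f (x * y) = f x * f y)"

lemma (in multiplicative_extension) ring_map_extend: "ring_map (coeff_extend F)"
  by (simp add: ring_map_def extend_one extend_add extend_mult)

lemma ring_map_simps:
  assumes "ring_map f"
  shows "f 0 = 0" "f 1 = 1" "f (x + y) = f x + f y" "f (x * y) = f x * f y" "f (sum g A) = (\<Sum>x\<in>A. f (g x))"
proof -
  show f: "f 1 = 1" "f (x + y) = f x + f y" "f (x * y) = f x * f y" for x y using assms by (auto simp: ring_map_def)
  have "f 0 + f 0 = f 0" using f(2)[of 0 0] by simp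
  then show z: "f 0 = 0" by simp
  show "f (sum g A) = (\<Sum>x\<in>A. f (g x))"
    by (induction A rule: infinite_finite_induct) (auto simp: z f)
qed

lemma map_entries_mult: "ring_map f \<Longrightarrow> map_entries f (P ** Q) = map_entries f P ** map_entries f Q"
  by (simp add: vec_eq_iff map_entries_def mult_matrix_nth ring_map_simps)

lemma map_entries_one: "ring_map f \<Longrightarrow> map_entries f (mat 1) = mat 1"
  by (simp add: vec_eq_iff map_entries_def mat_nth ring_map_simps)

lemma map_entries_elementary: "ring_map f \<Longrightarrow> map_entries f (elementary_matrix i j a) = elementary_matrix i j (f a)"
  by (simp add: vec_eq_iff map_entries_def elementary_matrix_nth ring_map_simps)

section \<open>Elementary groups\<close>

definition subring_set :: "'a::comm_ring_1 set \<Rightarrow> bool" where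
  "subring_set A \<longleftrightarrow> 0 \<in> A \<and> 1 \<in> A \<and> (\<forall>x\<in>A. - x \<in> A) \<and> (\<forall>x\<in>A. \<forall>y\<in>A. x + y \<in> A \<and> x * y \<in> A)"

lemma subring_sum: "subring_set A \<Longrightarrow> (\<And>x. x \<in> I \<Longrightarrow> f x \<in> A) \<Longrightarrow> sum f I \<in> A"
  by (induction I rule: infinite_finite_induct) (auto simp: subring_set_def)

lemma GL_over_simps:
  "carrier (GL_over A) = {P. (\<forall>i j. P $ i $ j \<in> A) \<and> (\<exists>Q. (\<forall>i j. Q $ i $ j \<in> A) \<and> inverse_pair P Q)}"
  "mult (GL_over A) = (**)" "one (GL_over A) = mat 1"
  by (auto simp: GL_over_def Let_def inverse_pair_def)

lemma group_GL_over:
  assumes A: "subring_set A"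
  shows "group (GL_over A :: ('a::comm_ring_1 ^ 'r::finite ^ 'r) monoid)"
proof (rule groupI)
  have m: "\<forall>i j. (P ** Q) $ i $ j \<in> A" if "\<forall>i j. P $ i $ j \<in> A" "\<forall>i j. Q $ i $ j \<in> A" for P Q :: "'a ^ 'r ^ 'r"
    unfolding mult_matrix_nth using A that by (auto intro!: subring_sum[OF A] simp: subring_set_def)
  show "P \<otimes>\<^bsub>GL_over A\<^esub> Q \<in> carrier (GL_over A)" if PQ: "P \<in> carrier (GL_over A)" "Q \<in> carrier (GL_over A)"
    for P Q :: "'a ^ 'r ^ 'r"
  proof -
    obtain P' Q' where "\<forall>i j. P' $ i $ j \<in> A" "inverse_pair P P'" "\<forall>i j. Q' $ i $ j \<in> A" "inverse_pair Q Q'"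
      using PQ by (auto simp: GL_over_simps)
    then have "inverse_pair (P ** Q) (Q' ** P')" "\<forall>i j. (Q' ** P') $ i $ j \<in> A"
      using m by (auto intro: inverse_pair_mult)
    then show ?thesis using m[of P Q] PQ by (auto simp: GL_over_simps)
  qed
  show "\<one>\<^bsub>GL_over A\<^esub> \<in> carrier (GL_over A :: ('a ^ 'r ^ 'r) monoid)"
    using A inverse_pair_one by (auto simp: GL_over_simps mat_nth subring_set_def intro!: exI[of _ "mat 1"])
  show "\<exists>Q\<in>carrier (GL_over A). Q \<otimes>\<^bsub>GL_over A\<^esub> P = \<one>\<^bsub>GL_over A\<^esub>" if P: "P \<in> carrier (GL_over A)" for P :: "'a ^ 'r ^ 'r"
  proof -
    obtain Q where "\<forall>i j. Q $ i $ j \<in> A" "inverse_pair P Q" using P by (auto simp: GL_over_simps)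
    then show ?thesis
      using P inverse_pair_sym by (intro bexI[of _ Q]) (auto simp: GL_over_simps inverse_pair_def)
  qed
qed (auto simp: GL_over_simps matrix_mul_assoc matrix_mul_lid)

abbreviation elementary_set :: "'a::comm_ring_1 set \<Rightarrow> ('a ^ 'r::finite ^ 'r) set" where
  "elementary_set A \<equiv> {elementary_matrix i j a | i j a. i \<noteq> j \<and> a \<in> A}"

lemma elementary_in_GL:
  assumes "subring_set A" "i \<noteq> j" "a \<in> A"
  shows "elementary_matrix i j a \<in> carrier (GL_over A)"
proof -
  have "\<forall>k l. elementary_matrix i j b $ k $ l \<in> A" if "b \<in> A" for b
    using that assms(1) by (auto simp: elementary_matrix_nth subring_set_def)
  then show ?thesis using assms inverse_pair_elementary[OF assms(2), of a]
    by (auto simp: GL_over_simps subring_set_def)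
qed

lemma EL_over_simps:
  "mult (EL_over A) = (**)" "one (EL_over A) = mat 1"
  by (simp_all add: EL_over_def GL_over_simps)

lemma carrier_EL_over:
  assumes "subring_set A"
  shows "carrier (EL_over A :: ('a::comm_ring_1 ^ 'r::finite ^ 'r) monoid) = generate (GL_over A) (elementary_set A)"
proof -
  have "elementary_set A \<subseteq> carrier (GL_over A :: ('a ^ 'r ^ 'r) monoid)" using elementary_in_GL[OF assms] by blast
  then have "carrier (GL_over A :: ('a ^ 'r ^ 'r) monoid) \<inter> elementary_set A = elementary_set A" by blast
  then show ?thesis by (simp add: EL_over_def carrier_subgroup_generated)
qed

lemma group_EL_over: "subring_set A \<Longrightarrow> group (EL_over A)"
  unfolding EL_over_def by (rule group.group_subgroup_generated[OF group_GL_over])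

lemma elementary_in_EL: "subring_set A \<Longrightarrow> i \<noteq> j \<Longrightarrow> a \<in> A \<Longrightarrow> elementary_matrix i j a \<in> carrier (EL_over A)"
  unfolding carrier_EL_over by (intro generate.incl) blast

lemma inv_EL_elementary:
  assumes "subring_set A" "i \<noteq> j" "a \<in> A"
  shows "inv\<^bsub>EL_over A\<^esub> (elementary_matrix i j a) = elementary_matrix i j (- a)"
proof (rule group.inv_equality[OF group_EL_over[OF assms(1)]])
  show "elementary_matrix i j (- a) \<otimes>\<^bsub>EL_over A\<^esub> elementary_matrix i j a = \<one>\<^bsub>EL_over A\<^esub>"
    using assms(2) by (simp add: EL_over_simps elementary_matrix_add elementary_matrix_0)
  show "elementary_matrix i j (- a) \<in> carrier (EL_over A)"
    using assms by (intro elementary_in_EL) (auto simp: subring_set_def)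
qed (rule elementary_in_EL[OF assms])

lemma EL_over_induct [consumes 2, case_names one elementary mult]:
  assumes "P \<in> carrier (EL_over A)" "subring_set A"
    and "Q (mat 1)" "\<And>i j a. i \<noteq> j \<Longrightarrow> a \<in> A \<Longrightarrow> Q (elementary_matrix i j a)"
    and "\<And>S T. S \<in> carrier (EL_over A) \<Longrightarrow> T \<in> carrier (EL_over A) \<Longrightarrow> Q S \<Longrightarrow> Q T \<Longrightarrow> Q (S ** T)"
  shows "Q P"
  using assms(1) unfolding carrier_EL_over[OF assms(2)]
proof (induction rule: generate.induct)
  case one
  then show ?case using assms(3) by (simp add: GL_over_simps)
next
  case (incl h)
  then show ?case using assms(4) by blast
next
  case (inv h)
  then obtain i j a where h: "h = elementary_matrix i j a" "i \<noteq> j" "a \<in> A" by blast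
  have "inv\<^bsub>GL_over A\<^esub> h = elementary_matrix i j (- a)"
    using h assms(2) elementary_in_GL[OF assms(2)]
    by (intro group.inv_equality[OF group_GL_over[OF assms(2)]])
      (auto simp: GL_over_simps(2,3) elementary_matrix_add elementary_matrix_0 subring_set_def)
  moreover have "- a \<in> A" using h assms(2) by (simp add: subring_set_def)
  ultimately show ?case using assms(4) h by simp
next
  case (eng S T)
  then show ?case using assms(5) by (simp add: carrier_EL_over[OF assms(2)] GL_over_simps)
qed

lemma map_entries_EL:
  assumes f: "ring_map f" and A: "subring_set A" and B: "subring_set B" and "f ` A \<subseteq> B" and P: "P \<in> carrier (EL_over A)"
  shows "map_entries f P \<in> carrier (EL_over B)"
  using P A
proof (induction rule: EL_over_induct)
  case one
  then show ?case using monoid.one_closed[OF group.is_monoid[OF group_EL_over[OF B]]] f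
    by (simp add: map_entries_one EL_over_simps)
next
  case (elementary i j a)
  then show ?case using assms(4) elementary_in_EL[OF B] by (auto simp: map_entries_elementary[OF f])
next
  case (mult S T)
  then show ?case using monoid.m_closed[OF group.is_monoid[OF group_EL_over[OF B]]] f
    by (fastforce simp: map_entries_mult EL_over_simps)
qed

lemma elementary_commutator:
  assumes "i \<noteq> j" "j \<noteq> k" "i \<noteq> k"
  shows "elementary_matrix i j a ** elementary_matrix j k b ** elementary_matrix i j (- a) ** elementary_matrix j k (- b) =
    elementary_matrix i k (a * b)"
  using assms by (auto simp: vec_eq_iff mult_elementary_matrix elementary_matrix_nth)

text \<open>
  The elements \<open>a\<close> of \<open>A\<close> for which all \<open>e\<^sub>i\<^sub>j(a)\<close> are words in the given generators are closed under
  addition, because \<open>e\<^sub>i\<^sub>j\<close> is additive, and under multiplication by the commutator formula, which needs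
  a third index.
\<close>

lemma finitely_generated_EL:
  fixes A T :: "'a::comm_ring_1 set"
  assumes A: "subring_set A" and T: "finite T" "T \<subseteq> A" and card: "CARD('r::finite) \<ge> 3"
    and gen: "\<And>B. T \<subseteq> B \<Longrightarrow> (\<And>x y. x \<in> B \<Longrightarrow> y \<in> B \<Longrightarrow> x + y \<in> B \<and> x * y \<in> B) \<Longrightarrow> A \<subseteq> B"
  shows "finitely_generated (EL_over A :: ('a ^ 'r ^ 'r) monoid)"
proof -
  let ?G = "EL_over A :: ('a ^ 'r ^ 'r) monoid"
  interpret group ?G by (rule group_EL_over[OF A])
  let ?S = "elementary_set T :: ('a ^ 'r ^ 'r) set"
  have sub: "?S \<subseteq> carrier ?G" using elementary_in_EL[OF A] T(2) by blast
  interpret Q: subgroup "generate ?G ?S" ?G by (rule generate_is_subgroup[OF sub])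
  define B where "B = {a \<in> A. \<forall>i j :: 'r. i \<noteq> j \<longrightarrow> elementary_matrix i j a \<in> generate ?G ?S}"
  have Bneg: "elementary_matrix i j (- a) \<in> generate ?G ?S" if "a \<in> B" "i \<noteq> j" for a and i j :: 'r
  proof -
    have "inv\<^bsub>?G\<^esub> (elementary_matrix i j a) \<in> generate ?G ?S" using that by (intro Q.m_inv_closed) (auto simp: B_def)
    then show ?thesis using that A by (simp add: inv_EL_elementary B_def)
  qed
  have AB: "A \<subseteq> B"
  proof (rule gen)
    show "T \<subseteq> B" using T(2) by (auto simp: B_def intro!: generate.incl)
    fix x y assume xy: "x \<in> B" "y \<in> B"
    then have xyA: "x + y \<in> A" "x * y \<in> A" using A by (auto simp: B_def subring_set_def)
    have "elementary_matrix i j (x + y) \<in> generate ?G ?S" if "i \<noteq> j" for i j :: 'r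
    proof -
      have "elementary_matrix i j x \<otimes>\<^bsub>?G\<^esub> elementary_matrix i j y \<in> generate ?G ?S"
        using xy that by (intro Q.m_closed) (auto simp: B_def)
      then show ?thesis using that by (simp add: EL_over_simps elementary_matrix_add)
    qed
    moreover have "elementary_matrix i k (x * y) \<in> generate ?G ?S" if "i \<noteq> k" for i k :: 'r
    proof -
      have "card {i, k} < CARD('r)" using card that by simp
      then have "UNIV \<noteq> {i, k}" by auto
      then obtain j where j: "j \<noteq> i" "j \<noteq> k" by blast
      have "elementary_matrix i j x \<otimes>\<^bsub>?G\<^esub> elementary_matrix j k y \<otimes>\<^bsub>?G\<^esub> elementary_matrix i j (- x)
          \<otimes>\<^bsub>?G\<^esub> elementary_matrix j k (- y) \<in> generate ?G ?S"
        using xy j Bneg by (intro Q.m_closed) (auto simp: B_def)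
      then show ?thesis using that j elementary_commutator[of i j k x y] by (simp add: EL_over_simps)
    qed
    ultimately show "x + y \<in> B \<and> x * y \<in> B" using xyA by (simp add: B_def)
  qed
  have "P \<in> generate ?G ?S" if "P \<in> carrier ?G" for P
    using that A
  proof (induction rule: EL_over_induct)
    case one
    then show ?case using Q.one_closed by (simp add: EL_over_simps)
  next
    case (elementary i j a)
    then show ?case using AB by (auto simp: B_def)
  next
    case (mult P R)
    then show ?case using Q.m_closed[of P R] by (simp add: EL_over_simps)
  qed
  then have "carrier ?G \<subseteq> generate ?G ?S" by blast
  moreover have "finite ?S"
  proof (rule finite_subset)
    show "?S \<subseteq> (\<lambda>(i, j, a). elementary_matrix i j a) ` (UNIV \<times> UNIV \<times> T)" by force
  qed (use T(1) in simp)
  ultimately show ?thesis using sub by (intro finitely_generatedI)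
qed


section \<open>Generators of the polynomial rings\<close>

lemma subring_UNIV: "subring_set UNIV"
  by (simp add: subring_set_def)

lemma keys_polynomials_mult: "p \<in> polynomials \<Longrightarrow> q \<in> polynomials \<Longrightarrow> p * q \<in> polynomials"
  unfolding polynomials_def using Poly_Mapping.keys_mult[of p q] by fastforce

lemma subring_polynomials: "subring_set polynomials"
proof -
  have "x + y \<in> polynomials" if "x \<in> polynomials" "y \<in> polynomials" for x y :: "('k::comm_ring_1, 'd::finite) laurent"
    using that Poly_Mapping.keys_add[of x y] unfolding polynomials_def by blast
  moreover have "- x \<in> polynomials" if "x \<in> polynomials" for x :: "('k::comm_ring_1, 'd::finite) laurent"
    using that unfolding polynomials_def by (auto simp: in_keys_iff)
  moreover have "0 \<in> polynomials" "1 \<in> polynomials"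
    by (auto simp: polynomials_def)
  ultimately show ?thesis unfolding subring_set_def using keys_polynomials_mult by blast
qed

definition laurent_monom :: "int ^ 'd::finite \<Rightarrow> ('k::comm_ring_1, 'd) laurent" where
  "laurent_monom v = Poly_Mapping.single v 1"

lemma laurent_monom_add: "laurent_monom (v + w) = laurent_monom v * laurent_monom w"
  by (simp add: laurent_monom_def mult_single)

lemma laurent_monom_0: "laurent_monom 0 = 1"
  by (simp add: laurent_monom_def)

lemma axis_add: "axis i (a + b) = axis i a + (axis i b :: int ^ 'd::finite)"
  by (simp add: vec_eq_iff axis_def)

lemma vec_sum_axis: "v = (\<Sum>i\<in>UNIV. axis i (v $ i))" for v :: "int ^ 'd::finite"
  by (simp add: vec_eq_iff axis_def if_distrib cong: if_cong)

lemma laurent_monom_in_closed: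
  fixes B :: "('k::comm_ring_1, 'd::finite) laurent set"
  assumes one: "1 \<in> B" and mult: "\<And>x y. x \<in> B \<Longrightarrow> y \<in> B \<Longrightarrow> x * y \<in> B"
    and axis: "\<And>i. laurent_monom (axis i 1) \<in> B"
    and v: "\<And>i. v $ i < 0 \<Longrightarrow> laurent_monom (axis i (- 1)) \<in> B"
  shows "laurent_monom v \<in> B"
proof -
  have pow: "laurent_monom (axis i (e * int n)) \<in> B" if "laurent_monom (axis i e) \<in> B" for i e n
  proof (induction n)
    case 0
    have "axis i 0 = (0 :: int ^ 'd)" by (simp add: vec_eq_iff axis_def)
    then show ?case using one by (simp only: of_nat_0 mult_zero_right laurent_monom_0)
  next
    case (Suc n)
    have "laurent_monom (axis i (e * int (Suc n))) = laurent_monom (axis i e) * (laurent_monom (axis i (e * int n)) :: ('k, 'd) laurent)"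
      by (simp add: laurent_monom_add[symmetric] axis_add[symmetric] distrib_left)
    then show ?case using Suc mult that by simp
  qed
  have coord: "laurent_monom (axis i (v $ i)) \<in> B" for i
  proof (cases "v $ i < 0")
    case True
    then show ?thesis using pow[OF v[OF True], of "nat (- (v $ i))"] by simp
  next
    case False
    then show ?thesis using pow[OF axis, of i "nat (v $ i)"] by simp
  qed
  have "laurent_monom (\<Sum>i\<in>I. axis i (v $ i)) \<in> B" if "finite I" for I
    using that by (induction I rule: finite_induct) (auto simp: laurent_monom_0 one laurent_monom_add intro: mult coord)
  then show ?thesis using vec_sum_axis[of v] by (metis finite_class.finite_UNIV)
qed

lemma laurent_in_closed:
  fixes p :: "('k::comm_ring_1, 'd::finite) laurent"
  assumes const: "\<And>c. Poly_Mapping.single 0 c \<in> B" and add: "\<And>x y. x \<in> B \<Longrightarrow> y \<in> B \<Longrightarrow> x + y \<in> B \<and> x * y \<in> B"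
    and keys: "\<And>v. v \<in> Poly_Mapping.keys p \<Longrightarrow> laurent_monom v \<in> B"
  shows "p \<in> B"
proof -
  have "Poly_Mapping.single v c \<in> B" if "v \<in> Poly_Mapping.keys p" for v c
  proof -
    have "Poly_Mapping.single v c = Poly_Mapping.single 0 c * laurent_monom v" by (simp add: laurent_monom_def mult_single)
    then show ?thesis using add[OF const keys[OF that], of c] by simp
  qed
  moreover have "0 \<in> B" using const[of 0] by simp
  ultimately have "(\<Sum>v\<in>I. Poly_Mapping.single v (Poly_Mapping.lookup p v)) \<in> B" if "I \<subseteq> Poly_Mapping.keys p" for I
    using that add finite_subset[OF that finite_keys]
    by (induction I rule: infinite_finite_induct) auto
  then show ?thesis using poly_mapping_sum_single[of p] by (metis subset_refl)
qed

lemma finitely_generated_EL_polynomials: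
  assumes "finite (UNIV :: 'k::field set)" "CARD('r::finite) \<ge> 3"
  shows "finitely_generated (EL_over polynomials :: (('k, 'd::finite) laurent ^ 'r ^ 'r) monoid)"
proof (rule finitely_generated_EL[OF subring_polynomials _ _ assms(2)])
  let ?T = "range (Poly_Mapping.single 0) \<union> range (\<lambda>i. laurent_monom (axis i 1)) :: ('k, 'd) laurent set"
  show "finite ?T" using assms(1) by simp
  show "?T \<subseteq> polynomials" by (auto simp: polynomials_def laurent_monom_def axis_def split: if_splits)
  fix B :: "('k, 'd) laurent set"
  assume T: "?T \<subseteq> B" and cl: "\<And>x y. x \<in> B \<Longrightarrow> y \<in> B \<Longrightarrow> x + y \<in> B \<and> x * y \<in> B"
  have const: "Poly_Mapping.single 0 c \<in> B" and ax: "laurent_monom (axis i 1) \<in> B" for c i using T by auto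
  have one: "1 \<in> B" using const[of 1] by simp
  show "polynomials \<subseteq> B"
  proof
    fix p :: "('k, 'd) laurent" assume p: "p \<in> polynomials"
    show "p \<in> B"
    proof (rule laurent_in_closed[OF const cl])
      fix v assume "v \<in> Poly_Mapping.keys p"
      then have nonneg: "\<not> v $ i < 0" for i using p by (simp add: polynomials_def not_less)
      show "laurent_monom v \<in> B"
        by (rule laurent_monom_in_closed[OF one cl[THEN conjunct2] ax]) (use nonneg in blast)+
    qed
  qed
qed

lemma finitely_generated_EL_laurent:
  assumes "finite (UNIV :: 'k::field set)" "CARD('r::finite) \<ge> 3"
  shows "finitely_generated (EL_over UNIV :: (('k, 'd::finite) laurent ^ 'r ^ 'r) monoid)"
proof (rule finitely_generated_EL[OF subring_UNIV _ _ assms(2)])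
  let ?T = "range (Poly_Mapping.single 0) \<union> range (\<lambda>i. laurent_monom (axis i 1)) \<union> range (\<lambda>i. laurent_monom (axis i (- 1))) :: ('k, 'd) laurent set"
  show "finite ?T" using assms(1) by simp
  show "?T \<subseteq> UNIV" by simp
  fix B :: "('k, 'd) laurent set"
  assume T: "?T \<subseteq> B" and cl: "\<And>x y. x \<in> B \<Longrightarrow> y \<in> B \<Longrightarrow> x + y \<in> B \<and> x * y \<in> B"
  have const: "Poly_Mapping.single 0 c \<in> B" and ax: "laurent_monom (axis i 1) \<in> B" "laurent_monom (axis i (- 1)) \<in> B" for c i
    using T by auto
  have one: "1 \<in> B" using const[of 1] by simp
  have "laurent_monom v \<in> B" for v
    by (rule laurent_monom_in_closed[OF one cl[THEN conjunct2] ax])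
  then show "UNIV \<subseteq> B" using laurent_in_closed[OF const cl] by blast
qed

section \<open>Exactness of the elementary group over the Laurent polynomial ring\<close>

text \<open>
  The product of finitely many families of measures is localized in the intersection of the
  individual sets; only this intersection has to be finite.
\<close>

lemma exact_group_finite_product:
  fixes G :: "('a, 'b) monoid_scheme" (structure) and B :: "'i \<Rightarrow> real \<Rightarrow> 'a set"
  assumes G: "group G" and I: "finite I"
    and rel: "\<And>i F \<epsilon>. i \<in> I \<Longrightarrow> finite F \<Longrightarrow> F \<subseteq> carrier G \<Longrightarrow> \<epsilon> > 0 \<Longrightarrow>
      \<exists>(\<tau> :: 'a \<Rightarrow> 'y pmf) C. almost_invariant G \<epsilon> F \<tau> \<and> localized G (B i C) \<tau>"
    and fin: "\<And>C. finite {x \<in> carrier G. \<forall>i\<in>I. x \<in> B i (C i)}"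
  shows "exact_group G"
proof -
  interpret group G by fact
  obtain cs where cs: "set cs = I" "distinct cs" using finite_distinct_list[OF I] by blast
  show ?thesis
  proof (rule exact_groupI)
    fix F :: "'a set" and \<epsilon> :: real
    assume F: "finite F" "F \<subseteq> carrier G" "\<epsilon> > 0"
    define \<delta> where "\<delta> = \<epsilon> / (real (length cs) + 1)"
    have \<delta>: "\<delta> > 0" using F(3) by (simp add: \<delta>_def add_nonneg_pos)
    have "\<exists>(\<tau> :: 'a \<Rightarrow> 'y list pmf) C. almost_invariant G (real (length js) * \<delta>) F \<tau> \<and>
        localized G {x \<in> carrier G. \<forall>i\<in>set js. x \<in> B i (C i)} \<tau>" if "set js \<subseteq> I" "distinct js" for js
      using that
    proof (induction js)
      case Nil
      show ?case
        by (intro exI[of _ "\<lambda>_. return_pmf []"] exI[of _ "\<lambda>_. 0"])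
          (auto simp: almost_invariant_def localized_def pmf_close_refl)
    next
      case (Cons j js)
      then obtain \<tau> :: "'a \<Rightarrow> 'y list pmf" and C where \<tau>: "almost_invariant G (real (length js) * \<delta>) F \<tau>"
        "localized G {x \<in> carrier G. \<forall>i\<in>set js. x \<in> B i (C i)} \<tau>" by auto
      have "j \<in> I" using Cons.prems by simp
      from rel[OF this F(1,2) \<delta>] obtain \<sigma> :: "'a \<Rightarrow> 'y pmf" and c where \<sigma>: "almost_invariant G \<delta> F \<sigma>"
        "localized G (B j c) \<sigma>" by blast
      define \<nu> where "\<nu> x = bind_pmf (\<sigma> x) (\<lambda>z. map_pmf ((#) z) (\<tau> x))" for x
      have "almost_invariant G (real (length (j # js)) * \<delta>) F \<nu>"
        unfolding almost_invariant_def
      proof (intro ballI)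
        fix x s assume xs: "x \<in> carrier G" "s \<in> F"
        have "pmf_close \<delta> (\<nu> x) (bind_pmf (\<sigma> (x \<otimes> s)) (\<lambda>z. map_pmf ((#) z) (\<tau> x)))"
          unfolding \<nu>_def using \<sigma>(1) xs by (intro pmf_close_bind_left) (simp add: almost_invariant_def)
        moreover have "pmf_close (real (length js) * \<delta>) (bind_pmf (\<sigma> (x \<otimes> s)) (\<lambda>z. map_pmf ((#) z) (\<tau> x))) (\<nu> (x \<otimes> s))"
          unfolding \<nu>_def using \<tau>(1) xs \<delta> by (intro pmf_close_bind_right pmf_close_map) (simp_all add: almost_invariant_def)
        ultimately have "pmf_close (\<delta> + real (length js) * \<delta>) (\<nu> x) (\<nu> (x \<otimes> s))" by (rule pmf_close_trans)
        then show "pmf_close (real (length (j # js)) * \<delta>) (\<nu> x) (\<nu> (x \<otimes> s))" by (simp add: distrib_right add.commute)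
      qed
      moreover have "localized G {x \<in> carrier G. \<forall>i\<in>set (j # js). x \<in> B i ((C(j := c)) i)} \<nu>"
        unfolding localized_def
      proof (intro ballI impI)
        fix x y assume xy: "x \<in> carrier G" "y \<in> carrier G" "set_pmf (\<nu> x) \<inter> set_pmf (\<nu> y) \<noteq> {}"
        then have "set_pmf (\<sigma> x) \<inter> set_pmf (\<sigma> y) \<noteq> {}" "set_pmf (\<tau> x) \<inter> set_pmf (\<tau> y) \<noteq> {}"
          by (auto simp: \<nu>_def)
        then have "inv x \<otimes> y \<in> B j c" "inv x \<otimes> y \<in> {x \<in> carrier G. \<forall>i\<in>set js. x \<in> B i (C i)}"
          using \<sigma>(2) \<tau>(2) xy(1,2) unfolding localized_def by blast+
        then show "inv x \<otimes> y \<in> {x \<in> carrier G. \<forall>i\<in>set (j # js). x \<in> B i ((C(j := c)) i)}"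
          using Cons.prems(2) by auto
      qed
      ultimately show ?case by blast
    qed
    from this[of cs] obtain \<tau> :: "'a \<Rightarrow> 'y list pmf" and C where \<tau>: "almost_invariant G (real (length cs) * \<delta>) F \<tau>"
        "localized G {x \<in> carrier G. \<forall>i\<in>I. x \<in> B i (C i)} \<tau>" using cs by auto
    have "real (length cs) * \<delta> \<le> \<epsilon>"
    proof -
      have "real (length cs) * \<delta> \<le> (real (length cs) + 1) * \<delta>" using \<delta> by simp
      then show ?thesis by (simp add: \<delta>_def)
    qed
    then have "almost_invariant G \<epsilon> F \<tau>" using \<tau>(1) pmf_close_mono unfolding almost_invariant_def by blast
    then show "\<exists>(\<tau> :: 'a \<Rightarrow> 'y list pmf) E. finite E \<and> almost_invariant G \<epsilon> F \<tau> \<and> localized G E \<tau>"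
      using \<tau>(2) fin by blast
  qed
qed

definition fls_nrm :: "'f::field fls \<Rightarrow> real" where
  "fls_nrm f = (if f = 0 then 0 else (1 / 2) powi fls_subdegree f)"

interpretation fls_abs: nonarchimedean "fls_nrm :: 'f::field fls \<Rightarrow> real" fls_X
proof -
  have ultra: "fls_nrm (f + g) \<le> max (fls_nrm f) (fls_nrm g)" for f g :: "'f fls"
  proof (cases "f = 0 \<or> g = 0 \<or> f + g = 0")
    case False
    then have "min (fls_subdegree f) (fls_subdegree g) \<le> fls_subdegree (f + g)" by (intro fls_plus_subdegree) auto
    then have "(1 / 2 :: real) powi fls_subdegree (f + g) \<le> (1 / 2) powi min (fls_subdegree f) (fls_subdegree g)"
      by (intro power_int_decreasing) auto
    then show ?thesis using False by (auto simp: fls_nrm_def min_def split: if_splits)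
  qed (auto simp: fls_nrm_def max_def)
  have nonneg: "0 \<le> fls_nrm f" for f :: "'f fls" by (simp add: fls_nrm_def)
  show "nonarchimedean (fls_nrm :: 'f fls \<Rightarrow> real) fls_X"
  proof
    show "fls_nrm (f + g) \<le> fls_nrm f + fls_nrm g" for f g :: "'f fls"
      using ultra[of f g] nonneg[of f] nonneg[of g] by linarith
    show "fls_nrm (f * g) = fls_nrm f * fls_nrm g" for f g :: "'f fls"
      by (simp add: fls_nrm_def power_int_add)
  qed (use ultra in \<open>auto simp: fls_nrm_def\<close>)
qed

text \<open>
  Embeds \<open>\<int>\<^sup>d\<close> into a linearly ordered group. The group algebra of an ordered group is an integral
  domain, and its field of fractions supplies the coefficients of the Laurent series below.
\<close>

definition exponent :: "int ^ 'd::finite \<Rightarrow> (nat \<Rightarrow>\<^sub>0 int)" where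
  "exponent v = (\<Sum>i\<in>UNIV. Poly_Mapping.single (pos i) (v $ i))"

lemma lookup_exponent: "Poly_Mapping.lookup (exponent v) (pos i) = v $ i"
proof -
  have "Poly_Mapping.lookup (exponent v) (pos i) = (\<Sum>j\<in>UNIV. if j = i then v $ j else 0)"
    unfolding exponent_def lookup_sum by (intro sum.cong) (auto simp: lookup_single when_def)
  then show ?thesis by simp
qed

lemma exponent_inject: "exponent v = exponent w \<longleftrightarrow> v = w"
  using lookup_exponent by (metis vec_eq_iff)

lemma exponent_add: "exponent (v + w) = exponent v + exponent w"
  by (simp add: exponent_def single_add sum.distrib)

lemma exponent_0: "exponent 0 = 0"
  by (simp add: exponent_def)

text \<open>
  The term \<open>a x\<^sup>v\<close> goes to \<open>a x\<^sup>v T\<^bsup>s v\<^esup>\<close>: the monomial is kept in the coefficient and its degree is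
  recorded by the series variable \<open>T\<close>. Keeping the monomials prevents terms of the same degree from
  cancelling.
\<close>

definition graded_term :: "(int ^ 'd::finite \<Rightarrow> int) \<Rightarrow> int ^ 'd \<Rightarrow> 'k::field \<Rightarrow> ((nat \<Rightarrow>\<^sub>0 int) \<Rightarrow>\<^sub>0 'k) fract fls" where
  "graded_term s v a = fls_shift (- s v) (fls_const (to_fract (Poly_Mapping.single (exponent v) a)))"

lemma multiplicative_graded_term:
  assumes "\<And>v w. s (v + w) = s v + s w"
  shows "multiplicative_extension (graded_term s :: int ^ 'd::finite \<Rightarrow> 'k::field \<Rightarrow> _)"
proof
  have s0: "s 0 = 0" using assms[of 0 0] by simp
  show "graded_term s v (a + b) = graded_term s v a + graded_term s v b" for v and a b :: 'k
    by (simp add: graded_term_def single_add fls_plus_const fls_shift_plus[symmetric])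
  show "graded_term s (v + w) (a * b) = graded_term s v a * graded_term s w b" for v w and a b :: 'k
    by (simp add: graded_term_def assms exponent_add mult_single[symmetric] fls_shifted_times_simps add.commute)
  show "graded_term s 0 1 = 1" by (simp add: graded_term_def s0 exponent_0)
qed

abbreviation "grading s \<equiv> coeff_extend (graded_term s)"

text \<open>
  The coefficient of \<open>T\<^bsup>s v\<^esup>\<close> is the homogeneous part of degree \<open>s v\<close>, and distinct monomials are
  linearly independent.
\<close>

lemma grading_nth_nonzero:
  fixes p :: "('k::field, 'd::finite) laurent"
  assumes "v \<in> Poly_Mapping.keys p"
  shows "fls_nth (grading s p) (s v) \<noteq> 0"
proof -
  let ?A = "{w \<in> Poly_Mapping.keys p. s w = s v}"
  let ?q = "\<Sum>w\<in>?A. Poly_Mapping.single (exponent w) (Poly_Mapping.lookup p w)"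
  have "fls_nth (grading s p) (s v) =
      (\<Sum>w\<in>Poly_Mapping.keys p. if s w = s v then to_fract (Poly_Mapping.single (exponent w) (Poly_Mapping.lookup p w)) else 0)"
    unfolding coeff_extend_def fls_nth_sum by (intro sum.cong) (auto simp: graded_term_def)
  also have "\<dots> = to_fract ?q" unfolding to_fract_sum by (rule sum.inter_filter[symmetric]) simp
  finally have eq: "fls_nth (grading s p) (s v) = to_fract ?q" .
  have "Poly_Mapping.lookup ?q (exponent v) = (\<Sum>w\<in>?A. if w = v then Poly_Mapping.lookup p w else 0)"
    unfolding lookup_sum by (intro sum.cong) (auto simp: lookup_single when_def exponent_inject)
  also have "\<dots> = Poly_Mapping.lookup p v" using assms by (subst sum.delta) auto
  finally have "?q \<noteq> 0" using assms by (metis in_keys_iff lookup_zero)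
  then show ?thesis unfolding eq to_fract_eq_0_iff .
qed

lemma grading_lower_bound:
  fixes p :: "('k::field, 'd::finite) laurent"
  assumes "v \<in> Poly_Mapping.keys p" "fls_nrm (grading s p) \<le> 2 ^ N"
  shows "- int N \<le> s v"
proof (rule ccontr)
  assume "\<not> - int N \<le> s v"
  moreover have "fls_subdegree (grading s p) \<le> s v" by (rule fls_subdegree_leI[OF grading_nth_nonzero[OF assms(1)]])
  ultimately have "fls_subdegree (grading s p) \<le> - int (Suc N)" by simp
  then have "(1 / 2 :: real) powi (- int (Suc N)) \<le> (1 / 2) powi fls_subdegree (grading s p)"
    by (intro power_int_decreasing) auto
  moreover have "grading s p \<noteq> 0" using grading_nth_nonzero[OF assms(1), of s] by auto
  ultimately have "(1 / 2 :: real) powi (- int (Suc N)) \<le> 2 ^ N" using assms(2) by (simp add: fls_nrm_def)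
  moreover have "(1 / 2 :: real) powi (- int (Suc N)) = 2 ^ Suc N"
    by (simp only: power_int_minus power_int_of_nat) (simp add: power_divide)
  ultimately show False by simp
qed

lemma finite_laurent_box:
  assumes "finite (UNIV :: 'k::zero set)" "finite K"
  shows "finite {p :: 'v \<Rightarrow>\<^sub>0 'k. Poly_Mapping.keys p \<subseteq> K}"
proof (rule inj_on_finite[where f = Poly_Mapping.lookup])
  show "inj_on Poly_Mapping.lookup {p :: 'v \<Rightarrow>\<^sub>0 'k. Poly_Mapping.keys p \<subseteq> K}"
    by (rule inj_onI) (simp only: poly_mapping_eq_iff)
  show "Poly_Mapping.lookup ` {p :: 'v \<Rightarrow>\<^sub>0 'k. Poly_Mapping.keys p \<subseteq> K} \<subseteq>
      {f. \<forall>x. (x \<in> K \<longrightarrow> f x \<in> UNIV) \<and> (x \<notin> K \<longrightarrow> f x = 0)}"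
  proof safe
    fix p :: "'v \<Rightarrow>\<^sub>0 'k" and x assume "Poly_Mapping.keys p \<subseteq> K" "x \<notin> K"
    then have "x \<notin> Poly_Mapping.keys p" by blast
    then show "Poly_Mapping.lookup p x = 0" by (simp add: in_keys_iff)
  qed simp
  show "finite {f :: 'v \<Rightarrow> 'k. \<forall>x. (x \<in> K \<longrightarrow> f x \<in> UNIV) \<and> (x \<notin> K \<longrightarrow> f x = 0)}"
    by (rule finite_set_of_finite_funs[OF assms(2,1)])
qed

text \<open>
  The index \<open>(i, e)\<close> stands for the degree in \<open>x\<^sub>i\<close>, with the sign \<open>e\<close>.
\<close>

lemma exact_EL_laurent:
  assumes "finite (UNIV :: 'k::field set)"
  shows "exact_group (EL_over UNIV :: (('k, 'd::finite) laurent ^ 'r::finite ^ 'r) monoid)"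
proof -
  let ?G = "EL_over UNIV :: (('k, 'd) laurent ^ 'r ^ 'r) monoid"
  define s :: "'d \<times> int \<Rightarrow> int ^ 'd \<Rightarrow> int" where "s = (\<lambda>(i, e) v. e * v $ i)"
  define I :: "('d \<times> int) set" where "I = UNIV \<times> {1, - 1}"
  define \<rho> :: "'d \<times> int \<Rightarrow> ('k, 'd) laurent ^ 'r ^ 'r \<Rightarrow> _" where "\<rho> c = map_entries (grading (s c))" for c
  define B where "B c C = {P \<in> carrier ?G. fls_abs.mbound C (\<rho> c P)}" for c C
  have rm: "ring_map (grading (s c) :: ('k, 'd) laurent \<Rightarrow> _)" for c
    by (intro multiplicative_extension.ring_map_extend multiplicative_graded_term)
      (simp add: s_def case_prod_beta distrib_left)
  show ?thesis
  proof (rule exact_group_finite_product[where I = I and B = B])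
    show "group ?G" by (rule group_EL_over[OF subring_UNIV])
    show "finite I" by (simp add: I_def)
    fix c F and \<epsilon> :: real assume F: "finite F" "F \<subseteq> carrier ?G" "\<epsilon> > 0"
    show "\<exists>(\<tau> :: ('k, 'd) laurent ^ 'r ^ 'r \<Rightarrow>
        (((nat \<Rightarrow>\<^sub>0 int) \<Rightarrow>\<^sub>0 'k) fract fls ^ 'r ^ 'r) set pmf) C. almost_invariant ?G \<epsilon> F \<tau> \<and> localized ?G (B c C) \<tau>"
      unfolding B_def
      by (rule fls_abs.gl_sampling_almost_invariant[OF group_EL_over[OF subring_UNIV] _ _ fls_abs.gl_sampling_lattice F])
        (simp_all add: \<rho>_def EL_over_simps map_entries_mult[OF rm] map_entries_one[OF rm])
  next
    fix C :: "'d \<times> int \<Rightarrow> real"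
    \<comment> \<open>A common bound for all gradings; it confines the exponents to the box \<open>[-N, N]\<close>.\<close>
    obtain N :: nat where "(\<Sum>c\<in>I. \<bar>C c\<bar>) < 2 ^ N" using real_arch_pow[of 2] by auto
    moreover have "C c \<le> (\<Sum>c\<in>I. \<bar>C c\<bar>)" if "c \<in> I" for c
      using member_le_sum[of c I "\<lambda>c. \<bar>C c\<bar>"] that by (simp add: I_def)
    ultimately have N: "C c \<le> 2 ^ N" if "c \<in> I" for c using that by fastforce
    let ?K = "{v :: int ^ 'd. \<forall>i. v $ i \<in> {- int N..int N}}"
    have "{P \<in> carrier ?G. \<forall>c\<in>I. P \<in> B c (C c)} \<subseteq> {P. \<forall>a b. P $ a $ b \<in> {p. Poly_Mapping.keys p \<subseteq> ?K}}"
    proof safe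
      fix P a b v i assume P: "\<forall>c\<in>I. P \<in> B c (C c)" and v: "v \<in> Poly_Mapping.keys (P $ a $ b)"
      have "- int N \<le> s c v" if "c \<in> I" for c
      proof (rule grading_lower_bound[OF v])
        have "fls_nrm (\<rho> c P $ a $ b) \<le> C c" using P that by (auto simp: B_def fls_abs.mbound_def)
        then show "fls_nrm (grading (s c) (P $ a $ b)) \<le> 2 ^ N" using N[OF that] by (simp add: \<rho>_def map_entries_def)
      qed
      from this[of "(i, 1)"] this[of "(i, - 1)"] show "v $ i \<in> {- int N..int N}" by (simp add: s_def I_def)
    qed
    moreover have "finite {P :: ('k, 'd) laurent ^ 'r ^ 'r. \<forall>a b. P $ a $ b \<in> {p. Poly_Mapping.keys p \<subseteq> ?K}}"
      by (intro finite_matrices finite_laurent_box assms finite_vectors) simp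
    ultimately show "finite {P \<in> carrier ?G. \<forall>c\<in>I. P \<in> B c (C c)}" by (rule finite_subset)
  qed
qed

section \<open>The semidirect product of the elementary and the special linear group\<close>

lemma semidirect_EL_SL:
  "semidirect (EL_over UNIV :: (('k::comm_ring_1, 'd::finite) laurent ^ 'r::finite ^ 'r) monoid) SL_int
     (\<lambda>M P. \<chi> i j. monomial_act M (P $ i $ j))"
  unfolding map_entries_def[symmetric]
proof (rule semidirect.intro)
  let ?H = "EL_over UNIV :: (('k, 'd) laurent ^ 'r ^ 'r) monoid"
  have rm: "ring_map (monomial_act M :: ('k, 'd) laurent \<Rightarrow> _)" for M :: "int ^ 'd ^ 'd"
    unfolding monomial_act_eq by (rule monomial.ring_map_extend)
  show "group ?H" by (rule group_EL_over[OF subring_UNIV])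
  show "group (SL_int :: (int ^ 'd ^ 'd) monoid)" by (rule group_SL)
  show "map_entries (monomial_act M) \<in> hom ?H ?H" for M :: "int ^ 'd ^ 'd"
    using map_entries_EL[OF rm subring_UNIV subring_UNIV]
    by (intro homI) (simp_all add: EL_over_simps map_entries_mult[OF rm])
  show "map_entries (monomial_act (M \<otimes>\<^bsub>SL_int\<^esub> N)) P = map_entries (monomial_act M) (map_entries (monomial_act N) P)"
    for M N :: "int ^ 'd ^ 'd" and P :: "('k, 'd) laurent ^ 'r ^ 'r"
    by (simp add: SL_simps map_entries_def monomial_act_mult)
  show "map_entries (monomial_act \<one>\<^bsub>SL_int\<^esub>) P = P" for P :: "('k, 'd) laurent ^ 'r ^ 'r"
    by (simp add: SL_simps map_entries_def monomial_act_one vec_eq_iff)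
qed

lemma group_EL_semidirect_SL:
  "group (EL_semidirect_SL :: ((('k::comm_ring_1, 'd::finite) laurent ^ 'r::finite ^ 'r) \<times> (int ^ 'd ^ 'd)) monoid)"
  unfolding EL_semidirect_SL_def by (rule semidirect.group_SD[OF semidirect_EL_SL])

lemma exact_EL_semidirect_SL:
  assumes "finite (UNIV :: 'k::field set)"
  shows "exact_group (EL_semidirect_SL :: ((('k, 'd::finite) laurent ^ 'r::finite ^ 'r) \<times> (int ^ 'd ^ 'd)) monoid)"
  unfolding EL_semidirect_SL_def
  by (rule semidirect.exact_SD[OF semidirect_EL_SL exact_EL_laurent[OF assms] exact_SL])

lemma finitely_generated_EL_semidirect_SL:
  assumes "finite (UNIV :: 'k::field set)" "CARD('r::finite) \<ge> 3"
  shows "finitely_generated (EL_semidirect_SL :: ((('k, 'd::finite) laurent ^ 'r ^ 'r) \<times> (int ^ 'd ^ 'd)) monoid)"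
proof -
  let ?H = "EL_over UNIV :: (('k, 'd) laurent ^ 'r ^ 'r) monoid"
  let ?act = "\<lambda>(M :: int ^ 'd ^ 'd) (P :: ('k, 'd) laurent ^ 'r ^ 'r). \<chi> i j. monomial_act M (P $ i $ j)"
  interpret semidirect ?H SL_int ?act by (rule semidirect_EL_SL)
  obtain T where T: "finite T" "T \<subseteq> carrier ?H" "generate ?H T = carrier ?H"
    by (rule finitely_generatedE[OF finitely_generated_EL_laurent[OF assms]])
  have "T \<subseteq> (\<Union>M\<in>carrier SL_int. ?act M ` T)"
  proof
    fix P assume P: "P \<in> T"
    then have "P = ?act \<one>\<^bsub>SL_int\<^esub> P" using T(2) act_one by auto
    then show "P \<in> (\<Union>M\<in>carrier SL_int. ?act M ` T)" using P K.one_closed by blast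
  qed
  then have "carrier ?H \<subseteq> generate ?H (\<Union>M\<in>carrier SL_int. ?act M ` T)"
    using T(3) H.mono_generate by blast
  then show ?thesis
    unfolding EL_semidirect_SL_def by (rule finitely_generated_SD[OF finitely_generated_SL T(1,2)])
qed

lemma polynomial_subgroup:
  "subgroup ((\<lambda>P. (P, mat 1)) ` carrier (EL_over polynomials))
     (EL_semidirect_SL :: ((('k::comm_ring_1, 'd::finite) laurent ^ 'r::finite ^ 'r) \<times> (int ^ 'd ^ 'd)) monoid)"
proof -
  let ?\<Gamma> = "EL_over polynomials :: (('k, 'd) laurent ^ 'r ^ 'r) monoid"
  let ?G = "EL_semidirect_SL :: ((('k, 'd) laurent ^ 'r ^ 'r) \<times> (int ^ 'd ^ 'd)) monoid"
  have "P \<in> carrier (EL_over UNIV)" if "P \<in> carrier ?\<Gamma>" for P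
    using map_entries_EL[OF _ subring_polynomials subring_UNIV _ that, of id]
    by (simp add: ring_map_def map_entries_def)
  then have "(\<lambda>P. (P, mat 1)) \<in> hom ?\<Gamma> ?G"
    by (intro homI)
      (auto simp: EL_semidirect_SL_def semidirect_product_def SL_simps EL_over_simps monomial_act_one matrix_mul_lid)
  then show ?thesis
    using group_EL_over[OF subring_polynomials] group_EL_semidirect_SL
    by (intro group_hom.img_is_subgroup) (simp add: group_hom_def group_hom_axioms_def)
qed

theorem proposition12p1:
  fixes q :: nat
    and \<Gamma> :: "(('k::field, 'd::finite) laurent ^ 'r::finite ^ 'r) monoid"
    and G :: "((('k, 'd) laurent ^ 'r ^ 'r) \<times> (int ^ 'd ^ 'd)) monoid"
    and \<iota> :: "('k, 'd) laurent ^ 'r ^ 'r \<Rightarrow> (('k, 'd) laurent ^ 'r ^ 'r) \<times> (int ^ 'd ^ 'd)"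
  assumes "primepow q" and "CARD('k) = q"
    and "CARD('r) \<ge> 3" and "CARD('d) \<ge> 3"
    and "\<Gamma> = EL_over polynomials"
    and "G = EL_semidirect_SL"
    and "\<iota> = (\<lambda>P. (P, mat 1))"
  shows "finitely_generated \<Gamma> \<and> finitely_generated G \<and>
    group_property_A (generalized_wreath_product (integer_mod_group 2) G (\<iota> ` carrier \<Gamma>)) \<and>
    group_property_A (amalgamated_free_product G G \<Gamma> \<iota> \<iota>)"
proof -
  have fin: "finite (UNIV :: 'k set)"
    using assms(1,2) primepow_gt_0_nat[of q] by (intro card_ge_0_finite) simp
  have G: "group G" "exact_group G" "finitely_generated G"
    unfolding assms(6)
    using group_EL_semidirect_SL exact_EL_semidirect_SL[OF fin] finitely_generated_EL_semidirect_SL[OF fin assms(3)]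
    by blast+
  have sub: "subgroup (\<iota> ` carrier \<Gamma>) G" unfolding assms(5-7) by (rule polynomial_subgroup)
  interpret wreath: wreath_Z2 G "\<iota> ` carrier \<Gamma>"
    by (intro wreath_Z2.intro wreath_Z2_axioms.intro G(1) sub)
  interpret double: double G \<Gamma> \<iota>
    by (intro double.intro double_axioms.intro G(1) sub)
  have "finitely_generated \<Gamma>" unfolding assms(5) by (rule finitely_generated_EL_polynomials[OF fin assms(3)])
  then show ?thesis
    using G(3) wreath.wreath_property_A[OF G(2,3)] double.amalgam_property_A[OF G(2,3)] by blast
qed

end
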